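(* Consider the aggregative game, with agents $i\in\mathcal I=\{1,\dots,N\}$ and affine aggregation, described in the context, and suppose that: (1) for each $i\in\mathcal I$, $\Omega_i\subseteq\mathbb R^{n_i}$ is closed and convex; $g_i:\mathbb R^{n_i}\to\mathbb R^m$ is componentwise convex and twice continuously differentiable; the set $\mathcal X=\Omega\cap\{x\in\mathbb R^n\mid g(x)\le \mathbf 0_m\}$ satisfies Slater's constraint qualification; $J_i$ is continuously differentiable and $J_i(\cdot,x_{-i})$ is convex for every $x_{-i}$; (2) the pseudo-gradient $F$ is $\mu$-strongly monotone for some $\mu>0$; (3) the communication graph $\mathcal G(\mathcal I,\mathcal E)$ is undirected and connected; (4) the mapping $\tilde{\boldsymbol F}$ is $\tilde\theta$-Lipschitz continuous for some $\tilde\theta>0$; let $\tilde\theta_\sigma\in(0,\tilde\theta]$ be such that $\tilde{\boldsymbol F}(x,\cdot)$ is $\tilde\theta_\sigma$-Lipschitz continuous for all $x\in\mathbb R^n$. Let $$c>\underline c:=\frac{\tilde\theta_\sigma^2}{4\mu\lambda_2(L)},$$ and consider the projected dynamical system in the variables $\mathrm{col}(x,\boldsymbol\varsigma,\boldsymbol z,\boldsymbol\lambda)\in\mathbb R^n\times\mathbb R^{N\bar n}\times\mathbb R^{Nm}\times\mathbb R^{Nm}$: $$\begin{aligned} \dot x&=\Pi_\Omega\big(x,\,-\tilde{\boldsymbol F}(x,\boldsymbol\sigma)-\mathbb G(x)^\top\boldsymbol\lambda-cB^\top\boldsymbol L_{\bar n}\boldsymbol\sigma\big),\\ \dot{\boldsymbol\varsigma}&=-c\boldsymbol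 L_{\bar n}\boldsymbol\sigma,\qquad\boldsymbol\sigma=\boldsymbol\psi(x)+\boldsymbol\varsigma,\\ \dot{\boldsymbol z}&=\boldsymbol L_m\boldsymbol\lambda,\\ \dot{\boldsymbol\lambda}&=\Pi_{\mathbb R^{Nm}_{\ge0}}\big(\boldsymbol\lambda,\,\boldsymbol g(x)-\boldsymbol z-\boldsymbol L_m\boldsymbol\lambda\big). \end{aligned}$$ Then, for any initial condition in $S=\Omega\times\boldsymbol E_{\bar n}^\perp\times\boldsymbol E_m^\perp\times\mathbb R^{mN}_{\ge0}$, the system has a unique Carathéodory solution (on $[0,\infty)$), which belongs to $S$ for all $t\ge0$. The solution converges to an equilibrium $\mathrm{col}(\bar x,\bar{\boldsymbol\varsigma},\bar{\boldsymbol z},\bar{\boldsymbol\lambda})$ with $\boldsymbol\psi(\bar x)+\bar{\boldsymbol\varsigma}=\mathbf 1_N\otimes\psi(\bar x)$, $\bar{\boldsymbol\lambda}=\mathbf 1_N\otimes\lambda^*$, where $(\bar x,\lambda^* )$ satisfies the KKT conditions $$\mathbf 0_n\in F(\bar x)+\tfrac{\partial}{\partial x}g(\bar x)^\top\lambda^*+\mathrm N_\Omega(\bar x),\qquad \mathbf 0_m\in -g(\bar x)+\mathrm N_{\mathbb R^m_{\ge0}}(\lambda^* );$$ hence $\bar x$ is the variational generalized Nash equilibrium (v-GNE) of the game.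
   Context: Game. Agent $i$ chooses $x_i\in\Omega_i\subseteq\mathbb R^{n_i}$; $n=\sum_i n_i$, $x=\mathrm{col}((x_i)_{i\in\mathcal I})$ (stacking), $x_{-i}=\mathrm{col}((x_j)_{j\ne i})$, $\Omega=\times_i\Omega_i\subseteq\mathbb R^n$. Agent $i$ has cost $J_i(x_i,x_{-i})\in\mathbb R$. The coupling constraints are $g(x):=\sum_{i}g_i(x_i)\le\mathbf 0_m$, with $g_i:\mathbb R^{n_i}\to\mathbb R^m$, and $\mathcal X=\Omega\cap\{x\mid g(x)\le\mathbf 0_m\}$. A generalized Nash equilibrium (GNE) is $x^*$ such that, for all $i$, $x_i^*\in\operatorname{argmin}_{y_i}J_i(y_i,x_{-i}^* )$ subject to $(y_i,x_{-i}^* )\in\mathcal X$. A v-GNE is a GNE whose individual KKT systems hold with equal dual variables for all agents, i.e. a point for which there is $\lambda^*$ such that the KKT conditions displayed in the claim hold. Aggregative structure (affine aggregation): $J_i(x_i,x_{-i})=f_i(x_i,\psi(x))$ with $f_i:\mathbb R^{n_i}\times\mathbb R^{\bar n}\to\mathbb R$ (differentiable), $\psi(x):=\frac1N\sum_i\psi_i(x_i)$, $\psi_i(x_i)=B_ix_i+d_i$, $B_i\in\mathbb R^{\bar n\times n_i}$, $d_i\in\mathbb R^{\bar n}$. $\boldsymbol\psi(x):=\mathrm{col}((\psi_i(x_i))_i)\in\mathbb R^{N\bar n}$, $B:=\mathrm{diag}((B_i)_i)$ (block diagonal). Pseudo-gradient: $F(x):=\mathrm{col}((\nabla_{x_i}J_i(x_i,x_{-i}))_{i\in\mathcal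 I})$; it is $\mu$-strongly monotone if $(F(x)-F(y))^\top(x-y)\ge\mu\|x-y\|^2$ for all $x,y$. Extended pseudo-gradient: for $\boldsymbol\sigma=\mathrm{col}((\sigma^i)_i)\in\mathbb R^{N\bar n}$, $\tilde{\boldsymbol F}(x,\boldsymbol\sigma):=\mathrm{col}((\nabla_{x_i}f_i(x_i,\sigma^i))_i)$, where by convention $\nabla_{x_i}f_i(x_i,\sigma^i):=\nabla_yf_i(y,\sigma^i)|_{y=x_i}+\frac1NB_i^\top\nabla_yf_i(x_i,y)|_{y=\sigma^i}$. Graph: $W$ is the symmetric adjacency matrix of $\mathcal G$ ($[W]_{i,j}=1$ if $(i,j)\in\mathcal E$, $0$ otherwise), $L$ its symmetric Laplacian, $\lambda_2(L)$ the second smallest eigenvalue of $L$; $\boldsymbol L_q:=L\otimes I_q$. Stacked variables: $\boldsymbol\varsigma=\mathrm{col}((\varsigma_i)_i)$ with $\varsigma_i\in\mathbb R^{\bar n}$, $\boldsymbol z=\mathrm{col}((z_i)_i)$, $\boldsymbol\lambda=\mathrm{col}((\lambda_i)_i)\in\mathbb R^{Nm}$. $\boldsymbol g(x):=\mathrm{col}((g_i(x_i))_i)$, $\mathbb G(x):=\frac{\partial}{\partial x}\boldsymbol g(x)=\mathrm{diag}((\frac{\partial}{\partial x_i}g_i(x_i))_i)$. $\boldsymbol E_q^\perp:=\{\boldsymbol y\in\mathbb R^{Nq}\mid(\mathbf 1_N^\top\otimes I_q)\boldsymbol y=\mathbf 0_q\}$. Convex analysis: for closed convex $S$, $\mathrm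 N_S(x)=\{v\mid\sup_{z\in S}v^\top(z-x)\le0\}$ is the normal cone, $\mathrm T_S(x)=\mathrm{cl}(\bigcup_{\delta>0}\frac1\delta(S-x))$ the tangent cone, and $\Pi_S(x,v):=\mathrm{proj}_{\mathrm T_S(x)}(v)$ (Euclidean projection). A Carathéodory solution is an absolutely continuous function with the given initial value satisfying the differential equation for almost all $t\ge0$. An equilibrium is a point where the right-hand side vanishes. *)

theory Defs
  imports "HOL-Analysis.Analysis"
begin

section \<open>Agents, blocks and stacked vectors\<close>

text \<open>
  The agents are the elements of a finite type \<open>'i\<close> (so \<open>N = CARD('i)\<close>). The coordinates of the
  stacked decision vector are indexed by \<open>'n\<close>, and \<open>own :: 'n \<Rightarrow> 'i\<close> tells which agent a coordinate
  belongs to; hence \<open>n\<^sub>i = card {k. own k = i}\<close> may differ from agent to agent. The space of the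
  decisions of agent \<open>i\<close> is the coordinate subspace \<open>range (blk own i)\<close> of \<open>real^'n\<close>, and a function
  of \<open>x\<^sub>i\<close> is a function on \<open>real^'n\<close> that is only ever evaluated on this subspace.
  A stack of \<open>N\<close> vectors of \<open>real^'q\<close> is an element of \<open>real^'q^'i\<close>; its inner product and its norm
  are those of the concatenated vector, and its order is the componentwise one.
\<close>

definition blk :: "('n::finite \<Rightarrow> 'i::finite) \<Rightarrow> 'i \<Rightarrow> real^'n \<Rightarrow> real^'n"
  where "blk own i x = (\<chi> k. if own k = i then x $ k else 0)"

text \<open>\<open>deviate own i y x\<close> is \<open>(y\<^sub>i, x\<^sub>-\<^sub>i)\<close>.\<close>

definition deviate :: "('n::finite \<Rightarrow> 'i::finite) \<Rightarrow> 'i \<Rightarrow> real^'n \<Rightarrow> real^'n \<Rightarrow> real^'n"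
  where "deviate own i y x = (\<chi> k. if own k = i then y $ k else x $ k)"

text \<open>\<open>kron_id A y\<close> is \<open>(A \<otimes> I\<^sub>q) y\<close>.\<close>

definition kron_id :: "real^'i^'i \<Rightarrow> real^'q^'i \<Rightarrow> real^'q^'i"
  where "kron_id A y = (\<chi> i. \<Sum>j\<in>UNIV. A $ i $ j *\<^sub>R y $ j)"

definition E_perp :: "(real^'q^'i) set"
  where "E_perp = {y. (\<Sum>i\<in>UNIV. y $ i) = 0}"


section \<open>Differential and convex notions\<close>

definition grad :: "('a::real_inner \<Rightarrow> real) \<Rightarrow> 'a \<Rightarrow> 'a"
  where "grad h x = (THE D. GDERIV h x :> D)"

definition C1 :: "('a::real_normed_vector \<Rightarrow> 'b::real_normed_vector) \<Rightarrow> bool"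
  where "C1 h \<longleftrightarrow> (\<exists>h' :: 'a \<Rightarrow> 'a \<Rightarrow>\<^sub>L 'b.
           (\<forall>x. (h has_derivative blinfun_apply (h' x)) (at x)) \<and> continuous_on UNIV h')"

definition C2 :: "('a::real_normed_vector \<Rightarrow> 'b::real_normed_vector) \<Rightarrow> bool"
  where "C2 h \<longleftrightarrow> (\<exists>h' :: 'a \<Rightarrow> 'a \<Rightarrow>\<^sub>L 'b.
           (\<forall>x. (h has_derivative blinfun_apply (h' x)) (at x)) \<and> C1 h')"

text \<open>The pointwise form of \<open>sup\<^bsub>z \<in> S\<^esub> v \<bullet> (z - x) \<le> 0\<close>. Membership \<open>x \<in> S\<close> is not part of the
  formula.\<close>

definition normal_cone :: "'a::real_inner set \<Rightarrow> 'a \<Rightarrow> 'a set"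
  where "normal_cone S x = {v. \<forall>z\<in>S. v \<bullet> (z - x) \<le> 0}"

definition tangent_cone :: "'a::real_normed_vector set \<Rightarrow> 'a \<Rightarrow> 'a set"
  where "tangent_cone S x = closure (\<Union>\<delta>\<in>{0<..}. (\<lambda>z. (1 / \<delta>) *\<^sub>R (z - x)) ` S)"

definition proj_vf :: "'a::euclidean_space set \<Rightarrow> 'a \<Rightarrow> 'a \<Rightarrow> 'a"
  where "proj_vf S x v = closest_point (tangent_cone S x) v"


section \<open>Graph\<close>

definition adjacency :: "('i::finite \<times> 'i) set \<Rightarrow> real^'i^'i"
  where "adjacency E = (\<chi> i j. if (i, j) \<in> E then 1 else 0)"

definition laplacian :: "('i::finite \<times> 'i) set \<Rightarrow> real^'i^'i"
  where "laplacian E =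
           (\<chi> i j. if i = j then (\<Sum>k\<in>UNIV. adjacency E $ i $ k) else 0) - adjacency E"

definition eigenspace :: "real^'i^'i \<Rightarrow> real \<Rightarrow> (real^'i) set"
  where "eigenspace A l = {v. A *v v = l *\<^sub>R v}"

definition eigenvalues :: "real^'i^'i \<Rightarrow> real set"
  where "eigenvalues A = {l. \<exists>v\<in>eigenspace A l. v \<noteq> 0}"

text \<open>Second smallest eigenvalue of a symmetric matrix, counted with multiplicity: the least
  eigenvalue such that at least two eigenvalues are not larger. By symmetry, the dimension of the
  eigenspace is also the algebraic multiplicity.\<close>

definition lambda2 :: "real^'i^'i \<Rightarrow> real"
  where "lambda2 A = Min {l \<in> eigenvalues A.
           2 \<le> (\<Sum>m | m \<in> eigenvalues A \<and> m \<le> l. dim (eigenspace A m))}"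


section \<open>The aggregative game\<close>

text \<open>The matrix \<open>M :: real^'n^'b\<close> is the block row \<open>[B\<^sub>1 \<dots> B\<^sub>N]\<close>: the columns of \<open>B\<^sub>i\<close> are those
  indexed by the coordinates of agent \<open>i\<close>. Thus \<open>B\<^sub>i x\<^sub>i\<close> is \<open>M *v blk own i x\<close>, and component \<open>k\<close>
  of \<open>B\<^sub>i\<^sup>T v\<close>, where \<open>own k = i\<close>, is \<open>(transpose M *v v) $ k\<close>.\<close>

definition joint :: "('n::finite \<Rightarrow> 'i::finite) \<Rightarrow> ('i \<Rightarrow> (real^'n) set) \<Rightarrow> (real^'n) set"
  where "joint own \<Omega> = {x. \<forall>i. blk own i x \<in> \<Omega> i}"

definition coupling :: "('n::finite \<Rightarrow> 'i::finite) \<Rightarrow> ('i \<Rightarrow> real^'n \<Rightarrow> real^'m) \<Rightarrow> real^'n \<Rightarrow> real^'m"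
  where "coupling own g x = (\<Sum>i\<in>UNIV. g i (blk own i x))"

definition coupling_stack ::
    "('n::finite \<Rightarrow> 'i::finite) \<Rightarrow> ('i \<Rightarrow> real^'n \<Rightarrow> real^'m) \<Rightarrow> real^'n \<Rightarrow> real^'m^'i"
  where "coupling_stack own g x = (\<chi> i. g i (blk own i x))"

definition feasible ::
    "('n::finite \<Rightarrow> 'i::finite) \<Rightarrow> ('i \<Rightarrow> (real^'n) set) \<Rightarrow> ('i \<Rightarrow> real^'n \<Rightarrow> real^'m) \<Rightarrow> (real^'n) set"
  where "feasible own \<Omega> g = joint own \<Omega> \<inter> {x. coupling own g x \<le> 0}"

definition B_diag :: "('n::finite \<Rightarrow> 'i::finite) \<Rightarrow> real^'n^'b \<Rightarrow> real^'n \<Rightarrow> real^'b^'i"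
  where "B_diag own M x = (\<chi> i. M *v blk own i x)"

definition psi_stack ::
    "('n::finite \<Rightarrow> 'i::finite) \<Rightarrow> real^'n^'b \<Rightarrow> ('i \<Rightarrow> real^'b) \<Rightarrow> real^'n \<Rightarrow> real^'b^'i"
  where "psi_stack own M d x = (\<chi> i. M *v blk own i x + d i)"

definition psi ::
    "('n::finite \<Rightarrow> 'i::finite) \<Rightarrow> real^'n^'b \<Rightarrow> ('i \<Rightarrow> real^'b) \<Rightarrow> real^'n \<Rightarrow> real^'b"
  where "psi own M d x = (1 / real CARD('i)) *\<^sub>R (\<Sum>i\<in>UNIV. psi_stack own M d x $ i)"

definition cost ::
    "('n::finite \<Rightarrow> 'i::finite) \<Rightarrow> real^'n^'b \<Rightarrow> ('i \<Rightarrow> real^'b) \<Rightarrow>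
     ('i \<Rightarrow> real^'n \<Rightarrow> real^'b \<Rightarrow> real) \<Rightarrow> 'i \<Rightarrow> real^'n \<Rightarrow> real"
  where "cost own M d f i x = f i (blk own i x) (psi own M d x)"

text \<open>Since \<open>deviate own i y x\<close> depends on \<open>y\<close> only through block \<open>i\<close>, the gradient below vanishes
  outside this block and restricts to \<open>\<nabla>\<^bsub>x\<^sub>i\<^esub> J\<^sub>i\<close> on it. The same holds for the first term of
  \<open>ext_pseudo_grad\<close>.\<close>

definition pseudo_grad ::
    "('n::finite \<Rightarrow> 'i::finite) \<Rightarrow> real^'n^'b \<Rightarrow> ('i \<Rightarrow> real^'b) \<Rightarrow>
     ('i \<Rightarrow> real^'n \<Rightarrow> real^'b \<Rightarrow> real) \<Rightarrow> real^'n \<Rightarrow> real^'n"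
  where "pseudo_grad own M d f x =
           (\<chi> k. grad (\<lambda>y. cost own M d f (own k) (deviate own (own k) y x)) x $ k)"

definition ext_pseudo_grad ::
    "('n::finite \<Rightarrow> 'i::finite) \<Rightarrow> real^'n^'b \<Rightarrow> ('i \<Rightarrow> real^'n \<Rightarrow> real^'b \<Rightarrow> real) \<Rightarrow>
     real^'n \<Rightarrow> real^'b^'i \<Rightarrow> real^'n"
  where "ext_pseudo_grad own M f x \<sigma> =
           (\<chi> k. let i = own k in
              (grad (\<lambda>y. f i (blk own i y) (\<sigma> $ i)) x
               + (1 / real CARD('i)) *\<^sub>R
                   (transpose M *v grad (\<lambda>s. f i (blk own i x) s) (\<sigma> $ i))) $ k)"

definition is_GNE ::
    "('n::finite \<Rightarrow> 'i::finite) \<Rightarrow> ('i \<Rightarrow> (real^'n) set) \<Rightarrow> ('i \<Rightarrow> real^'n \<Rightarrow> real^'m) \<Rightarrow>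
     real^'n^'b \<Rightarrow> ('i \<Rightarrow> real^'b) \<Rightarrow> ('i \<Rightarrow> real^'n \<Rightarrow> real^'b \<Rightarrow> real) \<Rightarrow> real^'n \<Rightarrow> bool"
  where "is_GNE own \<Omega> g M d f x \<longleftrightarrow>
           (\<forall>i. is_arg_min (\<lambda>y. cost own M d f i (deviate own i y x))
                  (\<lambda>y. deviate own i y x \<in> feasible own \<Omega> g) x)"

text \<open>The adjoint of the Frechet derivative is the transposed Jacobian. The first two conjuncts are
  the membership that is implicit in the use of the normal cones.\<close>

definition KKT ::
    "('n::finite \<Rightarrow> 'i::finite) \<Rightarrow> ('i \<Rightarrow> (real^'n) set) \<Rightarrow> ('i \<Rightarrow> real^'n \<Rightarrow> real^'m) \<Rightarrow>
     real^'n^'b \<Rightarrow> ('i \<Rightarrow> real^'b) \<Rightarrow> ('i \<Rightarrow> real^'n \<Rightarrow> real^'b \<Rightarrow> real) \<Rightarrow>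
     real^'n \<Rightarrow> real^'m \<Rightarrow> bool"
  where "KKT own \<Omega> g M d f x l \<longleftrightarrow>
           x \<in> joint own \<Omega> \<and> 0 \<le> l \<and>
           0 \<in> (\<lambda>v. pseudo_grad own M d f x
                     + adjoint (frechet_derivative (coupling own g) (at x)) l + v)
                ` normal_cone (joint own \<Omega>) x \<and>
           0 \<in> (\<lambda>v. - coupling own g x + v) ` normal_cone {0..} l"

definition is_vGNE ::
    "('n::finite \<Rightarrow> 'i::finite) \<Rightarrow> ('i \<Rightarrow> (real^'n) set) \<Rightarrow> ('i \<Rightarrow> real^'n \<Rightarrow> real^'m) \<Rightarrow>
     real^'n^'b \<Rightarrow> ('i \<Rightarrow> real^'b) \<Rightarrow> ('i \<Rightarrow> real^'n \<Rightarrow> real^'b \<Rightarrow> real) \<Rightarrow> real^'n \<Rightarrow> bool"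
  where "is_vGNE own \<Omega> g M d f x \<longleftrightarrow>
           is_GNE own \<Omega> g M d f x \<and> (\<exists>l. KKT own \<Omega> g M d f x l)"


section \<open>The projected dynamical system\<close>

text \<open>Here \<open>adjoint (B_diag own M)\<close> is \<open>B\<^sup>T\<close>, and the adjoint of the derivative of
  \<open>coupling_stack own g\<close> is the transpose of the block diagonal Jacobian.\<close>

definition dynamics ::
    "('n::finite \<Rightarrow> 'i::finite) \<Rightarrow> ('i \<Rightarrow> (real^'n) set) \<Rightarrow> ('i \<Rightarrow> real^'n \<Rightarrow> real^'m) \<Rightarrow>
     real^'n^'b \<Rightarrow> ('i \<Rightarrow> real^'b) \<Rightarrow> ('i \<Rightarrow> real^'n \<Rightarrow> real^'b \<Rightarrow> real) \<Rightarrow>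
     real^'i^'i \<Rightarrow> real \<Rightarrow>
     (real^'n) \<times> (real^'b^'i) \<times> (real^'m^'i) \<times> (real^'m^'i) \<Rightarrow>
     (real^'n) \<times> (real^'b^'i) \<times> (real^'m^'i) \<times> (real^'m^'i)"
  where "dynamics own \<Omega> g M d f L c = (\<lambda>(x, s, z, l).
           let \<sigma> = psi_stack own M d x + s in
           (proj_vf (joint own \<Omega>) x
              (- ext_pseudo_grad own M f x \<sigma>
               - adjoint (frechet_derivative (coupling_stack own g) (at x)) l
               - c *\<^sub>R adjoint (B_diag own M) (kron_id L \<sigma>)),
            - c *\<^sub>R kron_id L \<sigma>,
            kron_id L l,
            proj_vf {0..} l (coupling_stack own g x - z - kron_id L l)))"

definition state_set ::
    "('n::finite \<Rightarrow> 'i::finite) \<Rightarrow> ('i \<Rightarrow> (real^'n) set) \<Rightarrow>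
     ((real^'n) \<times> (real^'b^'i) \<times> (real^'m^'i) \<times> (real^'m^'i)) set"
  where "state_set own \<Omega> = joint own \<Omega> \<times> E_perp \<times> E_perp \<times> {0..}"

text \<open>Absolute continuity on a set of reals; a division is a finite family of non-overlapping
  compact intervals.\<close>

definition abs_cont_on :: "real set \<Rightarrow> (real \<Rightarrow> 'a::real_normed_vector) \<Rightarrow> bool"
  where "abs_cont_on S u \<longleftrightarrow> (\<forall>\<epsilon>>0. \<exists>\<delta>>0. \<forall>D T. D division_of T \<and> T \<subseteq> S \<and> (\<Sum>K\<in>D. Sup K - Inf K) < \<delta>
           \<longrightarrow> (\<Sum>K\<in>D. norm (u (Sup K) - u (Inf K))) < \<epsilon>)"

text \<open>On an unbounded time axis, absolute continuity is required on every compact interval. The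
  values \<open>u t\<close> for \<open>t < 0\<close> are irrelevant.\<close>

definition caratheodory_solution :: "('a::euclidean_space \<Rightarrow> 'a) \<Rightarrow> 'a \<Rightarrow> (real \<Rightarrow> 'a) \<Rightarrow> bool"
  where "caratheodory_solution \<Phi> u0 u \<longleftrightarrow>
           u 0 = u0 \<and> (\<forall>T\<ge>0. abs_cont_on {0..T} u) \<and>
           (AE t in lebesgue. 0 \<le> t \<longrightarrow> (u has_vector_derivative \<Phi> (u t)) (at t))"

end

theory Submission
  imports Defs "HOL-Complex_Analysis.Great_Picard"
begin

text \<open>
  The proof idea. On the state set, every equilibrium \<open>(x', \<varsigma>', z', \<lambda>')\<close> corresponds to a KKT pair, and
  \<open>|x - x'|\<^sup>2 + |\<varsigma> - \<varsigma>'|\<^sup>2 + (z - z') \<bullet> P (z - z') + |\<lambda> - \<lambda>'|\<^sup>2\<close>, where \<open>P\<close> inverts the Laplacian on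
  \<open>E_perp\<close>, decreases along trajectories: the terms of the constraints are monotone by convexity, the terms
  in \<open>z\<close> and \<open>\<lambda>\<close> cancel, and the disagreement of \<open>\<sigma>\<close> in \<open>x\<close> is absorbed by strong monotonicity and by
  \<open>c \<lambda>\<^sub>2(L)\<close>. Such an equilibrium exists, because the variational inequality of \<open>F\<close> on the feasible set is
  solvable and Slater's condition yields a multiplier. Bounded trajectories are limits of projected
  Euler schemes; being Lipschitz, they are differentiable almost everywhere, and their velocity is
  the projected field. Without dissipation, \<open>x\<close>, \<open>\<varsigma>\<close> and \<open>z\<close> are constant and every component of \<open>\<lambda>\<close>
  is monotone, hence convergent; so LaSalle's argument gives convergence to an equilibrium.
\<close>

text \<open>The projected right-hand side can jump at the boundary of the state set, and its
  constraint term couples the derivative of \<open>g\<close> with an unbounded multiplier, so Picard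
  iteration does not apply. Both obstacles are avoided by reading the equation as an inclusion: a
  continuous unprojected field minus the velocity lies in the normal cone. This inclusion survives
  the limit of Euler schemes, and its monotonicity turns a one-sided Lipschitz bound into
  uniqueness. The price is that curves are differentiable only almost everywhere, which is why
  covering arguments come before the dynamics. The factors \<open>E_perp\<close> of the state set
  are essential: a zero sum of the \<sigma>-corrections makes \<psi>(x) the only possible consensus
  value, and a zero sum of z turns the local residuals into a decomposition of g(x). The threshold
  for c is the discriminant condition of the form \<mu> a^2 - \<open>\<theta>\<^sub>\<sigma>\<close>
  a b + c \<lambda>2 b^2. Multipliers, unlike x, may be non-unique, so the Lyapunov function centred
  at a preselected equilibrium yields only boundedness; convergence needs it recentred at a limit
  point.\<close>

section \<open>Absolutely continuous functions\<close>

text \<open>Replaces the fundamental theorem of calculus: only the sign of the derivative enters, so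
  no integrability has to be discussed. A fine tagged division is split by its tags. Tags outside
  the null set give increments controlled by the derivative; tags inside it give intervals of small
  total length, controlled by absolute continuity.\<close>

lemma abs_cont_on_nonincreasing:
  fixes \<phi> :: "real \<Rightarrow> real"
  assumes ac: "abs_cont_on {a..b} \<phi>" and ab: "a \<le> b"
    and der: "AE t in lebesgue. a \<le> t \<and> t \<le> b \<longrightarrow> (\<exists>D\<le>0. (\<phi> has_real_derivative D) (at t))"
  shows "\<phi> b \<le> \<phi> a"
proof -
  have "\<phi> b - \<phi> a \<le> e * (b - a) + e" if e: "e > 0" for e
  proof -
    obtain \<delta> where \<delta>: "\<delta> > 0"
      and small: "\<And>D T. D division_of T \<Longrightarrow> T \<subseteq> {a..b} \<Longrightarrow> (\<Sum>K\<in>D. Sup K - Inf K) < \<delta>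
                    \<Longrightarrow> (\<Sum>K\<in>D. norm (\<phi> (Sup K) - \<phi> (Inf K))) < e"
      using ac e unfolding abs_cont_on_def by meson
    obtain N where N: "N \<in> null_sets lebesgue"
      and dN: "\<And>t. t \<in> {a..b} \<Longrightarrow> t \<notin> N \<Longrightarrow> \<exists>D\<le>0. (\<phi> has_real_derivative D) (at t)"
    proof (rule AE_E3[OF der])
      fix N assume "\<And>t. t \<in> space lebesgue - N \<Longrightarrow> a \<le> t \<and> t \<le> b \<longrightarrow> (\<exists>D\<le>0. (\<phi> has_real_derivative D) (at t))"
        "N \<in> null_sets lebesgue"
      then show thesis using that[of N] by simp
    qed
    obtain U where U: "open U" "N \<subseteq> U" "emeasure lebesgue (U - N) < ennreal \<delta>"
      using sets_lebesgue_outer_open[of N \<delta>] N \<delta> by (metis null_setsD2)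
    have Um: "U \<in> sets lebesgue" using U(1) by (simp add: borel_open)
    have "emeasure lebesgue U = emeasure lebesgue (U - N)"
      by (rule emeasure_Diff_null_set[OF N Um, symmetric])
    with U have emU: "emeasure lebesgue U < ennreal \<delta>" by simp
    \<comment> \<open>The two sides of \<open>t\<close> are estimated separately, so that an
      interval of the division can be cut at its tag.\<close>
    have "\<exists>r>0. \<forall>y. \<bar>y - t\<bar> < r \<longrightarrow>
             (t \<le> y \<longrightarrow> \<phi> y - \<phi> t \<le> e * (y - t)) \<and> (y \<le> t \<longrightarrow> \<phi> t - \<phi> y \<le> e * (t - y))"
      if t: "t \<in> {a..b}" "t \<notin> N" for t
    proof -
      obtain D where D: "D \<le> 0" "(\<phi> has_real_derivative D) (at t)" using dN t by blast
      from D(2) obtain r where r: "r > 0"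
        "\<And>y. \<bar>y - t\<bar> < r \<Longrightarrow> \<bar>\<phi> y - \<phi> t - (y - t) * D\<bar> \<le> e * \<bar>y - t\<bar>"
        unfolding has_field_derivative_def has_derivative_at_alt
        using e by (auto simp: mult.commute)
      have "(t \<le> y \<longrightarrow> \<phi> y - \<phi> t \<le> e * (y - t)) \<and> (y \<le> t \<longrightarrow> \<phi> t - \<phi> y \<le> e * (t - y))"
        if y: "\<bar>y - t\<bar> < r" for y
      proof -
        have "(y - t) * D \<le> 0" if "t \<le> y" using that D(1) by (simp add: mult_nonneg_nonpos)
        moreover have "(y - t) * D \<ge> 0" if "y \<le> t" using that D(1) by (simp add: mult_nonpos_nonpos)
        ultimately show ?thesis using r(2)[OF y] by (auto simp: abs_if split: if_splits)
      qed
      with r(1) show ?thesis by blast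
    qed
    then obtain r where r: "\<And>t. t \<in> {a..b} \<Longrightarrow> t \<notin> N \<Longrightarrow> r t > 0"
      and rr: "\<And>t y. t \<in> {a..b} \<Longrightarrow> t \<notin> N \<Longrightarrow> \<bar>y - t\<bar> < r t \<Longrightarrow>
             (t \<le> y \<longrightarrow> \<phi> y - \<phi> t \<le> e * (y - t)) \<and> (y \<le> t \<longrightarrow> \<phi> t - \<phi> y \<le> e * (t - y))"
      by metis
    \<comment> \<open>Around exceptional points the gauge is the open set \<open>U\<close> of
      measure below \<delta>; elsewhere in the interval it is the ball on which the derivative
      estimate holds.\<close>
    define \<gamma> where "\<gamma> t = (if t \<in> N then U else if t \<in> {a..b} then ball t (r t) else UNIV)" for t
    have g: "gauge \<gamma>" unfolding gauge_def \<gamma>_def using U r by auto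
    obtain p where p: "p tagged_division_of {a..b}" and fine: "\<gamma> fine p"
      using fine_division_exists[OF g, of a b] by auto
    have fp: "finite p" using p by blast
    define q where "q = {x\<in>p. fst x \<in> N}"
    have tel: "(\<Sum>(x,K)\<in>p. \<phi> (Sup K) - \<phi> (Inf K)) = \<phi> b - \<phi> a"
      using additive_tagged_division_1[OF ab p] .
    have telid: "(\<Sum>(x,K)\<in>p. Sup K - Inf K) = b - a"
      using additive_tagged_division_1[OF ab p, of "\<lambda>x. x"] .
    have int: "\<exists>c d. K = {c..d} \<and> c \<le> d \<and> x \<in> {c..d} \<and> {c..d} \<subseteq> {a..b} \<and> {c..d} \<subseteq> \<gamma> x" if xK: "(x, K) \<in> p" for x K
    proof -
      obtain c d where "K = cbox c d" using tagged_division_ofD(4)[OF p xK] by blast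
      moreover have "x \<in> K" "K \<subseteq> {a..b}" using tagged_division_ofD(2,3)[OF p xK] by auto
      moreover have "K \<subseteq> \<gamma> x" using fineD[OF fine xK] .
      ultimately show ?thesis by (intro exI[of _ c] exI[of _ d]) auto
    qed
    have nonneg: "0 \<le> Sup K - Inf K" if "(x, K) \<in> p" for x K
      using int[OF that] by auto
    have sp: "(\<Sum>(x,K)\<in>p. h K) = (\<Sum>(x,K)\<in>p - q. h K) + (\<Sum>(x,K)\<in>q. h K)" for h :: "real set \<Rightarrow> real"
      using sum.subset_diff[of q p "\<lambda>(x,K). h K"] fp unfolding q_def by auto
    have "(\<Sum>(x,K)\<in>p - q. \<phi> (Sup K) - \<phi> (Inf K)) \<le> (\<Sum>(x,K)\<in>p - q. e * (Sup K - Inf K))"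
    proof (rule sum_mono, clarify)
      fix x K assume xK: "(x, K) \<in> p" "(x, K) \<notin> q"
      then have xN: "x \<notin> N" by (auto simp: q_def)
      obtain c d where cd: "K = {c..d}" "c \<le> d" "x \<in> {c..d}" "{c..d} \<subseteq> {a..b}" "{c..d} \<subseteq> \<gamma> x"
        using int[OF xK(1)] by blast
      have xab: "x \<in> {a..b}" using cd by blast
      have "{c..d} \<subseteq> ball x (r x)" using cd(5) xN xab by (simp add: \<gamma>_def)
      then have "\<bar>c - x\<bar> < r x" "\<bar>d - x\<bar> < r x" using cd(2)
        by (auto simp: subset_eq dist_real_def abs_minus_commute)
      then have "\<phi> x - \<phi> c \<le> e * (x - c)" "\<phi> d - \<phi> x \<le> e * (d - x)"
        using rr[OF xab xN] cd(3) by auto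
      then have "\<phi> d - \<phi> c \<le> e * (d - c)" by (simp add: algebra_simps)
      then show "\<phi> (Sup K) - \<phi> (Inf K) \<le> e * (Sup K - Inf K)" using cd(1,2) by simp
    qed
    also have "\<dots> \<le> (\<Sum>(x,K)\<in>p. e * (Sup K - Inf K))"
      using nonneg e fp by (intro sum_mono2) (auto intro!: mult_nonneg_nonneg)
    also have "\<dots> = e * (b - a)"
      using telid by (simp add: sum_distrib_left[symmetric] case_prod_unfold)
    finally have 1: "(\<Sum>(x,K)\<in>p - q. \<phi> (Sup K) - \<phi> (Inf K)) \<le> e * (b - a)" .
    have qp: "q \<subseteq> p" by (auto simp: q_def)
    have qt: "q tagged_division_of (\<Union>(snd ` q))"
      using tagged_partial_division_subset[OF tagged_division_of_def[THEN iffD1, OF p, THEN conjunct1] qp]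
      by (rule tagged_partial_division_of_Union_self)
    let ?D = "snd ` q"
    have D: "?D division_of (\<Union>?D)" using division_of_tagged_division[OF qt] .
    have sub: "\<Union>?D \<subseteq> {a..b}" using int qp by force
    \<comment> \<open>By fineness, intervals tagged in the null set lie in \<open>U\<close>, whose
      measure is the one that absolute continuity tolerates.\<close>
    have subU: "\<Union>?D \<subseteq> U"
    proof clarify
      fix y x K assume "(x, K) \<in> q" "y \<in> snd (x, K)"
      then have "x \<in> N" "(x,K) \<in> p" "y \<in> K" by (auto simp: q_def)
      then show "y \<in> U" using fineD[OF fine, of x K] by (auto simp: \<gamma>_def)
    qed
    have "(\<Sum>K\<in>?D. Sup K - Inf K) = (\<Sum>K\<in>?D. measure lebesgue K)"
      using int qp by (intro sum.cong) force+
    also have "\<dots> = measure lebesgue (\<Union>?D)"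
      using content_division[OF D] by simp
    also have "\<dots> \<le> measure lebesgue U"
      using D subU emU Um
      by (intro measure_mono_fmeasurable) (auto simp: fmeasurable_def intro: lmeasurable_division[THEN fmeasurableD] less_trans)
    also have "\<dots> < \<delta>"
      using emU \<delta> by (simp add: measure_def enn2real_less_iff less_trans)
    finally have "(\<Sum>K\<in>?D. norm (\<phi> (Sup K) - \<phi> (Inf K))) < e"
      using small[OF D sub] by blast
    moreover have "(\<Sum>(x,K)\<in>q. norm (\<phi> (Sup K) - \<phi> (Inf K))) = (\<Sum>K\<in>?D. norm (\<phi> (Sup K) - \<phi> (Inf K)))"
    proof -
      \<comment> \<open>One interval may carry several tags only if it is degenerate, so passing
        from pairs to intervals needs a summand that vanishes on degenerate and empty intervals;
        \<open>Sup\<close> and \<open>Inf\<close> of the empty set are arbitrary reals, hence the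
        case distinction.\<close>
      define d where "d K = (if K = {} then 0 else norm (\<phi> (Sup K) - \<phi> (Inf K)))" for K
      have ne: "K \<noteq> {}" if "(x, K) \<in> q" for x K using int[of x K] that qp by fastforce
      have "(\<Sum>(x,K)\<in>q. d K) = sum d ?D"
      proof (rule sum.over_tagged_division_lemma[OF qt])
        fix u v :: real assume "box u v = {}"
        then show "d (cbox u v) = 0" by (cases "u = v") (auto simp: d_def)
      qed
      moreover have "(\<Sum>(x,K)\<in>q. d K) = (\<Sum>(x,K)\<in>q. norm (\<phi> (Sup K) - \<phi> (Inf K)))"
        using ne by (intro sum.cong) (auto simp: d_def)
      moreover have "sum d ?D = (\<Sum>K\<in>?D. norm (\<phi> (Sup K) - \<phi> (Inf K)))"
        using ne by (intro sum.cong) (force simp: d_def)+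
      ultimately show ?thesis by simp
    qed
    moreover have "(\<Sum>(x,K)\<in>q. \<phi> (Sup K) - \<phi> (Inf K)) \<le> (\<Sum>(x,K)\<in>q. norm (\<phi> (Sup K) - \<phi> (Inf K)))"
      by (intro sum_mono) auto
    ultimately show ?thesis using 1 sp[of "\<lambda>K. \<phi> (Sup K) - \<phi> (Inf K)"] tel by linarith
  qed
  then have "\<phi> b - \<phi> a \<le> e" if "e > 0" for e
  proof -
    have "\<phi> b - \<phi> a \<le> (e / (b - a + 1)) * (b - a) + e / (b - a + 1)"
      using \<open>\<And>e. e > 0 \<Longrightarrow> \<phi> b - \<phi> a \<le> e * (b - a) + e\<close>[of "e / (b - a + 1)"] that ab by simp
    also have "\<dots> = e / (b - a + 1) * (b - a + 1)" by (simp only: distrib_left mult_1_right)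
    also have "\<dots> = e" using ab by simp
    finally show ?thesis .
  qed
  then show ?thesis by (metis diff_le_0_iff_le field_le_epsilon add_0)
qed

text \<open>The definition refers to \<open>u\<close> only through increments between endpoints, so
  any curve with dominated increments inherits it. Lipschitz curves, linear images, constants and
  products are obtained in this way, sums and differences via pairs.\<close>

lemma abs_cont_on_transfer:
  assumes ac: "abs_cont_on S u"
    and le: "\<And>s t. s \<in> S \<Longrightarrow> t \<in> S \<Longrightarrow> norm (\<phi> t - \<phi> s) \<le> C * norm (u t - u s)"
  shows "abs_cont_on S \<phi>"
  unfolding abs_cont_on_def
proof (intro allI impI)
  fix e :: real assume e: "e > 0"
  \<comment> \<open>A positive constant is needed for the division \<open>e / C'\<close>, while
    \<open>C\<close> may be zero or negative.\<close>
  define C' where "C' = max C 1"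
  have C': "C' > 0" by (simp add: C'_def)
  obtain \<delta> where \<delta>: "\<delta> > 0"
      and small: "\<And>D T. D division_of T \<Longrightarrow> T \<subseteq> S \<Longrightarrow> (\<Sum>K\<in>D. Sup K - Inf K) < \<delta>
                    \<Longrightarrow> (\<Sum>K\<in>D. norm (u (Sup K) - u (Inf K))) < e / C'"
    using ac e C' unfolding abs_cont_on_def by (metis divide_pos_pos)
  show "\<exists>\<delta>>0. \<forall>D T. D division_of T \<and> T \<subseteq> S \<and> (\<Sum>K\<in>D. Sup K - Inf K) < \<delta> \<longrightarrow>
          (\<Sum>K\<in>D. norm (\<phi> (Sup K) - \<phi> (Inf K))) < e"
  proof (intro exI[of _ \<delta>] conjI allI impI)
    fix D T assume *: "D division_of T \<and> T \<subseteq> S \<and> (\<Sum>K\<in>D. Sup K - Inf K) < \<delta>"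
    have "(\<Sum>K\<in>D. norm (\<phi> (Sup K) - \<phi> (Inf K))) \<le> (\<Sum>K\<in>D. C' * norm (u (Sup K) - u (Inf K)))"
    proof (rule sum_mono)
      fix K assume K: "K \<in> D"
      obtain a b where ab: "K = cbox a b" "K \<noteq> {}" using * K by (metis division_ofD(3,4))
      then have "Sup K \<in> K" "Inf K \<in> K" by auto
      moreover have "K \<subseteq> S" using * K by (meson division_ofD(2) order_trans)
      ultimately have "norm (\<phi> (Sup K) - \<phi> (Inf K)) \<le> C * norm (u (Sup K) - u (Inf K))"
        using le by blast
      also have "\<dots> \<le> C' * norm (u (Sup K) - u (Inf K))"
        by (intro mult_right_mono) (auto simp: C'_def)
      finally show "norm (\<phi> (Sup K) - \<phi> (Inf K)) \<le> C' * norm (u (Sup K) - u (Inf K))" .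
    qed
    also have "\<dots> = C' * (\<Sum>K\<in>D. norm (u (Sup K) - u (Inf K)))" by (simp add: sum_distrib_left)
    also have "\<dots> < C' * (e / C')" using small[of D T] * C' by (intro mult_strict_left_mono) auto
    finally show "(\<Sum>K\<in>D. norm (\<phi> (Sup K) - \<phi> (Inf K))) < e" using C' by simp
  qed (use \<delta> in auto)
qed

lemma abs_cont_on_Pair:
  assumes u: "abs_cont_on S u" and v: "abs_cont_on S v"
  shows "abs_cont_on S (\<lambda>t. (u t, v t))"
  unfolding abs_cont_on_def
proof (intro allI impI)
  fix e :: real assume e: "e > 0"
  obtain \<delta>1 where \<delta>1: "\<delta>1 > 0"
      "\<And>D T. D division_of T \<Longrightarrow> T \<subseteq> S \<Longrightarrow> (\<Sum>K\<in>D. Sup K - Inf K) < \<delta>1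
                    \<Longrightarrow> (\<Sum>K\<in>D. norm (u (Sup K) - u (Inf K))) < e / 2"
    using u e unfolding abs_cont_on_def by (metis half_gt_zero)
  obtain \<delta>2 where \<delta>2: "\<delta>2 > 0"
      "\<And>D T. D division_of T \<Longrightarrow> T \<subseteq> S \<Longrightarrow> (\<Sum>K\<in>D. Sup K - Inf K) < \<delta>2
                    \<Longrightarrow> (\<Sum>K\<in>D. norm (v (Sup K) - v (Inf K))) < e / 2"
    using v e unfolding abs_cont_on_def by (metis half_gt_zero)
  show "\<exists>\<delta>>0. \<forall>D T. D division_of T \<and> T \<subseteq> S \<and> (\<Sum>K\<in>D. Sup K - Inf K) < \<delta> \<longrightarrow>
          (\<Sum>K\<in>D. norm ((u (Sup K), v (Sup K)) - (u (Inf K), v (Inf K)))) < e"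
  proof (intro exI[of _ "min \<delta>1 \<delta>2"] conjI allI impI)
    fix D T assume *: "D division_of T \<and> T \<subseteq> S \<and> (\<Sum>K\<in>D. Sup K - Inf K) < min \<delta>1 \<delta>2"
    have "(\<Sum>K\<in>D. norm ((u (Sup K), v (Sup K)) - (u (Inf K), v (Inf K))))
        \<le> (\<Sum>K\<in>D. norm (u (Sup K) - u (Inf K)) + norm (v (Sup K) - v (Inf K)))"
      by (intro sum_mono) (simp add: norm_Pair_le)
    also have "\<dots> < e" using \<delta>1(2)[of D T] \<delta>2(2)[of D T] * by (simp add: sum.distrib)
    finally show "(\<Sum>K\<in>D. norm ((u (Sup K), v (Sup K)) - (u (Inf K), v (Inf K)))) < e" .
  qed (use \<delta>1 \<delta>2 in auto)
qed

lemma abs_cont_on_id: "abs_cont_on S (\<lambda>t::real. t)"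
  unfolding abs_cont_on_def
proof (intro allI impI)
  fix e :: real assume e: "e > 0"
  have "(\<Sum>K\<in>D. norm (Sup K - Inf K)) = (\<Sum>K\<in>D. Sup K - Inf K)" if DT: "D division_of T" for D and T :: "real set"
  proof (rule sum.cong)
    fix K assume K: "K \<in> D"
    obtain a b where ab: "K = cbox a b" using division_ofD(4)[OF DT K] by blast
    with division_ofD(3)[OF DT K] show "norm (Sup K - Inf K) = Sup K - Inf K" by auto
  qed simp
  with e show "\<exists>\<delta>>0. \<forall>D T. D division_of T \<and> T \<subseteq> S \<and> (\<Sum>K\<in>D. Sup K - Inf K) < \<delta> \<longrightarrow>
          (\<Sum>K\<in>D. norm (Sup K - Inf K)) < e"
    by (intro exI[of _ e]) auto
qed

lemma lipschitz_imp_abs_cont_on: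
  assumes "C-lipschitz_on S u"
  shows "abs_cont_on S u"
  using abs_cont_on_transfer[OF abs_cont_on_id, of S u C] assms
  by (auto simp: lipschitz_on_def dist_norm)

lemma abs_cont_on_linear:
  assumes "abs_cont_on S u" "bounded_linear h"
  shows "abs_cont_on S (\<lambda>t. h (u t))"
proof -
  interpret bounded_linear h by fact
  obtain C where "\<And>x. norm (h x) \<le> norm x * C" using bounded by blast
  then show ?thesis
    by (intro abs_cont_on_transfer[OF assms(1), of _ C]) (metis diff mult.commute)
qed

lemma abs_cont_on_diff:
  assumes u: "abs_cont_on S u" and v: "abs_cont_on S v"
  shows "abs_cont_on S (\<lambda>t. u t - v t)"
proof -
  have "bounded_linear (\<lambda>p::'a \<times> 'a. fst p - snd p)"
    by (intro bounded_linear_intros)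
  from abs_cont_on_linear[OF abs_cont_on_Pair[OF u v] this] show ?thesis by simp
qed

lemma abs_cont_on_add:
  assumes u: "abs_cont_on S u" and v: "abs_cont_on S v"
  shows "abs_cont_on S (\<lambda>t. u t + v t)"
proof -
  have "bounded_linear (\<lambda>p::'a \<times> 'a. fst p + snd p)"
    by (intro bounded_linear_intros)
  from abs_cont_on_linear[OF abs_cont_on_Pair[OF u v] this] show ?thesis by simp
qed

lemma abs_cont_on_subset: "abs_cont_on S u \<Longrightarrow> T \<subseteq> S \<Longrightarrow> abs_cont_on T u"
  unfolding abs_cont_on_def by (meson order_trans)

lemma abs_cont_on_const: "abs_cont_on S (\<lambda>t. c)"
  using abs_cont_on_transfer[OF abs_cont_on_id, of S "\<lambda>_. c" 0] by simp

lemma abs_cont_on_imp_continuous_on: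
  fixes u :: "real \<Rightarrow> 'a::real_normed_vector"
  assumes ac: "abs_cont_on {a..b} u"
  shows "continuous_on {a..b} u"
proof (rule continuous_onI)
  fix x e :: real assume x: "x \<in> {a..b}" and e: "0 < e"
  obtain \<delta> where \<delta>: "\<delta> > 0"
      and small: "\<And>D T. D division_of T \<Longrightarrow> T \<subseteq> {a..b} \<Longrightarrow> (\<Sum>K\<in>D. Sup K - Inf K) < \<delta>
                    \<Longrightarrow> (\<Sum>K\<in>D. norm (u (Sup K) - u (Inf K))) < e"
    using ac e unfolding abs_cont_on_def by meson
  show "\<exists>d>0. \<forall>y\<in>{a..b}. dist y x < d \<longrightarrow> dist (u y) (u x) \<le> e"
  proof (intro exI[of _ \<delta>] conjI ballI impI)
    fix y assume y: "y \<in> {a..b}" "dist y x < \<delta>"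
    have "norm (u (max x y) - u (min x y)) < e"
    proof -
      let ?K = "{min x y..max x y}"
      have "{?K} division_of ?K"
        by (metis atLeastatMost_empty_iff2 box_real(2) division_of_self max.cobounded1 min.coboundedI1 not_le)
      moreover have "?K \<subseteq> {a..b}" using x y by auto
      ultimately show ?thesis using small[of "{?K}" ?K] y(2) by (auto simp: dist_real_def)
    qed
    then show "dist (u y) (u x) \<le> e" by (auto simp: dist_norm max_def min_def norm_minus_commute split: if_splits)
  qed (use \<delta> in auto)
qed

text \<open>Compactness of the interval makes both factors bounded, and the product increment is
  then dominated by the increment of the pair.\<close>

lemma abs_cont_on_inner:
  fixes u v :: "real \<Rightarrow> 'a::real_inner"
  assumes u: "abs_cont_on {a..b} u" and v: "abs_cont_on {a..b} v"
  shows "abs_cont_on {a..b} (\<lambda>t. u t \<bullet> v t)"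
proof -
  have "bounded (u ` {a..b})" "bounded (v ` {a..b})"
    using abs_cont_on_imp_continuous_on u v
    by (auto intro!: compact_imp_bounded compact_continuous_image)
  then obtain Cu Cv where Cu: "\<And>t. t \<in> {a..b} \<Longrightarrow> norm (u t) \<le> Cu"
    and Cv: "\<And>t. t \<in> {a..b} \<Longrightarrow> norm (v t) \<le> Cv"
    unfolding bounded_iff by (metis imageI)
  show ?thesis
  proof (rule abs_cont_on_transfer[OF abs_cont_on_Pair[OF u v], of _ "Cu + Cv"])
    fix s t assume st: "s \<in> {a..b}" "t \<in> {a..b}"
    have "norm (u t \<bullet> v t - u s \<bullet> v s) = norm (u t \<bullet> (v t - v s) + (u t - u s) \<bullet> v s)"
      by (simp add: algebra_simps)
    also have "\<dots> \<le> norm (u t) * norm (v t - v s) + norm (u t - u s) * norm (v s)"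
      by (intro order_trans[OF norm_triangle_ineq] add_mono) (auto simp: Cauchy_Schwarz_ineq2)
    also have "\<dots> \<le> Cu * norm ((u t, v t) - (u s, v s)) + norm ((u t, v t) - (u s, v s)) * Cv"
      using Cu[OF st(2)] Cv[OF st(1)]
      by (intro add_mono mult_mono) (auto simp: norm_Pair intro: real_sqrt_ge_abs1 real_sqrt_ge_abs2 order_trans[OF norm_ge_zero])
    finally show "norm (u t \<bullet> v t - u s \<bullet> v s) \<le> (Cu + Cv) * norm ((u t, v t) - (u s, v s))"
      by (simp add: algebra_simps)
  qed
qed

section \<open>Differentiability of Lipschitz curves\<close>

text \<open>
  Slopes are taken over small open balls that merely contain \<open>t\<close>: such balls are a Vitali cover, and
  the sets below are Borel without any argument about uncountable unions of closed intervals.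
\<close>

definition slope_below :: "(real \<Rightarrow> real) \<Rightarrow> real \<Rightarrow> real set"
  where "slope_below f p = {t. \<forall>d>0. \<exists>a r. t \<in> ball a r \<and> r < d \<and> f (a + r) - f (a - r) < p * (2 * r)}"

definition slope_above :: "(real \<Rightarrow> real) \<Rightarrow> real \<Rightarrow> real set"
  where "slope_above f q = {t. \<forall>d>0. \<exists>a r. t \<in> ball a r \<and> r < d \<and> f (a + r) - f (a - r) > q * (2 * r)}"

text \<open>The radii \<open>d\<close> may be restricted to the sequence 1/(n+1), and for each of
  them the set is a union of open balls: altogether a countable intersection of open sets, whatever
  \<open>Q\<close> is.\<close>

lemma borel_vitali_limit:
  fixes Q :: "real \<Rightarrow> real \<Rightarrow> bool"
  shows "{t. \<forall>d>0. \<exists>a r. t \<in> ball a r \<and> r < d \<and> Q a r} \<in> sets borel"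
proof -
  have "{t. \<forall>d>0. \<exists>a r. t \<in> ball a r \<and> r < d \<and> Q a r}
      = (\<Inter>n. \<Union>(a,r)\<in>{(a,r). r < inverse (real (Suc n)) \<and> Q a r}. ball a r)" (is "?A = ?B")
  proof
    show "?A \<subseteq> ?B"
    proof clarify
      fix t and n :: nat assume "\<forall>d>0. \<exists>a r. t \<in> ball a r \<and> r < d \<and> Q a r"
      moreover have "inverse (real (Suc n)) > 0" by simp
      ultimately obtain a r where "t \<in> ball a r" "r < inverse (real (Suc n))" "Q a r" by meson
      then show "t \<in> (\<Union>(a,r)\<in>{(a,r). r < inverse (real (Suc n)) \<and> Q a r}. ball a r)"
        by (intro UN_I[of "(a, r)"]) auto
    qed
    show "?B \<subseteq> ?A"
    proof clarify
      fix t d :: real assume t: "t \<in> ?B" and d: "0 < d"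
      obtain n where n: "inverse (real (Suc n)) < d" using reals_Archimedean[OF d] by blast
      have "t \<in> (\<Union>(a,r)\<in>{(a,r). r < inverse (real (Suc n)) \<and> Q a r}. ball a r)" using INT_D[OF t UNIV_I] .
      then obtain a r where "t \<in> ball a r" "r < inverse (real (Suc n))" "Q a r" by auto
      with n show "\<exists>a r. t \<in> ball a r \<and> r < d \<and> Q a r" by (meson less_trans)
    qed
  qed
  also have "\<dots> \<in> sets borel"
    by (intro sets.countable_INT') (auto intro!: borel_open open_UN)
  finally show ?thesis .
qed

text \<open>Turns slopes into ratios of measures: by continuity the Stieltjes measure of
  \<open>F\<close> has no atoms, so the endpoint that distinguishes the ball from the half-open
  interval has no mass.\<close>

lemma emeasure_interval_measure_ball:
  assumes "mono F" "continuous_on UNIV F" "r \<ge> 0"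
  shows "emeasure (interval_measure F) (ball a r) = ennreal (F (a + r) - F (a - r))"
proof -
  note m = monoD[OF assms(1)]
  have cr: "continuous (at_right x) F" for x
    using assms(2) by (auto intro: continuous_within_subset simp: continuous_on_eq_continuous_within)
  have 0: "emeasure (interval_measure F) {a + r} = 0"
    using emeasure_interval_measure_Icc[of "a+r" "a+r" F] m assms(2) by simp
  have 1: "emeasure (interval_measure F) {a - r<..a + r} = ennreal (F (a + r) - F (a - r))"
    using emeasure_interval_measure_Ioc[of "a-r" "a+r" F] m cr assms(3) by simp
  have "ball a r = {a - r<..a + r} - {a + r}"
    by (auto simp: dist_real_def)
  moreover have "emeasure (interval_measure F) ({a - r<..a + r} - {a + r}) = emeasure (interval_measure F) {a - r<..a + r}"
    using 0 by (intro emeasure_Diff_null_set) (auto intro: null_setsI)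
  ultimately show ?thesis using 1 by simp
qed

text \<open>Countable additivity carries a comparison of two measures from single balls to a
  disjoint family. The weights stand on both sides because the comparison is used in both directions
  between Lebesgue and Stieltjes measure.\<close>

lemma emeasure_ball_family_mono:
  fixes C :: "(real \<times> real) set"
  assumes C: "countable C" "pairwise (\<lambda>i j. disjnt (ball (fst i) (snd i)) (ball (fst j) (snd j))) C"
    and le: "\<And>i. i \<in> C \<Longrightarrow> snd i \<ge> 0 \<Longrightarrow>
        a * emeasure M (ball (fst i) (snd i)) \<le> b * emeasure N (ball (fst i) (snd i))"
    and sets: "sets M = sets borel" "sets N = sets borel"
  shows "a * emeasure M (\<Union>i\<in>C. ball (fst i) (snd i)) \<le> b * emeasure N (\<Union>i\<in>C. ball (fst i) (snd i))"
proof -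
  have dis: "disjoint_family_on (\<lambda>i. ball (fst i) (snd i)) C"
    using C(2) unfolding disjoint_family_on_def pairwise_def disjnt_def by blast
  have eq: "k * emeasure L (\<Union>i\<in>C. ball (fst i) (snd i)) = (\<integral>\<^sup>+i. k * emeasure L (ball (fst i) (snd i)) \<partial>count_space C)"
    if "sets L = sets borel" for L :: "real measure" and k
    using that by (subst emeasure_UN_countable[OF _ C(1) dis]) (auto simp: nn_integral_cmult)
  have "a * emeasure M (ball (fst i) (snd i)) \<le> b * emeasure N (ball (fst i) (snd i))" if "i \<in> C" for i
    using le[OF that] by (cases "snd i \<ge> 0") (auto simp: not_le ball_empty)
  then show ?thesis unfolding eq[OF sets(1)] eq[OF sets(2)] by (intro nn_integral_mono) auto
qed

text \<open>Let \<open>F\<close> be a bounded piece of the set. A Vitali cover by balls of slope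
  below \<open>p\<close>, inside an open set hardly larger than \<open>F\<close>, bounds the
  Stieltjes mass of their union by about p|F|. A second cover inside that union, by balls of slope
  above \<open>q\<close>, bounds the same mass from below by q|F|. Hence q|F| \<le> p|F| with p <
  q.\<close>

lemma negligible_slope_gap:
  assumes f: "mono f" "continuous_on UNIV f" and pq: "p < q"
  shows "negligible (slope_below f p \<inter> slope_above f q)"
proof (cases "p > 0")
  case False
  \<comment> \<open>Increments of a monotone function are nonnegative, so a slope below a
    nonpositive number is impossible.\<close>
  have "slope_below f p = {}"
  proof (rule ccontr)
    assume "slope_below f p \<noteq> {}"
    then obtain t where "t \<in> slope_below f p" by blast
    then have "\<forall>d>0. \<exists>a r. t \<in> ball a r \<and> r < d \<and> f (a + r) - f (a - r) < p * (2 * r)"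
      by (simp add: slope_below_def)
    then obtain a r where ar: "t \<in> ball a r" "f (a + r) - f (a - r) < p * (2 * r)" by (meson zero_less_one)
    then have r: "r > 0" by (metis ball_empty empty_iff not_le)
    then have "f (a - r) \<le> f (a + r)" using monoD[OF f(1)] by auto
    moreover have "p * (2 * r) \<le> 0" using False r by (simp add: mult_nonpos_nonneg)
    ultimately show False using ar by linarith
  qed
  then show ?thesis by simp
next
  case p: True
  let ?\<nu> = "interval_measure f"
  define E where "E = slope_below f p \<inter> slope_above f q"
  have Eb: "E \<in> sets borel"
    unfolding E_def slope_below_def slope_above_def
    by (intro sets.Int borel_vitali_limit[of "\<lambda>a r. f (a + r) - f (a - r) < p * (2 * r)"]
        borel_vitali_limit[of "\<lambda>a r. f (a + r) - f (a - r) > q * (2 * r)"])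
  \<comment> \<open>Cutting down to a ball makes the measure finite, without which the final
    comparison of p|F| and q|F| would say nothing.\<close>
  have "negligible (E \<inter> ball 0 (real k))" for k
  proof -
    define F where "F = E \<inter> ball 0 (real k)"
    have Fb[measurable]: "F \<in> sets borel" unfolding F_def using Eb by simp
    have "emeasure lborel F \<le> emeasure lborel (ball (0::real) (real k))"
      unfolding F_def by (intro emeasure_mono) auto
    also have "\<dots> < \<infinity>" using emeasure_lborel_ball_finite by blast
    finally have fin: "emeasure lborel F < \<infinity>" .
    have main: "ennreal q * emeasure lborel F \<le> ennreal p * (emeasure lborel F + ennreal e)" if e: "e > 0" for e
    proof -
      obtain U where U: "open U" "F \<subseteq> U" "emeasure lborel (U - F) < e"
        using outer_regular_lborel[OF Fb e] by blast
      have [measurable]: "U \<in> sets borel" using U by auto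
      have "emeasure lborel U = emeasure lborel F + emeasure lborel (U - F)"
        using U by (subst plus_emeasure) (auto simp: Un_absorb1)
      also have "\<dots> \<le> emeasure lborel F + ennreal e" using U by (intro add_mono) auto
      finally have emU: "emeasure lborel U \<le> emeasure lborel F + ennreal e" .
      \<comment> \<open>Balls that merely contain \<open>t\<close> can still be placed inside a
        given neighbourhood: radius below \<eta>/2 puts the whole ball within \<eta> of
        \<open>t\<close>.\<close>
      have refine: "\<exists>b s. t \<in> ball b s \<and> s < d \<and> Q b s \<and> ball b s \<subseteq> V"
        if V: "open V" "t \<in> V" and d: "d > 0" and ex: "\<forall>d>0. \<exists>a r. t \<in> ball a r \<and> r < d \<and> Q a r" for t d V and Q :: "real \<Rightarrow> real \<Rightarrow> bool"
      proof -
        obtain \<eta> where \<eta>: "\<eta> > 0" "ball t \<eta> \<subseteq> V" using V openE by metis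
        obtain a r where ar: "t \<in> ball a r" "r < min d (\<eta>/2)" "Q a r"
          using ex[rule_format, of "min d (\<eta>/2)"] \<eta>(1) d by auto
        have "ball a r \<subseteq> ball t \<eta>"
        proof
          fix y assume "y \<in> ball a r"
          then show "y \<in> ball t \<eta>" using ar(1,2) by (auto simp: dist_real_def)
        qed
        with ar \<eta> show ?thesis by (intro exI[of _ a] exI[of _ r]) auto
      qed
      define K1 where "K1 = {i. ball (fst i) (snd i) \<subseteq> U \<and> f (fst i + snd i) - f (fst i - snd i) < p * (2 * snd i)}"
      have "\<exists>i. i \<in> K1 \<and> t \<in> ball (fst i) (snd i) \<and> snd i < d" if t: "t \<in> F" and d: "0 < d" for t d
      proof -
        have "t \<in> slope_below f p" "t \<in> U" using t U by (auto simp: F_def E_def)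
        then obtain a r where "t \<in> ball a r" "r < d" "f (a + r) - f (a - r) < p * (2 * r)" "ball a r \<subseteq> U"
          using refine[of U t d "\<lambda>a r. f (a + r) - f (a - r) < p * (2 * r)"] d U(1)
          unfolding slope_below_def by blast
        then show ?thesis by (intro exI[of _ "(a, r)"]) (simp add: K1_def)
      qed
      then obtain C1 where C1: "countable C1" "C1 \<subseteq> K1"
        "pairwise (\<lambda>i j. disjnt (ball (fst i) (snd i)) (ball (fst j) (snd j))) C1"
        "negligible (F - (\<Union>i\<in>C1. ball (fst i) (snd i)))"
        by (rule Vitali_covering_theorem_balls[of F K1 fst snd])
      define V where "V = (\<Union>i\<in>C1. ball (fst i) (snd i))"
      have V: "open V" unfolding V_def by blast
      \<comment> \<open>The second family is confined to the union of the first, so that its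
        Stieltjes mass is bounded by the mass already estimated from above.\<close>
      define K2 where "K2 = {i. ball (fst i) (snd i) \<subseteq> V \<and> f (fst i + snd i) - f (fst i - snd i) > q * (2 * snd i)}"
      have "\<exists>i. i \<in> K2 \<and> t \<in> ball (fst i) (snd i) \<and> snd i < d" if t: "t \<in> F \<inter> V" and d: "0 < d" for t d
      proof -
        have "t \<in> slope_above f q" "t \<in> V" using t U by (auto simp: F_def E_def)
        then obtain a r where "t \<in> ball a r" "r < d" "f (a + r) - f (a - r) > q * (2 * r)" "ball a r \<subseteq> V"
          using refine[of V t d "\<lambda>a r. f (a + r) - f (a - r) > q * (2 * r)"] d V
          unfolding slope_above_def by blast
        then show ?thesis by (intro exI[of _ "(a, r)"]) (simp add: K2_def)
      qed
      then obtain C2 where C2: "countable C2" "C2 \<subseteq> K2"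
        "pairwise (\<lambda>i j. disjnt (ball (fst i) (snd i)) (ball (fst j) (snd j))) C2"
        "negligible (F \<inter> V - (\<Union>i\<in>C2. ball (fst i) (snd i)))"
        by (rule Vitali_covering_theorem_balls[of "F \<inter> V" K2 fst snd])
      define V2 where "V2 = (\<Union>i\<in>C2. ball (fst i) (snd i))"
      have [measurable]: "V \<in> sets borel" "V2 \<in> sets borel" unfolding V_def V2_def by (auto intro!: borel_open)
      have VU: "V \<subseteq> U" using C1(2) unfolding V_def K1_def by auto
      have V2V: "V2 \<subseteq> V" using C2(2) unfolding V2_def K2_def by auto
      have lb: "emeasure lborel (ball a r) = ennreal (2 * r)" if "r \<ge> 0" for a r :: real
        using emeasure_lborel_Ioo[of "a-r" "a+r"] that by (simp add: ball_eq_greaterThanLessThan)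
      have n1: "ennreal 1 * ?\<nu> V \<le> ennreal p * emeasure lborel V"
        unfolding V_def
      proof (rule emeasure_ball_family_mono[OF C1(1,3)])
        fix i assume "i \<in> C1" "snd i \<ge> 0"
        then show "ennreal 1 * ?\<nu> (ball (fst i) (snd i)) \<le> ennreal p * emeasure lborel (ball (fst i) (snd i))"
          using C1(2) p
          by (auto simp: K1_def emeasure_interval_measure_ball[OF f] lb ennreal_mult[symmetric] intro!: ennreal_leI)
      qed auto
      have n2: "ennreal q * emeasure lborel V2 \<le> ennreal 1 * ?\<nu> V2"
        unfolding V2_def
      proof (rule emeasure_ball_family_mono[OF C2(1,3)])
        fix i assume "i \<in> C2" "snd i \<ge> 0"
        then show "ennreal q * emeasure lborel (ball (fst i) (snd i)) \<le> ennreal 1 * ?\<nu> (ball (fst i) (snd i))"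
          using C2(2) p pq
          by (auto simp: K2_def emeasure_interval_measure_ball[OF f] lb ennreal_mult[symmetric] intro!: ennreal_leI)
      qed auto
      have neg: "negligible (F - V2)"
      proof (rule negligible_subset)
        show "negligible ((F - V) \<union> (F \<inter> V - V2))"
          using C1(4) C2(4) unfolding V_def V2_def by (rule negligible_Un)
      qed auto
      have "emeasure lborel F \<le> emeasure lborel (V2 \<union> (F - V2))" by (intro emeasure_mono) auto
      also have "\<dots> = emeasure lborel V2"
        using neg by (intro emeasure_Un_null_set) (auto simp: negligible_iff_null_sets null_sets_completion_iff)
      finally have "ennreal q * emeasure lborel F \<le> ennreal q * emeasure lborel V2" by (rule mult_left_mono) simp
      also note n2
      also have "ennreal 1 * ?\<nu> V2 \<le> ennreal 1 * ?\<nu> V" using V2V by (intro mult_left_mono emeasure_mono) auto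
      also note n1
      also have "ennreal p * emeasure lborel V \<le> ennreal p * emeasure lborel U"
        using VU by (intro mult_left_mono emeasure_mono) auto
      also have "\<dots> \<le> ennreal p * (emeasure lborel F + ennreal e)" using emU by (rule mult_left_mono) simp
      finally show ?thesis .
    qed
    obtain x where x: "emeasure lborel F = ennreal x" "x \<ge> 0"
      using fin by (cases "emeasure lborel F") auto
    have "q * x \<le> p * (x + e)" if "e > 0" for e
      using main[OF that] x p pq that
      by (simp add: ennreal_mult[symmetric] ennreal_plus[symmetric] del: ennreal_plus)
    then have "q * x \<le> p * x + e" if "e > 0" for e
    proof -
      have "q * x \<le> p * (x + e / p)" by (rule \<open>\<And>e. e > 0 \<Longrightarrow> q * x \<le> p * (x + e)\<close>) (use that p in simp)
      then show ?thesis using p by (simp add: algebra_simps)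
    qed
    then have "q * x \<le> p * x" by (rule field_le_epsilon)
    then have "x = 0" using pq x(2) by (metis mult_le_cancel_right not_le order_antisym)
    then have "F \<in> null_sets lborel" using x Fb by (auto intro: null_setsI)
    then show ?thesis unfolding F_def[symmetric] by (simp add: negligible_iff_null_sets null_sets_completionI)
  qed
  then have "negligible (\<Union>k. E \<inter> ball 0 (real k))" by (intro negligible_countable_Union) auto
  also have "(\<Union>k. E \<inter> ball 0 (real k)) = E"
    using reals_Archimedean2 by (auto simp: dist_real_def)
  finally show ?thesis by (simp add: E_def)
qed

text \<open>The derivative is the supremum \<open>D\<close> of all \<open>q\<close> that are
  exceeded by slopes over arbitrarily small balls around \<open>t\<close>. Slopes eventually stay
  below \<open>D + e\<close> by definition of the supremum, and above \<open>D - e\<close> because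
  otherwise a rational pair would witness a gap.\<close>

lemma differentiable_if_no_slope_gap:
  assumes f: "mono f" and lip: "L-lipschitz_on UNIV f"
    and gap: "\<And>p q. p \<in> \<rat> \<Longrightarrow> q \<in> \<rat> \<Longrightarrow> p < q \<Longrightarrow> t \<notin> slope_below f p \<inter> slope_above f q"
  shows "f differentiable (at t)"
proof -
  have cont: "isCont f x" for x
    using lipschitz_on_continuous_on[OF lip] by (simp add: continuous_on_eq_continuous_at)
  have anti: "t \<in> slope_above f q" if above: "t \<in> slope_above f q'" and qq: "q \<le> q'" for q q'
    unfolding slope_above_def
  proof (clarify)
    fix d :: real assume "d > 0"
    then obtain a r where ar: "t \<in> ball a r" "r < d" "f (a + r) - f (a - r) > q' * (2 * r)"
      using above unfolding slope_above_def by blast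
    have "r > 0" using ar(1) by (metis ball_empty empty_iff not_le)
    then have "q * (2 * r) \<le> q' * (2 * r)" using qq by (intro mult_right_mono) auto
    with ar show "\<exists>a r. t \<in> ball a r \<and> r < d \<and> f (a + r) - f (a - r) > q * (2 * r)" by (meson le_less_trans)
  qed
  have ub: "q \<le> L" if above: "t \<in> slope_above f q" for q
  proof -
    obtain a r where ar: "t \<in> ball a r" "f (a + r) - f (a - r) > q * (2 * r)"
      using above unfolding slope_above_def by (auto dest: spec[of _ 1])
    have r: "r > 0" using ar(1) by (metis ball_empty empty_iff not_le)
    have "f (a + r) - f (a - r) \<le> L * (2 * r)"
      using lipschitz_onD[OF lip, of "a + r" "a - r"] r by (auto simp: dist_real_def)
    with ar have "q * (2 * r) < L * (2 * r)" by linarith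
    then show ?thesis using r by (simp add: mult_less_cancel_right)
  qed
  have low: "t \<in> slope_above f q" if "q < 0" for q
    unfolding slope_above_def
  proof clarify
    fix d :: real assume d: "d > 0"
    have "q * (2 * (d/2)) < 0" using that d by (simp add: mult_neg_pos)
    moreover have "f (t - d/2) \<le> f (t + d/2)" using d by (intro monoD[OF f]) auto
    ultimately show "\<exists>a r. t \<in> ball a r \<and> r < d \<and> f (a + r) - f (a - r) > q * (2 * r)"
      using d by (intro exI[of _ t] exI[of _ "d/2"]) auto
  qed
  define A where "A = {q. t \<in> slope_above f q}"
  have bdd: "bdd_above A" using ub unfolding A_def bdd_above_def by blast
  have ne: "A \<noteq> {}" using low[of "-1"] unfolding A_def by auto
  define D where "D = Sup A"
  have above: "\<exists>d>0. \<forall>a r. t \<in> ball a r \<longrightarrow> r < d \<longrightarrow> f (a + r) - f (a - r) \<le> (D + e) * (2 * r)" if "e > 0" for e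
  proof -
    have "D + e \<notin> A" using cSup_upper[OF _ bdd, of "D + e"] that unfolding D_def by auto
    then show ?thesis unfolding A_def slope_above_def by (simp add: not_less) (meson not_le)
  qed
  have below: "\<exists>d>0. \<forall>a r. t \<in> ball a r \<longrightarrow> r < d \<longrightarrow> f (a + r) - f (a - r) \<ge> (D - e) * (2 * r)" if e: "e > 0" for e
  proof -
    obtain q0 where q0: "q0 \<in> A" "D - e < q0" using less_cSupE[OF _ ne, of "D - e"] e unfolding D_def by auto
    \<comment> \<open>Two rationals are needed strictly between \<open>D - e\<close> and an element
      of \<open>A\<close>: the smaller one bounds the slopes from below, the larger one lies in
      \<open>A\<close> by downward closure.\<close>
    obtain p where p: "p \<in> \<rat>" "D - e < p" "p < q0" using Rats_dense_in_real[OF q0(2)] by blast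
    obtain q where q: "q \<in> \<rat>" "p < q" "q < q0" using Rats_dense_in_real[OF p(3)] by blast
    have "t \<in> slope_above f q" using anti q0 q unfolding A_def by auto
    then have "t \<notin> slope_below f p" using gap[OF p(1) q(1) q(2)] by blast
    then obtain d where d: "d > 0" "\<And>a r. t \<in> ball a r \<Longrightarrow> r < d \<Longrightarrow> f (a + r) - f (a - r) \<ge> p * (2 * r)"
      unfolding slope_below_def by (simp add: not_less) (meson not_le)
    have "f (a + r) - f (a - r) \<ge> (D - e) * (2 * r)" if "t \<in> ball a r" "r < d" for a r
    proof -
      have "r > 0" using that(1) by (metis ball_empty empty_iff not_le)
      then have "(D - e) * (2 * r) \<le> p * (2 * r)" using p by (intro mult_right_mono) auto
      with d(2)[OF that] show ?thesis by linarith
    qed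
    with d(1) show ?thesis by blast
  qed
  have "(f has_real_derivative D) (at t)"
    unfolding has_field_derivative_def has_derivative_at_alt
  proof (intro conjI allI impI)
    fix e :: real assume e: "e > 0"
    obtain d1 where d1: "d1 > 0" "\<And>a r. t \<in> ball a r \<Longrightarrow> r < d1 \<Longrightarrow> f (a + r) - f (a - r) \<le> (D + e) * (2 * r)"
      using above[OF e] by blast
    obtain d2 where d2: "d2 > 0" "\<And>a r. t \<in> ball a r \<Longrightarrow> r < d2 \<Longrightarrow> f (a + r) - f (a - r) \<ge> (D - e) * (2 * r)"
      using below[OF e] by blast
    define d where "d = min d1 d2"
    have d: "d > 0" using d1 d2 by (simp add: d_def)
    have I: "(D - e) * (v - u) \<le> f v - f u \<and> f v - f u \<le> (D + e) * (v - u)" if "u < t" "t < v" "v - u < d" for u v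
    proof -
      have t: "t \<in> ball ((u + v)/2) ((v - u)/2)" using that by (auto simp: dist_real_def abs_if field_simps)
      have eq: "(u + v)/2 + (v - u)/2 = v" "(u + v)/2 - (v - u)/2 = u" "2 * ((v - u)/2) = v - u"
        by (simp_all add: field_simps)
      have "(v - u)/2 < d1" "(v - u)/2 < d2" using that by (auto simp: d_def)
      from d1(2)[OF t this(1), unfolded eq] d2(2)[OF t this(2), unfolded eq] show ?thesis by blast
    qed
    have ft: "(f \<longlongrightarrow> f t) (at t within S)" for S
      using cont[of t] unfolding isCont_def by (rule Lim_at_imp_Lim_at_within)
    \<comment> \<open>The balls have \<open>t\<close> in their interior, whereas the difference
      quotient has it as an endpoint; the other endpoint is moved to \<open>t\<close> by continuity
      of \<open>f\<close>.\<close>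
    have R: "(D - e) * (v - t) \<le> f v - f t \<and> f v - f t \<le> (D + e) * (v - t)" if "t < v" "v - t < d" for v
    proof -
      have lim: "((\<lambda>u. f v - f u) \<longlongrightarrow> f v - f t) (at_left t)" "((\<lambda>u. k * (v - u)) \<longlongrightarrow> k * (v - t)) (at_left t)" for k
        by (intro tendsto_intros ft)+
      have "v - d < t" using that by linarith
      then have ev: "eventually (\<lambda>u. v - d < u \<and> u < t) (at_left t)" using eventually_at_left_real by (auto elim!: eventually_mono)
      have II: "(D - e) * (v - u) \<le> f v - f u" "f v - f u \<le> (D + e) * (v - u)" if "v - d < u \<and> u < t" for u
        using I[of u v] that \<open>t < v\<close> by auto
      have "(D - e) * (v - t) \<le> f v - f t"
        by (rule tendsto_le[OF _ lim(1) lim(2)]) (simp_all add: eventually_mono[OF ev II(1)])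
      moreover have "f v - f t \<le> (D + e) * (v - t)"
        by (rule tendsto_le[OF _ lim(2) lim(1)]) (simp_all add: eventually_mono[OF ev II(2)])
      ultimately show ?thesis by blast
    qed
    have Lf: "(D - e) * (t - u) \<le> f t - f u \<and> f t - f u \<le> (D + e) * (t - u)" if "u < t" "t - u < d" for u
    proof -
      have lim: "((\<lambda>v. f v - f u) \<longlongrightarrow> f t - f u) (at_right t)" "((\<lambda>v. k * (v - u)) \<longlongrightarrow> k * (t - u)) (at_right t)" for k
        by (intro tendsto_intros ft)+
      have "t < u + d" using that by linarith
      then have ev: "eventually (\<lambda>v. t < v \<and> v < u + d) (at_right t)" using eventually_at_right_real by (auto elim!: eventually_mono)
      have II: "(D - e) * (v - u) \<le> f v - f u" "f v - f u \<le> (D + e) * (v - u)" if "t < v \<and> v < u + d" for v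
        using I[of u v] that \<open>u < t\<close> by auto
      have "(D - e) * (t - u) \<le> f t - f u"
        by (rule tendsto_le[OF _ lim(1) lim(2)]) (simp_all add: eventually_mono[OF ev II(1)])
      moreover have "f t - f u \<le> (D + e) * (t - u)"
        by (rule tendsto_le[OF _ lim(2) lim(1)]) (simp_all add: eventually_mono[OF ev II(2)])
      ultimately show ?thesis by blast
    qed
    have "norm (f y - f t - D * (y - t)) \<le> e * norm (y - t)" if "norm (y - t) < d" for y
    proof (cases y t rule: linorder_cases)
      case less
      then have "(D - e) * (t - y) \<le> f t - f y \<and> f t - f y \<le> (D + e) * (t - y)" using Lf[of y] that by simp
      then have "\<bar>f y - f t - D * (y - t)\<bar> \<le> e * (t - y)" unfolding abs_le_iff by (simp add: algebra_simps)
      with less show ?thesis by simp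
    next
      case greater
      then have "(D - e) * (y - t) \<le> f y - f t \<and> f y - f t \<le> (D + e) * (y - t)" using R[of y] that by simp
      then have "\<bar>f y - f t - D * (y - t)\<bar> \<le> e * (y - t)" unfolding abs_le_iff by (simp add: algebra_simps)
      with greater show ?thesis by simp
    qed simp
    with d show "\<exists>d>0. \<forall>y. norm (y - t) < d \<longrightarrow> norm (f y - f t - D * (y - t)) \<le> e * norm (y - t)" by blast
  qed (simp add: bounded_linear_mult_right)
  then show ?thesis using real_differentiable_def by blast
qed

text \<open>Adding \<open>L * t\<close> makes the function monotone without affecting
  differentiability, and only countably many rational gaps have to be excluded.\<close>

theorem lipschitz_differentiable_AE_real:
  fixes f :: "real \<Rightarrow> real"
  assumes lip: "L-lipschitz_on UNIV f"
  shows "AE t in lebesgue. f differentiable (at t)"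
proof -
  define h where "h t = f t + L * t" for t
  have mono: "mono h"
  proof (rule monoI)
    fix x y :: real assume "x \<le> y"
    then show "h x \<le> h y" using lipschitz_onD[OF lip, of x y] by (auto simp: dist_real_def h_def algebra_simps)
  qed
  have L: "L \<ge> 0" using lip lipschitz_on_nonneg by blast
  have lip': "(L + L)-lipschitz_on UNIV h"
    unfolding h_def using L
    by (intro lipschitz_on_add[OF lip] lipschitz_onI) (auto simp: dist_real_def abs_mult simp flip: right_diff_distrib)
  define N where "N = (\<Union>(p,q)\<in>{(p,q). p \<in> \<rat> \<and> q \<in> \<rat> \<and> p < q}. slope_below h p \<inter> slope_above h q)"
  have "countable {(p,q). p \<in> \<rat> \<and> q \<in> \<rat> \<and> p < (q::real)}"
    by (rule countable_subset[of _ "\<rat> \<times> \<rat>"]) (auto simp: countable_rat)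
  then have "negligible N"
    unfolding N_def using negligible_slope_gap[OF mono lipschitz_on_continuous_on[OF lip']]
    by (intro negligible_countable_Union) auto
  moreover have "f differentiable (at t)" if "t \<notin> N" for t
  proof -
    have "h differentiable (at t)"
      by (rule differentiable_if_no_slope_gap[OF mono lip']) (use that in \<open>auto simp: N_def\<close>)
    then have "(\<lambda>t. h t - L * t) differentiable (at t)" by (intro derivative_intros) auto
    then show ?thesis by (simp add: h_def)
  qed
  ultimately show ?thesis
    by (intro AE_I'[of N]) (auto simp: negligible_iff_null_sets)
qed

theorem lipschitz_differentiable_AE:
  fixes u :: "real \<Rightarrow> 'a::euclidean_space"
  assumes lip: "L-lipschitz_on UNIV u"
  shows "AE t in lebesgue. u differentiable (at t)"
proof -
  have "AE t in lebesgue. (\<lambda>s. u s \<bullet> b) differentiable (at t)" if b: "b \<in> Basis" for b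
  proof (rule lipschitz_differentiable_AE_real)
    show "L-lipschitz_on UNIV (\<lambda>s. u s \<bullet> b)"
    proof (rule lipschitz_onI)
      fix x y
      have "dist (u x \<bullet> b) (u y \<bullet> b) \<le> norm (u x - u y)"
        using Basis_le_norm[OF b, of "u x - u y"] by (simp add: dist_real_def inner_diff_left)
      then show "dist (u x \<bullet> b) (u y \<bullet> b) \<le> L * dist x y"
        using lipschitz_onD[OF lip, of x y] by (simp add: dist_norm)
    qed (use lip lipschitz_on_nonneg in blast)
  qed
  then have "AE t in lebesgue. \<forall>b\<in>Basis. (\<lambda>s. u s \<bullet> b) differentiable (at t)"
    by (subst AE_finite_all) auto
  then show ?thesis
    by eventually_elim (subst differentiable_componentwise_within, simp)
qed

section \<open>The projected Euler scheme\<close>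

lemma nat_floor_diff_le: "\<bar>real (nat \<lfloor>a\<rfloor>) - real (nat \<lfloor>b\<rfloor>)\<bar> \<le> \<bar>a - b\<bar> + 1"
  by linarith

lemma tendsto_nat_floor_mult:
  assumes "0 \<le> s" "strict_mono (r :: nat \<Rightarrow> nat)"
  shows "(\<lambda>n. real (nat \<lfloor>s * real (Suc (r n))\<rfloor>) / real (Suc (r n))) \<longlonglongrightarrow> s"
proof (rule LIMSEQ_I)
  fix e :: real assume "e > 0"
  then obtain N where N: "inverse (real (Suc N)) < e" using reals_Archimedean by blast
  have "norm (real (nat \<lfloor>s * real (Suc (r n))\<rfloor>) / real (Suc (r n)) - s) < e" if n: "n \<ge> N" for n
  proof -
    let ?m = "real (Suc (r n))"
    have "\<bar>real (nat \<lfloor>s * ?m\<rfloor>) - s * ?m\<bar> \<le> 1"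
      using assms(1) by (simp add: of_nat_nat) linarith
    moreover have "real (nat \<lfloor>s * ?m\<rfloor>) / ?m - s = (real (nat \<lfloor>s * ?m\<rfloor>) - s * ?m) / ?m"
      by (simp add: diff_divide_distrib del: of_nat_Suc)
    ultimately have "\<bar>real (nat \<lfloor>s * ?m\<rfloor>) / ?m - s\<bar> \<le> inverse ?m"
      by (simp add: divide_right_mono inverse_eq_divide del: of_nat_Suc)
    also have "inverse ?m \<le> inverse (real (Suc N))"
      using seq_suble[OF assms(2), of n] n by (intro le_imp_inverse_le) auto
    finally show ?thesis using N by simp
  qed
  then show "\<exists>no. \<forall>n\<ge>no. norm (real (nat \<lfloor>s * real (Suc (r n))\<rfloor>) / real (Suc (r n)) - s) < e" by blast
qed

text \<open>
  The curve is a pointwise limit of the explicit scheme \<open>x \<mapsto> proj\<^bsub>K\<^esub> (x + h \<Psi> x)\<close> along a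
  subsequence of step sizes \<open>h\<close> that converges at all rational times. The last property is the limit
  of the one-step estimate of the squared distance to \<open>z\<close>.
\<close>

theorem projected_euler_limit:
  fixes K :: "'a::euclidean_space set" and \<Psi> :: "'a \<Rightarrow> 'a"
  assumes K: "closed K" "convex K" and cont: "continuous_on K \<Psi>"
    and bd: "\<And>x. x \<in> K \<Longrightarrow> norm (\<Psi> x) \<le> R" and u0: "u0 \<in> K"
  obtains u where "u 0 = u0" "\<And>t. u t \<in> K" "R-lipschitz_on UNIV u"
    "\<And>t w z. 0 < t \<Longrightarrow> (u has_vector_derivative w) (at t) \<Longrightarrow> z \<in> K \<Longrightarrow> (\<Psi> (u t) - w) \<bullet> (z - u t) \<le> 0"
proof -
  have R: "R \<ge> 0" using bd[OF u0] norm_ge_zero order_trans by blast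
  have Kne: "K \<noteq> {}" using u0 by blast
  define h where "h n = 1 / real (Suc n)" for n
  have hpos: "h n > 0" for n by (simp add: h_def)
  have h0: "h \<longlonglongrightarrow> 0" unfolding h_def using LIMSEQ_inverse_real_of_nat by (simp add: inverse_eq_divide)
  define step where "step n x = closest_point K (x + h n *\<^sub>R \<Psi> x)" for n x
  define U where "U n k = (step n ^^ k) u0" for n k
  have U0: "U n 0 = u0" for n by (simp add: U_def)
  have USuc: "U n (Suc k) = closest_point K (U n k + h n *\<^sub>R \<Psi> (U n k))" for n k
    by (simp add: U_def step_def)
  have UK: "U n k \<in> K" for n k
    by (cases k) (use U0 USuc u0 closest_point_in_set[OF K(1) Kne] in auto)
  have proj: "dist (closest_point K x) z \<le> dist x z" if "z \<in> K" for x z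
    using closest_point_lipschitz[OF K(2) K(1) Kne, of x z] closest_point_self[OF that] by simp
  have step1: "norm (U n (Suc k) - U n k) \<le> h n * R" for n k
  proof -
    have "norm (U n (Suc k) - U n k) \<le> norm (h n *\<^sub>R \<Psi> (U n k))"
      using proj[OF UK, of "U n k + h n *\<^sub>R \<Psi> (U n k)" n k] unfolding USuc dist_norm by simp
    also have "\<dots> \<le> h n * R" using bd[OF UK] hpos[of n] by simp
    finally show ?thesis .
  qed
  have lipU: "norm (U n (k + j) - U n k) \<le> h n * R * real j" for n k j
  proof (induction j)
    case (Suc j)
    have "norm (U n (k + Suc j) - U n k) \<le> norm (U n (Suc (k + j)) - U n (k + j)) + norm (U n (k + j) - U n k)"
      using norm_triangle_ineq[of "U n (Suc (k + j)) - U n (k + j)" "U n (k + j) - U n k"] by simp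
    then show ?case using step1[of n "k + j"] Suc by (simp add: algebra_simps)
  qed simp
  have lipU2: "norm (U n i - U n j) \<le> h n * R * \<bar>real i - real j\<bar>" for n i j
  proof (cases i j rule: le_cases)
    case le then show ?thesis using lipU[of n i "j - i"] by (simp add: norm_minus_commute of_nat_diff)
  next
    case ge then show ?thesis using lipU[of n j "i - j"] by (simp add: of_nat_diff)
  qed
  \<comment> \<open>Discrete evolution variational inequality: projection onto \<open>K\<close> does
    not increase the distance to a point \<open>z\<close> of \<open>K\<close>, so only the explicit
    step contributes.\<close>
  have evi1: "(norm (U n (Suc k) - z))\<^sup>2 - (norm (U n k - z))\<^sup>2
      \<le> 2 * h n * (\<Psi> (U n k) \<bullet> (U n k - z)) + (h n)\<^sup>2 * R\<^sup>2" if z: "z \<in> K" for n k z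
  proof -
    let ?x = "U n k" and ?p = "\<Psi> (U n k)"
    have "norm (U n (Suc k) - z) \<le> norm ((?x - z) + h n *\<^sub>R ?p)"
      using proj[OF z, of "?x + h n *\<^sub>R ?p"] unfolding USuc dist_norm by (simp add: algebra_simps)
    then have "(norm (U n (Suc k) - z))\<^sup>2 \<le> (norm ((?x - z) + h n *\<^sub>R ?p))\<^sup>2"
      by (intro power_mono) auto
    also have "\<dots> = (norm (?x - z))\<^sup>2 + 2 * h n * (?p \<bullet> (?x - z)) + (h n)\<^sup>2 * (norm ?p)\<^sup>2"
    proof -
      have "(norm (a + b))\<^sup>2 = (norm a)\<^sup>2 + 2 * (b \<bullet> a) + (norm b)\<^sup>2" for a b :: 'a
        by (simp add: power2_norm_eq_inner inner_add_left inner_add_right inner_commute)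
      from this[of "?x - z" "h n *\<^sub>R ?p"] show ?thesis by (simp add: power_mult_distrib)
    qed
    also have "(h n)\<^sup>2 * (norm ?p)\<^sup>2 \<le> (h n)\<^sup>2 * R\<^sup>2"
      using bd[OF UK] by (intro mult_left_mono power_mono) auto
    finally show ?thesis by linarith
  qed
  \<comment> \<open>Index of the last grid point up to \<open>t\<close>. Since \<open>nat\<close>
    sends negatives to 0, the curves are constant for negative times, which lets them be Lipschitz
    on the whole line.\<close>
  define ix where "ix n t = nat \<lfloor>t * real (Suc n)\<rfloor>" for n :: nat and t :: real
  define v where "v n t = U n (ix n t)" for n t
  have ixd: "h n * \<bar>real (ix n t) - real (ix n s)\<bar> \<le> \<bar>t - s\<bar> + h n" for n t s
  proof -
    have "\<bar>real (ix n t) - real (ix n s)\<bar> \<le> \<bar>t * real (Suc n) - s * real (Suc n)\<bar> + 1"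
      unfolding ix_def by (rule nat_floor_diff_le)
    also have "\<dots> = \<bar>t - s\<bar> * real (Suc n) + 1" by (simp add: abs_mult flip: left_diff_distrib)
    finally have "h n * \<bar>real (ix n t) - real (ix n s)\<bar> \<le> h n * (\<bar>t - s\<bar> * real (Suc n) + 1)"
      using hpos[of n] by (intro mult_left_mono) auto
    also have "\<dots> = \<bar>t - s\<bar> + h n" by (simp add: h_def field_simps del: of_nat_Suc)
    finally show ?thesis .
  qed
  have vlip: "norm (v n t - v n s) \<le> R * (\<bar>t - s\<bar> + h n)" for n t s
  proof -
    have "norm (v n t - v n s) \<le> R * (h n * \<bar>real (ix n t) - real (ix n s)\<bar>)"
      using lipU2[of n "ix n t" "ix n s"] by (simp add: v_def algebra_simps)
    also have "\<dots> \<le> R * (\<bar>t - s\<bar> + h n)" using ixd R by (intro mult_left_mono) auto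
    finally show ?thesis .
  qed
  have v0: "v n t = u0" if "t \<le> 0" for n t
  proof -
    have "t * real (Suc n) \<le> 0" using that by (intro mult_nonpos_nonneg) auto
    then have "ix n t = 0" unfolding ix_def by linarith
    then show ?thesis by (simp add: v_def U0)
  qed
  \<comment> \<open>The diagonal subsequence argument asks for one bound at all times; the growth of
    \<open>v\<close> is at most linear, so division by 1 + |t| supplies it.\<close>
  define f where "f n t = (1 / (1 + \<bar>t\<bar>)) *\<^sub>R (v n t - u0)" for n t
  have fb: "norm (f n t) \<le> R" for n t
  proof -
    have "h n \<le> 1" by (simp add: h_def)
    then have "norm (v n t - u0) \<le> R * (1 + \<bar>t\<bar>)"
      using vlip[of n t 0] v0[of 0 n] R by (smt (verit) mult_left_mono)
    then show ?thesis by (simp add: f_def divide_le_eq)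
  qed
  obtain r where r: "strict_mono (r :: nat \<Rightarrow> nat)" and conv: "\<And>q. q \<in> \<rat> \<Longrightarrow> \<exists>l. (\<lambda>n. f (r n) q) \<longlonglongrightarrow> l"
    using function_convergent_subsequence[OF countable_rat, of f R] fb by metis
  have hr: "(\<lambda>n. h (r n)) \<longlonglongrightarrow> 0" using LIMSEQ_subseq_LIMSEQ[OF h0 r] by (simp add: o_def)
  have convq: "convergent (\<lambda>n. v (r n) q)" if q: "q \<in> \<rat>" for q
  proof -
    obtain l where "(\<lambda>n. f (r n) q) \<longlonglongrightarrow> l" using conv[OF q] by blast
    then have "(\<lambda>n. (1 + \<bar>q\<bar>) *\<^sub>R f (r n) q + u0) \<longlonglongrightarrow> (1 + \<bar>q\<bar>) *\<^sub>R l + u0" by (intro tendsto_intros)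
    moreover have "1 + \<bar>q\<bar> \<noteq> 0" by linarith
    then have "(1 + \<bar>q\<bar>) *\<^sub>R f (r n) q + u0 = v (r n) q" for n by (simp add: f_def)
    ultimately show ?thesis by (auto simp: convergent_def)
  qed
  have "\<exists>l. (\<lambda>n. v (r n) t) \<longlonglongrightarrow> l" for t
  proof -
    \<comment> \<open>Rational times suffice because the step curves are Lipschitz up to an error
      that tends to 0 with the step size.\<close>
    have "Cauchy (\<lambda>n. v (r n) t)"
    proof (rule metric_CauchyI)
      fix e :: real assume e: "e > 0"
      define d where "d = e / (8 * (R + 1))"
      have d: "d > 0" using e R by (simp add: d_def)
      have Rd: "R * (2 * d) \<le> e / 4" using R e by (simp add: d_def field_simps)
      obtain q where q: "q \<in> \<rat>" "t < q" "q < t + d" using Rats_dense_in_real[of t "t + d"] d by auto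
      have "Cauchy (\<lambda>n. v (r n) q)" using convq[OF q(1)] by (rule convergent_Cauchy)
      then obtain M1 where M1: "\<And>m n. m \<ge> M1 \<Longrightarrow> n \<ge> M1 \<Longrightarrow> dist (v (r m) q) (v (r n) q) < e / 4"
        using metric_CauchyD[of _ "e/4"] e by (metis zero_less_divide_iff zero_less_numeral)
      obtain M2 where M2: "\<And>n. n \<ge> M2 \<Longrightarrow> h (r n) < d"
        using LIMSEQ_D[OF hr d] hpos by (auto simp: abs_of_pos less_imp_le)
      have near: "dist (v (r n) t) (v (r n) q) \<le> e / 4" if "n \<ge> M2" for n
      proof -
        have "dist (v (r n) t) (v (r n) q) \<le> R * (\<bar>t - q\<bar> + h (r n))" using vlip by (simp add: dist_norm)
        also have "\<dots> \<le> R * (2 * d)" using M2[OF that] q R by (intro mult_left_mono) auto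
        finally show ?thesis using Rd by simp
      qed
      have "dist (v (r m) t) (v (r n) t) < e" if "m \<ge> max M1 M2" "n \<ge> max M1 M2" for m n
      proof -
        have "dist (v (r m) t) (v (r n) t) \<le> dist (v (r m) t) (v (r m) q) + dist (v (r m) q) (v (r n) q) + dist (v (r n) q) (v (r n) t)"
          by (meson dist_triangle dist_triangle_le order_trans add_right_mono)
        also have "\<dots> < e"
          using near[of m] near[of n] M1[of m n] that e by (simp add: dist_commute)
        finally show ?thesis .
      qed
      then show "\<exists>M. \<forall>m\<ge>M. \<forall>n\<ge>M. dist (v (r m) t) (v (r n) t) < e" by blast
    qed
    then show ?thesis by (simp add: Cauchy_convergent_iff convergent_def)
  qed
  then obtain u where u: "\<And>t. (\<lambda>n. v (r n) t) \<longlonglongrightarrow> u t" by metis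
  show thesis
  proof
    show "u 0 = u0" using u[of 0] v0[of 0] by (simp add: LIMSEQ_const_iff)
    show uK: "u t \<in> K" for t
      using closed_sequentially[OF K(1) _ u[of t]] UK by (simp add: v_def)
    show "R-lipschitz_on UNIV u"
    proof (rule lipschitz_onI)
      fix t s
      have "(\<lambda>n. norm (v (r n) t - v (r n) s)) \<longlonglongrightarrow> norm (u t - u s)" by (intro tendsto_intros u)
      moreover have "(\<lambda>n. R * (\<bar>t - s\<bar> + h (r n))) \<longlonglongrightarrow> R * (\<bar>t - s\<bar> + 0)" by (intro tendsto_intros hr)
      ultimately have "norm (u t - u s) \<le> R * (\<bar>t - s\<bar> + 0)"
        by (rule LIMSEQ_le) (use vlip in auto)
      then show "dist (u t) (u s) \<le> R * dist t s" by (simp add: dist_norm)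
    qed (rule R)
    fix t w z assume t: "0 < t" and w: "(u has_vector_derivative w) (at t)" and z: "z \<in> K"
    define A where "A = \<Psi> (u t) \<bullet> (u t - z)"
    have main: "w \<bullet> (u t - z) \<le> A + e" if e: "e > 0" for e
    proof -
      have "continuous_on K (\<lambda>y. \<Psi> y \<bullet> (y - z))" by (intro continuous_intros cont)
      then obtain \<eta> where \<eta>: "\<eta> > 0" "\<And>y. y \<in> K \<Longrightarrow> dist y (u t) < \<eta> \<Longrightarrow> dist (\<Psi> y \<bullet> (y - z)) A < e"
        unfolding continuous_on_iff A_def using uK[of t] e by metis
      have \<eta>2: "\<Psi> y \<bullet> (y - z) \<le> A + e" if "y \<in> K" "norm (y - u t) < \<eta>" for y
        using \<eta>(2)[of y] that by (simp add: dist_norm)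
      \<comment> \<open>On a time span \<delta> with step size below \<delta> the scheme moves at
        most \<eta>/2; together with an initial error below \<eta>/2 it remains where continuity of
        \<Psi> controls the one-step term.\<close>
      define \<delta> where "\<delta> = \<eta> / (4 * (R + 1))"
      have \<delta>: "\<delta> > 0" using \<eta> R by (simp add: \<delta>_def)
      have R\<delta>: "R * (2 * \<delta>) \<le> \<eta> / 2" using R \<eta> by (simp add: \<delta>_def field_simps)
      have fin: "(norm (u s - z))\<^sup>2 - (norm (u t - z))\<^sup>2 \<le> 2 * (s - t) * (A + e)" if s: "t < s" "s < t + \<delta>" for s
      proof -
        have ts: "ix m t \<le> ix m s" for m unfolding ix_def using s by (intro nat_mono floor_mono mult_right_mono) auto
        \<comment> \<open>The one-step estimate summed over the grid points between \<open>t\<close>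
          and \<open>s\<close>. The quadratic error per step is h^2 R^2, so its sum is of order h
          and disappears in the limit.\<close>
        have disc: "(norm (v m s - z))\<^sup>2 - (norm (v m t - z))\<^sup>2
            \<le> 2 * (h m * (real (ix m s) - real (ix m t))) * (A + e) + h m * R\<^sup>2 * (h m * (real (ix m s) - real (ix m t)))"
          if hm: "h m < \<delta>" and vm: "norm (v m t - u t) < \<eta> / 2" for m
        proof -
          have "ix m t + j \<le> ix m s \<Longrightarrow> (norm (U m (ix m t + j) - z))\<^sup>2 - (norm (U m (ix m t) - z))\<^sup>2
             \<le> real j * (2 * h m * (A + e) + (h m)\<^sup>2 * R\<^sup>2)" for j
          proof (induction j)
            case (Suc j)
            let ?i = "ix m t + j"
            have "norm (U m ?i - U m (ix m t)) \<le> R * (h m * real j)"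
              using lipU[of m "ix m t" j] by (simp add: algebra_simps)
            also have "\<dots> \<le> R * (h m * \<bar>real (ix m s) - real (ix m t)\<bar>)"
              using Suc.prems R hpos[of m] by (intro mult_left_mono) auto
            also have "\<dots> \<le> R * (\<bar>s - t\<bar> + h m)" using ixd R by (intro mult_left_mono) auto
            also have "\<dots> \<le> R * (2 * \<delta>)" using s hm R by (intro mult_left_mono) auto
            finally have "norm (U m ?i - U m (ix m t)) \<le> \<eta> / 2" using R\<delta> by simp
            then have "norm (U m ?i - u t) < \<eta>"
              using vm norm_triangle_ineq[of "U m ?i - U m (ix m t)" "U m (ix m t) - u t"] by (simp add: v_def)
            from \<eta>2[OF UK this] have "2 * h m * (\<Psi> (U m ?i) \<bullet> (U m ?i - z)) \<le> 2 * h m * (A + e)"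
              using hpos[of m] by (intro mult_left_mono) auto
            with evi1[OF z, of m ?i] Suc show ?case by (simp add: algebra_simps)
          qed simp
          from this[of "ix m s - ix m t"] ts[of m] show ?thesis
            by (simp add: v_def of_nat_diff algebra_simps power2_eq_square)
        qed
        have lim: "(\<lambda>n. h (r n) * real (ix (r n) x)) \<longlonglongrightarrow> x" if "0 \<le> x" for x
          using tendsto_nat_floor_mult[OF that r] by (simp add: h_def ix_def del: of_nat_Suc)
        have lim2: "(\<lambda>n. h (r n) * (real (ix (r n) s) - real (ix (r n) t))) \<longlonglongrightarrow> s - t"
          using tendsto_diff[OF lim[of s] lim[of t]] s t by (simp add: right_diff_distrib)
        have l1: "(\<lambda>n. (norm (v (r n) s - z))\<^sup>2 - (norm (v (r n) t - z))\<^sup>2) \<longlonglongrightarrow> (norm (u s - z))\<^sup>2 - (norm (u t - z))\<^sup>2"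
          by (intro tendsto_intros u)
        have l2: "(\<lambda>n. 2 * (h (r n) * (real (ix (r n) s) - real (ix (r n) t))) * (A + e)
            + h (r n) * R\<^sup>2 * (h (r n) * (real (ix (r n) s) - real (ix (r n) t)))) \<longlonglongrightarrow> 2 * (s - t) * (A + e) + 0 * R\<^sup>2 * (s - t)"
          by (intro tendsto_intros lim2 hr)
        have "eventually (\<lambda>n. norm (v (r n) t - u t) < \<eta> / 2) sequentially"
          using tendstoD[OF u[of t], of "\<eta>/2"] \<eta>(1) by (simp add: dist_norm)
        then have "eventually (\<lambda>n. (norm (v (r n) s - z))\<^sup>2 - (norm (v (r n) t - z))\<^sup>2
            \<le> 2 * (h (r n) * (real (ix (r n) s) - real (ix (r n) t))) * (A + e)
            + h (r n) * R\<^sup>2 * (h (r n) * (real (ix (r n) s) - real (ix (r n) t)))) sequentially"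
          using order_tendstoD(2)[OF hr \<delta>] by eventually_elim (rule disc)
        then have "(norm (u s - z))\<^sup>2 - (norm (u t - z))\<^sup>2 \<le> 2 * (s - t) * (A + e) + 0 * R\<^sup>2 * (s - t)"
          by (rule tendsto_le[OF sequentially_bot l2 l1])
        then show ?thesis by simp
      qed
      \<comment> \<open>Dividing the integrated inequality by \<open>s - t\<close> and letting
        \<open>s\<close> decrease to \<open>t\<close> recovers the pointwise inequality, wherever
        the derivative exists.\<close>
      have "((\<lambda>s. (u s - z) \<bullet> (u s - z)) has_vector_derivative ((u t - z) \<bullet> (w - 0) + (w - 0) \<bullet> (u t - z))) (at t)"
        by (intro bounded_bilinear.has_vector_derivative[OF bounded_bilinear_inner]
            has_vector_derivative_diff w has_vector_derivative_const)
      then have "((\<lambda>s. (norm (u s - z))\<^sup>2) has_real_derivative 2 * (w \<bullet> (u t - z))) (at t)"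
        by (simp add: power2_norm_eq_inner has_real_derivative_iff_has_vector_derivative inner_commute)
      then have "((\<lambda>s. ((norm (u s - z))\<^sup>2 - (norm (u t - z))\<^sup>2) / (s - t)) \<longlongrightarrow> 2 * (w \<bullet> (u t - z))) (at t)"
        by (simp add: has_field_derivative_iff)
      then have "((\<lambda>s. ((norm (u s - z))\<^sup>2 - (norm (u t - z))\<^sup>2) / (s - t)) \<longlongrightarrow> 2 * (w \<bullet> (u t - z))) (at_right t)"
        by (rule Lim_at_imp_Lim_at_within)
      then have "2 * (w \<bullet> (u t - z)) \<le> 2 * (A + e)"
      proof (rule tendsto_upperbound)
        have "eventually (\<lambda>s. s \<in> {t<..<t + \<delta>}) (at_right t)" using \<delta> by (intro eventually_at_right_real) auto
        then show "\<forall>\<^sub>F s in at_right t. ((norm (u s - z))\<^sup>2 - (norm (u t - z))\<^sup>2) / (s - t) \<le> 2 * (A + e)"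
          by eventually_elim (use fin in \<open>auto simp: divide_le_eq algebra_simps\<close>)
      qed simp
      then show ?thesis by simp
    qed
    have "w \<bullet> (u t - z) \<le> A" by (rule field_le_epsilon) (rule main)
    then show "(\<Psi> (u t) - w) \<bullet> (z - u t) \<le> 0" by (simp add: A_def algebra_simps)
  qed
qed

section \<open>Tangent and normal cones\<close>

lemma tangent_cone_closed: "closed (tangent_cone S x)"
  by (simp add: tangent_cone_def)

lemma tangent_coneI:
  assumes "z \<in> S" "\<delta> > 0"
  shows "(1 / \<delta>) *\<^sub>R (z - x) \<in> tangent_cone S x"
  unfolding tangent_cone_def using assms by (intro subsetD[OF closure_subset]) auto

lemma tangent_cone_diff: "z \<in> S \<Longrightarrow> z - x \<in> tangent_cone S x"
  using tangent_coneI[of z S 1 x] by simp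

lemma tangent_cone_convex:
  fixes S :: "'a::real_normed_vector set"
  assumes "convex S"
  shows "convex (tangent_cone S x)"
  unfolding tangent_cone_def
proof (rule convex_closure, rule convexI)
  fix a b :: 'a and s t :: real
  assume a: "a \<in> (\<Union>\<delta>\<in>{0<..}. (\<lambda>z. (1 / \<delta>) *\<^sub>R (z - x)) ` S)"
    and b: "b \<in> (\<Union>\<delta>\<in>{0<..}. (\<lambda>z. (1 / \<delta>) *\<^sub>R (z - x)) ` S)"
    and st: "0 \<le> s" "0 \<le> t" "s + t = 1"
  obtain d1 z1 where 1: "d1 > 0" "z1 \<in> S" "a = (1 / d1) *\<^sub>R (z1 - x)" using a by auto
  obtain d2 z2 where 2: "d2 > 0" "z2 \<in> S" "b = (1 / d2) *\<^sub>R (z2 - x)" using b by auto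
  \<comment> \<open>A combination of two dilated differences is \<open>k\<close> times a difference
    to \<open>x\<close>; its base point is the convex combination whose weights are those of
    \<open>k\<close>, normalised.\<close>
  define k where "k = s / d1 + t / d2"
  have k: "k > 0"
  proof (cases "s > 0")
    case True then show ?thesis using 1(1) 2(1) st unfolding k_def by (intro add_pos_nonneg) auto
  next
    case False then have "t = 1" "s = 0" using st by auto
    then show ?thesis using 2(1) unfolding k_def by simp
  qed
  define z where "z = (s / d1 / k) *\<^sub>R z1 + (t / d2 / k) *\<^sub>R z2"
  have "s / d1 / k + t / d2 / k = (s / d1 + t / d2) / k" by (rule add_divide_distrib[symmetric])
  also have "\<dots> = 1" using k by (simp add: k_def)
  finally have "s / d1 / k + t / d2 / k = 1" .
  then have "z \<in> S" unfolding z_def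
    using convexD[OF assms 1(2) 2(2), of "s / d1 / k" "t / d2 / k"] st 1(1) 2(1) k by auto
  moreover have "s *\<^sub>R a + t *\<^sub>R b = (1 / (1 / k)) *\<^sub>R (z - x)"
  proof -
    have "k *\<^sub>R z = (s / d1) *\<^sub>R z1 + (t / d2) *\<^sub>R z2" using k by (simp add: z_def scaleR_add_right)
    moreover have "k *\<^sub>R x = (s / d1) *\<^sub>R x + (t / d2) *\<^sub>R x" by (simp add: k_def scaleR_add_left)
    ultimately show ?thesis by (simp add: 1 2 scaleR_diff_right)
  qed
  ultimately show "s *\<^sub>R a + t *\<^sub>R b \<in> (\<Union>\<delta>\<in>{0<..}. (\<lambda>z. (1 / \<delta>) *\<^sub>R (z - x)) ` S)"
    using k by (intro UN_I[of "1 / k"]) auto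
qed

lemma tangent_cone_inner_le:
  assumes "\<And>z. z \<in> S \<Longrightarrow> v \<bullet> (z - x) \<le> 0" "y \<in> tangent_cone S x"
  shows "v \<bullet> y \<le> 0"
proof -
  have "(\<Union>\<delta>\<in>{0<..}. (\<lambda>z. (1 / \<delta>) *\<^sub>R (z - x)) ` S) \<subseteq> {y. v \<bullet> y \<le> 0}"
    using assms(1) by (auto simp: divide_le_0_iff)
  then have "tangent_cone S x \<subseteq> {y. v \<bullet> y \<le> 0}"
    unfolding tangent_cone_def by (intro closure_minimal closed_halfspace_le)
  with assms(2) show ?thesis by blast
qed

lemma tangent_cone_scale:
  fixes S :: "'a::real_normed_vector set"
  assumes "y \<in> tangent_cone S x" "c > 0"
  shows "c *\<^sub>R y \<in> tangent_cone S x"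
proof -
  let ?C = "\<Union>\<delta>\<in>{0<..}. (\<lambda>z. (1 / \<delta>) *\<^sub>R (z - x)) ` S"
  have "(*\<^sub>R) c ` ?C \<subseteq> ?C"
  proof
    fix y assume "y \<in> (*\<^sub>R) c ` ?C"
    then obtain \<delta> z where "0 < \<delta>" "z \<in> S" "y = c *\<^sub>R ((1 / \<delta>) *\<^sub>R (z - x))" by auto
    then show "y \<in> ?C"
      using assms(2) by (intro UN_I[of "\<delta> / c"] image_eqI[of _ _ z]) auto
  qed
  then have "closure ((*\<^sub>R) c ` (\<Union>\<delta>\<in>{0<..}. (\<lambda>z. (1 / \<delta>) *\<^sub>R (z - x)) ` S)) \<subseteq> tangent_cone S x"
    unfolding tangent_cone_def by (rule closure_mono)
  then show ?thesis
    using assms(1) closure_scaleR[of c "(\<Union>\<delta>\<in>{0<..}. (\<lambda>z. (1 / \<delta>) *\<^sub>R (z - x)) ` S)"]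
    unfolding tangent_cone_def by blast
qed

lemma proj_vf_in_tangent_cone:
  assumes "S \<noteq> {}"
  shows "proj_vf S x v \<in> tangent_cone S x"
proof -
  obtain z where "z \<in> S" using assms by blast
  then have "tangent_cone S x \<noteq> {}" using tangent_cone_diff by blast
  then show ?thesis unfolding proj_vf_def by (rule closest_point_in_set[OF tangent_cone_closed])
qed

text \<open>Moreau's decomposition. The tangent cone is a convex cone, so testing the projection
  with 0 and with twice itself makes the residual orthogonal to it; the residual then lies in the
  polar of the tangent cone.\<close>

lemma proj_vf_residual_normal:
  fixes S :: "'a::euclidean_space set"
  assumes S: "convex S" and x: "x \<in> S"
  shows "v - proj_vf S x v \<in> normal_cone S x"
proof -
  let ?T = "tangent_cone S x" and ?p = "proj_vf S x v"
  have cc: "convex ?T" "closed ?T" using tangent_cone_convex[OF S] tangent_cone_closed by auto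
  have p: "?p \<in> ?T" using proj_vf_in_tangent_cone x by blast
  have le: "(v - ?p) \<bullet> (y - ?p) \<le> 0" if "y \<in> ?T" for y
    using closest_point_dot[OF cc that, of v] by (simp add: proj_vf_def)
  have "0 \<in> ?T" using tangent_cone_diff[OF x, of x] by simp
  then have "(v - ?p) \<bullet> ?p \<ge> 0" using le[of 0] by simp
  moreover have "(v - ?p) \<bullet> ?p \<le> 0" using le[OF tangent_cone_scale[OF p, of 2]] by (simp add: scaleR_2)
  ultimately have "(v - ?p) \<bullet> ?p = 0" by simp
  then show ?thesis
    using le tangent_cone_diff by (fastforce simp: normal_cone_def inner_diff_right)
qed

text \<open>Converse of Moreau's decomposition: polarity of the residual, tangency and orthogonality
  identify the projection, since the squared distance to any competitor splits off a nonnegative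
  term.\<close>

lemma proj_vf_eqI:
  fixes S :: "'a::euclidean_space set"
  assumes S: "convex S" and n: "v - w \<in> normal_cone S x" and t: "w \<in> tangent_cone S x" "(v - w) \<bullet> w = 0"
  shows "proj_vf S x v = w"
proof -
  have "dist v w \<le> dist v y" if y: "y \<in> tangent_cone S x" for y
  proof -
    have "(v - w) \<bullet> y \<le> 0" using n by (intro tangent_cone_inner_le[OF _ y]) (auto simp: normal_cone_def)
    then have "(v - w) \<bullet> (y - w) \<le> 0" using t(2) by (simp add: inner_diff_right)
    then have "(norm (v - w))\<^sup>2 \<le> (norm (v - y))\<^sup>2"
    proof -
      have "(norm (v - y))\<^sup>2 = (norm (v - w))\<^sup>2 - 2 * ((v - w) \<bullet> (y - w)) + (norm (y - w))\<^sup>2"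
        by (simp add: power2_norm_eq_inner inner_diff_left inner_diff_right inner_commute)
      with \<open>(v - w) \<bullet> (y - w) \<le> 0\<close> show ?thesis by (smt (verit) zero_le_power2)
    qed
    then show ?thesis by (simp add: dist_norm)
  qed
  then show ?thesis unfolding proj_vf_def
    using closest_point_unique[OF tangent_cone_convex[OF S] tangent_cone_closed t(1)] by metis
qed

lemma proj_vf_eq_0_iff:
  fixes S :: "'a::euclidean_space set"
  assumes S: "convex S" and x: "x \<in> S"
  shows "proj_vf S x v = 0 \<longleftrightarrow> v \<in> normal_cone S x"
proof
  assume "v \<in> normal_cone S x"
  moreover have "0 \<in> tangent_cone S x" using tangent_cone_diff[OF x, of x] by simp
  ultimately show "proj_vf S x v = 0" by (intro proj_vf_eqI[OF S]) auto
qed (use proj_vf_residual_normal[OF S x, of v] in simp)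

lemma vector_derivative_in_tangent_cone:
  fixes u :: "real \<Rightarrow> 'a::real_normed_vector"
  assumes der: "(u has_vector_derivative w) (at t)" and S: "\<And>s. s > t \<Longrightarrow> u s \<in> S"
  shows "w \<in> tangent_cone S (u t)"
proof -
  have "\<exists>y\<in>tangent_cone S (u t). dist y w < e" if e: "e > 0" for e
  proof -
    obtain d where d: "d > 0"
      "\<And>y. norm (y - t) < d \<Longrightarrow> norm (u y - u t - (y - t) *\<^sub>R w) \<le> (e / 2) * norm (y - t)"
      using der e unfolding has_vector_derivative_def has_derivative_at_alt by (meson half_gt_zero)
    define r where "r = d / 2"
    have r: "r > 0" using d by (simp add: r_def)
    have le: "norm (u (t + r) - u t - r *\<^sub>R w) \<le> (e / 2) * r" using d(2)[of "t + r"] d(1) by (simp add: r_def)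
    have "dist ((1 / r) *\<^sub>R (u (t + r) - u t)) w = norm ((1 / r) *\<^sub>R (u (t + r) - u t - r *\<^sub>R w))"
      using r by (simp add: dist_norm scaleR_diff_right)
    also have "\<dots> = norm (u (t + r) - u t - r *\<^sub>R w) / r" using r by simp
    also have "\<dots> \<le> e / 2" using le r by (simp add: divide_le_eq)
    also have "\<dots> < e" using e by simp
    finally show ?thesis using tangent_coneI[OF S, of "t + r" r "u t"] r by (intro bexI) auto
  qed
  then show ?thesis using closed_approachable[OF tangent_cone_closed] by blast
qed

text \<open>Of interest for \<open>x\<close> outside \<open>S\<close>, where the formula for the
  tangent cone still makes sense: every difference from \<open>x\<close> to a point of
  \<open>S\<close>, hence every limit of such directions, leads towards \<open>S\<close>. This keeps
  arbitrary solutions from leaving the state set.\<close>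

lemma closest_point_obtuse:
  fixes S :: "'a::euclidean_space set"
  assumes S: "convex S" "closed S" "S \<noteq> {}" and w: "w \<in> tangent_cone S x"
  shows "(x - closest_point S x) \<bullet> w \<le> 0"
proof (rule tangent_cone_inner_le[OF _ w])
  fix z assume z: "z \<in> S"
  let ?p = "closest_point S x"
  have "(x - ?p) \<bullet> (z - ?p) \<le> 0" by (rule closest_point_dot[OF S(1,2) z])
  moreover have "(x - ?p) \<bullet> (z - x) = (x - ?p) \<bullet> (z - ?p) - (norm (x - ?p))\<^sup>2"
    by (simp add: power2_norm_eq_inner inner_diff_left inner_diff_right inner_commute)
  ultimately show "(x - ?p) \<bullet> (z - x) \<le> 0" by (smt (verit) zero_le_power2)
qed

text \<open>The closest point itself need not be differentiable. Taking the projection of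
  \<open>x\<close> as a competitor for \<open>y\<close> bounds the increment from above, the
  obtuse-angle inequality bounds it from below, and the two bounds differ by |y - x|^2 only.\<close>

lemma has_derivative_square_dist_closest_point:
  fixes S :: "'a::euclidean_space set"
  assumes S: "convex S" "closed S" "S \<noteq> {}"
  shows "((\<lambda>y. (norm (y - closest_point S y))\<^sup>2) has_derivative (\<lambda>h. 2 * ((x - closest_point S x) \<bullet> h))) (at x)"
proof -
  let ?P = "closest_point S"
  have up: "(norm (y - ?P y))\<^sup>2 - (norm (x - ?P x))\<^sup>2 \<le> 2 * ((x - ?P x) \<bullet> (y - x)) + (norm (y - x))\<^sup>2" for x y
  proof -
    have "norm (y - ?P y) \<le> norm (y - ?P x)"
      using closest_point_le[OF S(2) closest_point_in_set[OF S(2,3), of x], of y] by (simp add: dist_norm)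
    then have "(norm (y - ?P y))\<^sup>2 \<le> (norm (y - ?P x))\<^sup>2" by (intro power_mono) auto
    also have "\<dots> = (norm (x - ?P x))\<^sup>2 + 2 * ((x - ?P x) \<bullet> (y - x)) + (norm (y - x))\<^sup>2"
      by (simp add: power2_norm_eq_inner inner_diff_left inner_diff_right inner_commute)
    finally show ?thesis by simp
  qed
  have low: "(norm (y - ?P y))\<^sup>2 - (norm (x - ?P x))\<^sup>2 \<ge> 2 * ((x - ?P x) \<bullet> (y - x))" for x y
  proof -
    have "(x - ?P x) \<bullet> (?P y - ?P x) \<le> 0"
      by (rule closest_point_dot[OF S(1,2) closest_point_in_set[OF S(2,3)]])
    moreover have "(norm (y - ?P y))\<^sup>2 - (norm (x - ?P x))\<^sup>2
       = 2 * ((x - ?P x) \<bullet> (y - x)) - 2 * ((x - ?P x) \<bullet> (?P y - ?P x)) + (norm ((y - ?P y) - (x - ?P x)))\<^sup>2"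
      by (simp add: power2_norm_eq_inner inner_diff_left inner_diff_right inner_commute)
    ultimately show ?thesis by (smt (verit) zero_le_power2)
  qed
  show ?thesis
    unfolding has_derivative_at_alt
  proof (intro conjI allI impI)
    show "bounded_linear (\<lambda>h. 2 * ((x - ?P x) \<bullet> h))" by (intro bounded_linear_intros)
    fix e :: real assume e: "e > 0"
    have "norm ((norm (y - ?P y))\<^sup>2 - (norm (x - ?P x))\<^sup>2 - 2 * ((x - ?P x) \<bullet> (y - x))) \<le> e * norm (y - x)"
      if y: "norm (y - x) < e" for y
    proof -
      have "norm ((norm (y - ?P y))\<^sup>2 - (norm (x - ?P x))\<^sup>2 - 2 * ((x - ?P x) \<bullet> (y - x))) \<le> (norm (y - x))\<^sup>2"
        using up[of y x] low[where x=x and y=y] by (simp add: abs_le_iff)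
      also have "\<dots> \<le> e * norm (y - x)" using y by (simp add: power2_eq_square mult_right_mono)
      finally show ?thesis .
    qed
    then show "\<exists>d>0. \<forall>y. norm (y - x) < d \<longrightarrow>
       norm ((norm (y - ?P y))\<^sup>2 - (norm (x - ?P x))\<^sup>2 - 2 * ((x - ?P x) \<bullet> (y - x))) \<le> e * norm (y - x)"
      using e by blast
  qed
qed

text \<open>The derivative is two-sided. The curve lies in \<open>S\<close> before and after
  \<open>t\<close>, so the linear functional given by the residual attains a local maximum along it;
  its vanishing derivative is the orthogonality missing from the normal-cone inclusion.\<close>

lemma proj_vf_of_curve:
  fixes u :: "real \<Rightarrow> 'a::euclidean_space"
  assumes S: "convex S" "\<And>s. 0 \<le> s \<Longrightarrow> u s \<in> S" and t: "t > 0"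
    and der: "(u has_vector_derivative w) (at t)" and n: "v - w \<in> normal_cone S (u t)"
  shows "proj_vf S (u t) v = w"
proof (rule proj_vf_eqI[OF S(1) n])
  show "w \<in> tangent_cone S (u t)"
    by (rule vector_derivative_in_tangent_cone[OF der]) (use S t in auto)
  have "((\<lambda>s. (v - w) \<bullet> u s) has_vector_derivative (v - w) \<bullet> w) (at t)"
    by (rule bounded_linear.has_vector_derivative[OF bounded_linear_inner_right der])
  then have "((\<lambda>s. (v - w) \<bullet> u s) has_real_derivative (v - w) \<bullet> w) (at t)"
    by (simp add: has_real_derivative_iff_has_vector_derivative)
  moreover have "\<forall>y. \<bar>t - y\<bar> < t \<longrightarrow> (v - w) \<bullet> u y \<le> (v - w) \<bullet> u t"
    using n S(2) by (auto simp: normal_cone_def inner_diff_right)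
  ultimately show "(v - w) \<bullet> w = 0" using t by (intro DERIV_local_max)
qed

section \<open>Graph Laplacians\<close>

abbreviation "adj E i j \<equiv> adjacency E $ i $ j"

lemma adjacency_nonneg: "0 \<le> adj E i j"
  by (simp add: adjacency_def)

lemma adjacency_sym: "sym E \<Longrightarrow> adj E i j = adj E j i"
  by (auto simp: adjacency_def dest: symD)

text \<open>The difference form of a row. A loop in \<open>E\<close> enters both the degree and the
  adjacency entry and cancels.\<close>

lemma laplacian_sum:
  fixes y :: "'i::finite \<Rightarrow> 'a::real_vector"
  shows "(\<Sum>j\<in>UNIV. laplacian E $ i $ j *\<^sub>R y j) = (\<Sum>j\<in>UNIV. adj E i j *\<^sub>R (y i - y j))"
proof -
  have "(\<Sum>j\<in>UNIV. laplacian E $ i $ j *\<^sub>R y j)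
      = (\<Sum>j\<in>UNIV. (if i = j then (\<Sum>k\<in>UNIV. adj E i k) *\<^sub>R y j else 0) - adj E i j *\<^sub>R y j)"
    by (intro sum.cong) (auto simp: laplacian_def scaleR_diff_left)
  also have "\<dots> = (\<Sum>k\<in>UNIV. adj E i k) *\<^sub>R y i - (\<Sum>j\<in>UNIV. adj E i j *\<^sub>R y j)"
    by (simp add: sum_subtractf)
  also have "\<dots> = (\<Sum>j\<in>UNIV. adj E i j *\<^sub>R (y i - y j))"
    by (simp add: scaleR_sum_left scaleR_diff_right sum_subtractf)
  finally show ?thesis .
qed

text \<open>The double sum is averaged with its copy in which \<open>i\<close> and \<open>j\<close>
  are exchanged. Values in an inner product space let the identity serve both the matrix and its
  Kronecker lift.\<close>

lemma laplacian_bilinear: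
  fixes x y :: "'i::finite \<Rightarrow> 'a::real_inner"
  assumes "sym E"
  shows "(\<Sum>i\<in>UNIV. x i \<bullet> (\<Sum>j\<in>UNIV. laplacian E $ i $ j *\<^sub>R y j))
       = (\<Sum>i\<in>UNIV. \<Sum>j\<in>UNIV. adj E i j * ((x i - x j) \<bullet> (y i - y j))) / 2"
proof -
  let ?S = "\<Sum>i\<in>UNIV. \<Sum>j\<in>UNIV. adj E i j * (x i \<bullet> (y i - y j))"
  have 1: "(\<Sum>i\<in>UNIV. x i \<bullet> (\<Sum>j\<in>UNIV. laplacian E $ i $ j *\<^sub>R y j)) = ?S"
    unfolding laplacian_sum by (simp add: inner_sum_right)
  have "?S = (\<Sum>j\<in>UNIV. \<Sum>i\<in>UNIV. adj E i j * (x i \<bullet> (y i - y j)))" by (rule sum.swap)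
  also have "\<dots> = (\<Sum>i\<in>UNIV. \<Sum>j\<in>UNIV. adj E i j * (x j \<bullet> (y j - y i)))"
    by (subst adjacency_sym[OF assms]) simp
  finally have "?S + ?S = (\<Sum>i\<in>UNIV. \<Sum>j\<in>UNIV. adj E i j * (x i \<bullet> (y i - y j)) + adj E i j * (x j \<bullet> (y j - y i)))"
    by (simp add: sum.distrib)
  also have "\<dots> = (\<Sum>i\<in>UNIV. \<Sum>j\<in>UNIV. adj E i j * ((x i - x j) \<bullet> (y i - y j)))"
    by (intro sum.cong) (auto simp: algebra_simps)
  finally show ?thesis using 1 by simp
qed

lemma laplacian_quadratic_zero:
  fixes y :: "'i::finite \<Rightarrow> 'a::real_inner"
  assumes E: "sym E" "\<And>i j. (i, j) \<in> E\<^sup>*"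
    and 0: "(\<Sum>i\<in>UNIV. y i \<bullet> (\<Sum>j\<in>UNIV. laplacian E $ i $ j *\<^sub>R y j)) = 0"
  shows "y i = y j"
proof -
  have nn: "0 \<le> adj E i j * ((y i - y j) \<bullet> (y i - y j))" for i j
    by (simp add: adjacency_nonneg)
  have "(\<Sum>i\<in>UNIV. \<Sum>j\<in>UNIV. adj E i j * ((y i - y j) \<bullet> (y i - y j))) = 0"
    using 0 laplacian_bilinear[OF E(1), of y y] by simp
  then have z: "adj E i j * ((y i - y j) \<bullet> (y i - y j)) = 0" for i j
    using nn by (simp add: sum_nonneg_eq_0_iff sum_nonneg)
  have edge: "y i = y j" if "(i, j) \<in> E" for i j
    using z[of i j] that by (simp add: adjacency_def)
  have "(i, j) \<in> E\<^sup>*" by (rule E(2))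
  then show ?thesis by (induction rule: rtrancl_induct) (auto dest: edge)
qed

lemma inner_mult_vec: "v \<bullet> (A *v w) = (\<Sum>i\<in>UNIV. v $ i \<bullet> (\<Sum>j\<in>UNIV. A $ i $ j *\<^sub>R w $ j))"
  for v w :: "real^'i"
  by (simp add: inner_vec_def matrix_vector_mult_def)

lemma laplacian_mult_sym:
  fixes v w :: "real^'i"
  assumes "sym E"
  shows "v \<bullet> (laplacian E *v w) = w \<bullet> (laplacian E *v v)"
  unfolding inner_mult_vec laplacian_bilinear[OF assms] by (simp add: mult.commute)

lemma laplacian_mult_nonneg:
  fixes v :: "real^'i"
  assumes "sym E"
  shows "0 \<le> v \<bullet> (laplacian E *v v)"
  unfolding inner_mult_vec laplacian_bilinear[OF assms]
  by (intro divide_nonneg_nonneg sum_nonneg mult_nonneg_nonneg adjacency_nonneg) auto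

lemma laplacian_mult_kernel:
  fixes v :: "real^'i"
  assumes "sym E" "\<And>i j. (i, j) \<in> E\<^sup>*" "v \<bullet> (laplacian E *v v) = 0"
  shows "v $ i = v $ j"
  using laplacian_quadratic_zero[OF assms(1,2), of "\<lambda>i. v $ i" i j] assms(3) unfolding inner_mult_vec by simp

text \<open>Eigenvectors of distinct eigenvalues are orthogonal, hence independent. Finiteness gives
  a meaning to the \<open>Min\<close> in \<open>lambda2\<close>.\<close>

lemma finite_eigenvalues_laplacian:
  fixes E :: "('i::finite \<times> 'i) set"
  assumes "sym E"
  shows "finite (eigenvalues (laplacian E))"
proof -
  have "\<forall>l\<in>eigenvalues (laplacian E). \<exists>v. laplacian E *v v = l *\<^sub>R v \<and> v \<noteq> 0"
    by (auto simp: eigenvalues_def eigenspace_def)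
  then obtain e where e: "\<And>l. l \<in> eigenvalues (laplacian E) \<Longrightarrow> laplacian E *v e l = l *\<^sub>R e l \<and> e l \<noteq> 0"
    by metis
  have orth: "e l \<bullet> e k = 0" if "l \<in> eigenvalues (laplacian E)" "k \<in> eigenvalues (laplacian E)" "l \<noteq> k" for l k
  proof -
    have "k * (e l \<bullet> e k) = e l \<bullet> (laplacian E *v e k)" using e[OF that(2)] by simp
    also have "\<dots> = e k \<bullet> (laplacian E *v e l)" by (rule laplacian_mult_sym[OF assms])
    also have "\<dots> = l * (e l \<bullet> e k)" using e[OF that(1)] by (simp add: inner_commute)
    finally show ?thesis using that(3) by simp
  qed
  have inj: "inj_on e (eigenvalues (laplacian E))"
  proof (rule inj_onI, rule ccontr)
    fix l k assume "l \<in> eigenvalues (laplacian E)" "k \<in> eigenvalues (laplacian E)" "e l = e k" "l \<noteq> k"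
    then show False using orth[of l k] e[of k] by simp
  qed
  have "pairwise orthogonal (e ` eigenvalues (laplacian E))"
    using orth by (auto simp: pairwise_def orthogonal_def)
  moreover have "0 \<notin> e ` eigenvalues (laplacian E)" using e by auto
  ultimately have "independent (e ` eigenvalues (laplacian E))" by (rule pairwise_orthogonal_independent)
  then have "finite (e ` eigenvalues (laplacian E))" by (rule independent_imp_finite)
  then show ?thesis using finite_imageD inj by blast
qed

text \<open>\<open>m\<close> is the minimum of the Rayleigh quotient over unit vectors with zero
  sum. It is positive since a minimiser with value 0 would be a consensus vector of zero sum, and it
  is an eigenvalue because a minimiser with nonzero residual could be improved.\<close>

lemma laplacian_fiedler:
  fixes E :: "('i::finite \<times> 'i) set"
  assumes N: "2 \<le> CARD('i)" and E: "sym E" "\<And>i j. (i, j) \<in> E\<^sup>*"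
  obtains m where "0 < m" "m \<in> eigenvalues (laplacian E)"
    "\<And>v :: real^'i. (\<Sum>i\<in>UNIV. v $ i) = 0 \<Longrightarrow> m * (v \<bullet> v) \<le> v \<bullet> (laplacian E *v v)"
proof -
  let ?L = "laplacian E"
  define C where "C = {v :: real^'i. norm v = 1 \<and> (\<Sum>i\<in>UNIV. v $ i) = 0}"
  have "closed {v :: real^'i. (\<Sum>i\<in>UNIV. v $ i) = 0}" by (intro closed_Collect_eq continuous_intros)
  moreover have "C = sphere 0 1 \<inter> {v :: real^'i. (\<Sum>i\<in>UNIV. v $ i) = 0}" by (auto simp: C_def)
  ultimately have "compact C" using compact_Int_closed[OF compact_sphere] by metis
  moreover have "C \<noteq> {}"
  proof -
    obtain i j :: 'i where ij: "i \<noteq> j"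
      using N by (metis (full_types) One_nat_def UNIV_I card_1_singleton_iff card_le_Suc0_iff_eq finite not_less_eq_eq numeral_2_eq_2)
    define v :: "real^'i" where "v = axis i 1 - axis j 1"
    have "v $ i = 1" using ij by (simp add: v_def axis_def)
    then have v: "v \<noteq> 0" by auto
    have "(\<Sum>k\<in>UNIV. v $ k) = 0" by (simp add: v_def axis_def sum_subtractf)
    then have "(1 / norm v) *\<^sub>R v \<in> C" using v by (simp add: C_def sum_distrib_left[symmetric] sum_divide_distrib[symmetric])
    then show ?thesis by blast
  qed
  moreover have "continuous_on C (\<lambda>v. v \<bullet> (?L *v v))"
    by (intro continuous_intros matrix_vector_mult_linear_continuous_on)
  ultimately obtain w where w: "w \<in> C" "\<And>v. v \<in> C \<Longrightarrow> w \<bullet> (?L *v w) \<le> v \<bullet> (?L *v v)"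
    using continuous_attains_inf[of C "\<lambda>v. v \<bullet> (?L *v v)"] by blast
  define m where "m = w \<bullet> (?L *v w)"
  have ww: "norm w = 1" "(\<Sum>i\<in>UNIV. w $ i) = 0" using w(1) by (auto simp: C_def)
  have bound: "m * (v \<bullet> v) \<le> v \<bullet> (?L *v v)" if v: "(\<Sum>i\<in>UNIV. v $ i) = 0" for v :: "real^'i"
  proof (cases "v = 0")
    case False
    have "(1 / norm v) *\<^sub>R v \<in> C" using v False by (simp add: C_def sum_distrib_left[symmetric] sum_divide_distrib[symmetric])
    from w(2)[OF this] have "m \<le> (1 / norm v)\<^sup>2 * (v \<bullet> (?L *v v))"
      by (simp add: m_def matrix_vector_mult_scaleR power2_eq_square)
    then show ?thesis using False by (simp add: divide_simps power2_norm_eq_inner)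
  qed simp
  have m: "m > 0"
  proof (rule ccontr)
    assume "\<not> m > 0"
    then have "m = 0" using laplacian_mult_nonneg[OF E(1), of w] by (simp add: m_def)
    then have "w $ i = w $ j" for i j unfolding m_def by (rule laplacian_mult_kernel[OF E])
    then have "(\<Sum>i\<in>UNIV. w $ i) = real CARD('i) * w $ j" for j by (metis sum_constant sum.cong)
    then have "w $ j = 0" for j using ww(2) by simp
    then have "w = 0" by (simp add: vec_eq_iff)
    then show False using ww(1) by simp
  qed
  have sumL: "(\<Sum>i\<in>UNIV. (?L *v v) $ i) = 0" for v :: "real^'i"
  proof -
    have "(\<Sum>i\<in>UNIV. (?L *v v) $ i) = (\<chi> i. 1) \<bullet> (?L *v v)" by (simp add: inner_vec_def)
    also have "\<dots> = 0" unfolding inner_mult_vec laplacian_bilinear[OF E(1)] by simp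
    finally show ?thesis .
  qed
  have "?L *v w = m *\<^sub>R w"
  proof (rule ccontr)
    assume neq: "?L *v w \<noteq> m *\<^sub>R w"
    \<comment> \<open>The residual is an admissible direction: images of the Laplacian have zero
      sum, and so does \<open>w\<close>.\<close>
    define h where "h = ?L *v w - m *\<^sub>R w"
    define b where "b = h \<bullet> h"
    have b: "b > 0" using neq by (simp add: b_def h_def)
    have h: "(\<Sum>i\<in>UNIV. h $ i) = 0" using ww(2) sumL by (simp add: h_def sum_subtractf sum_distrib_left[symmetric])
    define q where "q = h \<bullet> (?L *v h) - m * (h \<bullet> h)"
    have q: "q \<ge> 0" using bound[OF h] by (simp add: q_def)
    \<comment> \<open>Close to the minimiser of 2tb + t^2 q. The summand 1 allows q = 0, and the
      choice turns the expression into tb - t^2, which is negative.\<close>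
    define t where "t = - b / (q + 1)"
    have "(\<Sum>i\<in>UNIV. (w + t *\<^sub>R h) $ i) = 0" using h ww(2) by (simp add: sum.distrib sum_distrib_left[symmetric])
    from bound[OF this] have "m * (w \<bullet> w) + 2 * t * (m * (h \<bullet> w)) + t\<^sup>2 * (m * (h \<bullet> h))
        \<le> w \<bullet> (?L *v w) + 2 * t * (h \<bullet> (?L *v w)) + t\<^sup>2 * (h \<bullet> (?L *v h))"
      using laplacian_mult_sym[OF E(1), of w h]
      by (simp add: matrix_vector_right_distrib matrix_vector_mult_scaleR inner_add_left inner_add_right
          inner_commute power2_eq_square algebra_simps)
    moreover have "w \<bullet> (?L *v w) = m * (w \<bullet> w)" using ww(1) by (simp add: m_def norm_eq_1)
    moreover have "h \<bullet> (?L *v w) - m * (h \<bullet> w) = b" by (simp add: b_def h_def inner_diff_right)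
    ultimately have "0 \<le> 2 * t * b + t\<^sup>2 * q" by (simp add: q_def algebra_simps)
    also have "\<dots> = t * b - t\<^sup>2"
    proof -
      have "t * (q + 1) = - b" using q by (simp add: t_def)
      then have "t * (t * (q + 1)) = - (t * b)" by simp
      then show ?thesis by (simp add: power2_eq_square algebra_simps)
    qed
    also have "\<dots> < 0"
    proof -
      have "t < 0" using b q by (simp add: t_def)
      then have "t * b < 0" using b by (rule mult_neg_pos)
      then show ?thesis by (smt (verit) zero_le_power2)
    qed
    finally show False by simp
  qed
  moreover have "w \<noteq> 0" using ww(1) by auto
  ultimately have "m \<in> eigenvalues ?L" by (auto simp: eigenvalues_def eigenspace_def)
  with m bound show ?thesis using that by blast
qed

text \<open>Eigenvalues 0 and \<open>m\<close> together reach multiplicity two, hence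
  \<open>lambda2\<close> is at most the Rayleigh minimum \<open>m\<close>. It is positive because
  connectedness makes the kernel one-dimensional, so 0 alone does not reach multiplicity
  two.\<close>

lemma lambda2_laplacian_bounds:
  fixes E :: "('i::finite \<times> 'i) set"
  assumes N: "2 \<le> CARD('i)" and E: "sym E" "\<And>i j. (i, j) \<in> E\<^sup>*"
  shows "0 < lambda2 (laplacian E)"
    and "\<And>v :: real^'i. (\<Sum>i\<in>UNIV. v $ i) = 0 \<Longrightarrow> lambda2 (laplacian E) * (v \<bullet> v) \<le> v \<bullet> (laplacian E *v v)"
proof -
  let ?L = "laplacian E"
  obtain m where m: "0 < m" "m \<in> eigenvalues ?L"
    "\<And>v :: real^'i. (\<Sum>i\<in>UNIV. v $ i) = 0 \<Longrightarrow> m * (v \<bullet> v) \<le> v \<bullet> (?L *v v)"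
    using laplacian_fiedler[OF N E] by blast
  have fin: "finite (eigenvalues ?L)" by (rule finite_eigenvalues_laplacian[OF E(1)])
  have dim1: "1 \<le> dim (eigenspace ?L l)" if "l \<in> eigenvalues ?L" for l
  proof -
    have "dim (eigenspace ?L l) \<noteq> 0" using that unfolding dim_eq_0 eigenvalues_def by blast
    then show ?thesis by linarith
  qed
  have ones: "?L *v (\<chi> i. 1) = 0"
    using laplacian_sum[of E _ "\<lambda>_. 1::real"] by (simp add: vec_eq_iff matrix_vector_mult_def)
  have zero: "0 \<in> eigenvalues ?L"
    unfolding eigenvalues_def eigenspace_def using ones by (auto intro!: bexI[of _ "\<chi> i. 1"] simp: vec_eq_iff)
  have nonneg: "0 \<le> l" if l: "l \<in> eigenvalues ?L" for l
  proof -
    obtain v where v: "?L *v v = l *\<^sub>R v" "v \<noteq> 0" using l by (auto simp: eigenvalues_def eigenspace_def)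
    have "0 \<le> l * (v \<bullet> v)" using laplacian_mult_nonneg[OF E(1), of v] v(1) by simp
    moreover have "0 < v \<bullet> v" using v(2) by simp
    ultimately show ?thesis using mult_neg_pos[of l "v \<bullet> v"] by linarith
  qed
  let ?A = "{l \<in> eigenvalues ?L. 2 \<le> (\<Sum>m | m \<in> eigenvalues ?L \<and> m \<le> l. dim (eigenspace ?L m))}"
  have "m \<in> ?A"
  proof -
    have "(\<Sum>k\<in>{0, m}. dim (eigenspace ?L k)) \<le> (\<Sum>k | k \<in> eigenvalues ?L \<and> k \<le> m. dim (eigenspace ?L k))"
      using m zero fin by (intro sum_mono2) auto
    moreover have "(\<Sum>k\<in>{0, m}. dim (eigenspace ?L k)) = dim (eigenspace ?L 0) + dim (eigenspace ?L m)"
      using m(1) by simp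
    ultimately show ?thesis using dim1[OF zero] dim1[OF m(2)] m(2) by simp
  qed
  have finA: "finite ?A" using fin by simp
  have le: "lambda2 ?L \<le> m" unfolding lambda2_def using Min_le[OF finA \<open>m \<in> ?A\<close>] .
  have "lambda2 ?L \<in> ?A" unfolding lambda2_def using Min_in[OF finA] \<open>m \<in> ?A\<close> by blast
  then have inA: "lambda2 ?L \<in> eigenvalues ?L"
    "2 \<le> (\<Sum>k | k \<in> eigenvalues ?L \<and> k \<le> lambda2 ?L. dim (eigenspace ?L k))" by auto
  have ker: "dim (eigenspace ?L 0) \<le> 1"
  proof -
    have "v \<in> span {(\<chi> i. 1)}" if "v \<in> eigenspace ?L 0" for v
    proof -
      have "v \<bullet> (?L *v v) = 0" using that by (simp add: eigenspace_def)
      then have "v $ i = v $ j" for i j by (rule laplacian_mult_kernel[OF E])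
      then have "v = (v $ undefined) *\<^sub>R (\<chi> i. 1)" by (simp add: vec_eq_iff)
      then show ?thesis by (metis span_base span_mul singletonI)
    qed
    then have "dim (eigenspace ?L 0) \<le> card {(\<chi> i::'i. (1::real))}" by (intro dim_le_card) auto
    then show ?thesis by simp
  qed
  show pos: "0 < lambda2 ?L"
  proof (rule ccontr)
    assume "\<not> 0 < lambda2 ?L"
    then have "{k \<in> eigenvalues ?L. k \<le> lambda2 ?L} \<subseteq> {0}" using nonneg by force
    then have "(\<Sum>k | k \<in> eigenvalues ?L \<and> k \<le> lambda2 ?L. dim (eigenspace ?L k)) \<le> (\<Sum>k\<in>{0}. dim (eigenspace ?L k))"
      by (intro sum_mono2) auto
    with ker inA(2) show False by simp
  qed
  show "lambda2 ?L * (v \<bullet> v) \<le> v \<bullet> (?L *v v)" if "(\<Sum>i\<in>UNIV. v $ i) = 0" for v :: "real^'i"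
    using m(3)[OF that] le by (meson inner_ge_zero mult_right_mono order_trans)
qed

section \<open>The Laplacian acting on stacked vectors\<close>

lemma linear_kron_id: "linear (kron_id A)"
  by (intro linearI)
     (simp_all add: kron_id_def vec_eq_iff scaleR_add_right sum.distrib scaleR_sum_right sum_distrib_left algebra_simps)

lemma kron_id_inner:
  "x \<bullet> kron_id A y = (\<Sum>i\<in>UNIV. x $ i \<bullet> (\<Sum>j\<in>UNIV. A $ i $ j *\<^sub>R y $ j))"
  by (simp add: inner_vec_def[of x] kron_id_def)

lemma kron_id_laplacian_sym:
  assumes "sym E"
  shows "x \<bullet> kron_id (laplacian E) y = kron_id (laplacian E) x \<bullet> y"
  unfolding inner_commute[of "kron_id (laplacian E) x"] kron_id_inner laplacian_bilinear[OF assms]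
  by (simp add: inner_commute)

lemma kron_id_laplacian_consensus: "kron_id (laplacian E) (\<chi> i. v) = 0"
  using laplacian_sum[of E _ "\<lambda>_. v"] by (simp add: kron_id_def vec_eq_iff)

text \<open>\<open>E_perp\<close> is the orthogonal complement of the consensus vectors, which a
  self-adjoint Laplacian annihilates.\<close>

lemma kron_id_laplacian_E_perp:
  assumes "sym E"
  shows "kron_id (laplacian E) y \<in> E_perp"
proof -
  have "v \<bullet> (\<Sum>i\<in>UNIV. kron_id (laplacian E) y $ i) = 0" for v
  proof -
    have "v \<bullet> (\<Sum>i\<in>UNIV. kron_id (laplacian E) y $ i) = (\<chi> i. v) \<bullet> kron_id (laplacian E) y"
      by (simp add: inner_vec_def[of "\<chi> i. v"] inner_sum_right)
    then show ?thesis by (simp add: kron_id_laplacian_sym[OF assms] kron_id_laplacian_consensus)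
  qed
  then show ?thesis by (simp add: E_perp_def) (metis inner_eq_zero_iff)
qed

lemma E_perp_inner_consensus: "z \<in> E_perp \<Longrightarrow> z \<bullet> (\<chi> i. v) = 0"
  by (simp add: E_perp_def inner_vec_def[of z] inner_sum_left[symmetric])

lemma subspace_E_perp: "subspace E_perp"
  by (auto simp: subspace_def E_perp_def sum.distrib scaleR_sum_right[symmetric])

lemma kron_id_laplacian_zero_iff:
  fixes y :: "real^'q^'i"
  assumes E: "sym E" "\<And>i j. (i, j) \<in> E\<^sup>*" and 0: "y \<bullet> kron_id (laplacian E) y = 0"
  shows "\<exists>v. y = (\<chi> i. v)"
proof -
  have "y $ i = y $ j" for i j
    using laplacian_quadratic_zero[OF E, of "\<lambda>i. y $ i" i j] 0 unfolding kron_id_inner by simp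
  then have "y = (\<chi> i. y $ undefined)" by (simp add: vec_eq_iff)
  then show ?thesis by blast
qed

text \<open>For each coordinate \<open>q\<close>, the stack is sliced into a scalar vector over the
  agents; each slice has zero sum, and both quadratic forms are sums over the slices.\<close>

lemma lambda2_kron_id:
  fixes y :: "real^'q^'i"
  assumes N: "2 \<le> CARD('i::finite)" and E: "sym E" "\<And>i j. (i, j) \<in> E\<^sup>*" and y: "y \<in> E_perp"
  shows "lambda2 (laplacian E) * (norm y)\<^sup>2 \<le> y \<bullet> kron_id (laplacian E) y"
proof -
  define v :: "'q \<Rightarrow> real^'i" where "v q = (\<chi> i. y $ i $ q)" for q
  have v0: "(\<Sum>i\<in>UNIV. v q $ i) = 0" for q
    using arg_cong[of _ _ "\<lambda>w. w $ q", OF y[unfolded E_perp_def mem_Collect_eq]] by (simp add: v_def)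
  have "y \<bullet> y = (\<Sum>q\<in>UNIV. v q \<bullet> v q)"
    unfolding inner_vec_def v_def by (simp add: sum.swap[of _ "UNIV::'q set"])
  moreover have "y \<bullet> kron_id (laplacian E) y = (\<Sum>q\<in>UNIV. v q \<bullet> (laplacian E *v v q))"
    unfolding inner_vec_def v_def
    by (subst (2) sum.swap) (simp add: inner_vec_def kron_id_def matrix_vector_mult_def)
  moreover have "(\<Sum>q\<in>UNIV. lambda2 (laplacian E) * (v q \<bullet> v q)) \<le> (\<Sum>q\<in>UNIV. v q \<bullet> (laplacian E *v v q))"
    by (intro sum_mono lambda2_laplacian_bounds(2)[OF N E] v0)
  ultimately show ?thesis by (simp add: power2_norm_eq_inner sum_distrib_left)
qed

text \<open>
  \<open>P\<close> weights the \<open>z\<close>-component of the Lyapunov function: for the Euclidean norm the mixed terms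
  that come from \<open>z' = L \<lambda>\<close> and from \<open>- z\<close> in the equation of \<open>\<lambda>\<close> would not cancel.
\<close>

lemma laplacian_inverse_on_E_perp:
  fixes E :: "('i::finite \<times> 'i) set"
  assumes N: "2 \<le> CARD('i)" and E: "sym E" "\<And>i j. (i, j) \<in> E\<^sup>*"
  obtains P :: "real^'q^'i \<Rightarrow> real^'q^'i" and \<kappa> where
    "linear P" "\<And>z. z \<in> E_perp \<Longrightarrow> P z \<in> E_perp" "\<And>z. z \<in> E_perp \<Longrightarrow> kron_id (laplacian E) (P z) = z"
    "\<And>z z'. P z \<bullet> z' = z \<bullet> P z'" "\<kappa> > 0" "\<And>z. z \<in> E_perp \<Longrightarrow> \<kappa> * (norm z)\<^sup>2 \<le> z \<bullet> P z"
proof -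
  let ?K = "kron_id (laplacian E) :: real^'q^'i \<Rightarrow> real^'q^'i"
  \<comment> \<open>\<open>S\<close> is the missing rank of the Laplacian: it vanishes on
    \<open>E_perp\<close> and multiplies consensus vectors by the number of agents. Hence
    \<open>A\<close> is invertible on the whole space and agrees with the Laplacian on
    \<open>E_perp\<close>.\<close>
  define S where "S y = (\<chi> i::'i. \<Sum>j\<in>UNIV. y $ j)" for y :: "real^'q^'i"
  define A where "A y = ?K y + S y" for y
  have linS: "linear S"
    by (intro linearI) (simp_all add: S_def vec_eq_iff sum.distrib scaleR_sum_right sum_distrib_left)
  have linA: "linear A" unfolding A_def by (intro linear_compose_add linear_kron_id linS)
  have symS: "x \<bullet> S y = S x \<bullet> y" for x y
    by (simp add: S_def inner_vec_def[where 'b='i] inner_sum_left[symmetric] inner_sum_right[symmetric])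
  have symA: "x \<bullet> A y = A x \<bullet> y" for x y
    by (simp add: A_def inner_add_left inner_add_right symS kron_id_laplacian_sym[OF E(1)])
  have sumA: "(\<Sum>i\<in>UNIV. A y $ i) = real CARD('i) *\<^sub>R (\<Sum>i\<in>UNIV. y $ i)" for y
    using kron_id_laplacian_E_perp[OF E(1), of y] by (simp add: A_def S_def sum.distrib E_perp_def scaleR_conv_of_real sum_constant_scaleR)
  have S0: "S y = 0" if "y \<in> E_perp" for y using that by (simp add: S_def E_perp_def vec_eq_iff)
  have "inj A"
  proof (subst linear_injective_0[OF linA], intro allI impI)
    fix y assume Ay: "A y = 0"
    then have yE: "y \<in> E_perp" using sumA[of y] by (simp add: E_perp_def)
    then have "?K y = 0" using Ay S0 by (simp add: A_def)
    then obtain v where v: "y = (\<chi> i. v)" using kron_id_laplacian_zero_iff[OF E, of y] by auto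
    then show "y = 0" using E_perp_inner_consensus[OF yE, of v] by simp
  qed
  then obtain P where P: "linear P" "\<And>x. P (A x) = x" "\<And>x. A (P x) = x"
    using linear_injective_isomorphism[OF linA] by blast
  have PE: "P z \<in> E_perp" if "z \<in> E_perp" for z
    using sumA[of "P z"] that by (simp add: P E_perp_def)
  have KP: "?K (P z) = z" if "z \<in> E_perp" for z
    using P(3)[of z] S0[OF PE[OF that]] by (simp add: A_def)
  obtain C where C: "C > 0" "\<And>y. norm (A y) \<le> C * norm y"
    using linear_bounded_pos[OF linA] by blast
  \<comment> \<open>With y = P z the form is the Laplacian form at y, thus at least \<lambda>2
    |y|^2, while |z| = |A y| \<le> C |y|.\<close>
  define \<kappa> where "\<kappa> = lambda2 (laplacian E) / C\<^sup>2"
  note l2 = lambda2_laplacian_bounds(1)[OF N E]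
  have "\<kappa> * (norm z)\<^sup>2 \<le> z \<bullet> P z" if z: "z \<in> E_perp" for z
  proof -
    have "norm z \<le> C * norm (P z)" using C(2)[of "P z"] P(3) by simp
    then have "(norm z)\<^sup>2 \<le> C\<^sup>2 * (norm (P z))\<^sup>2" by (metis norm_ge_zero power_mono power_mult_distrib)
    then have "\<kappa> * (norm z)\<^sup>2 \<le> \<kappa> * (C\<^sup>2 * (norm (P z))\<^sup>2)" using l2 C(1) by (intro mult_left_mono) (auto simp: \<kappa>_def)
    also have "\<dots> = lambda2 (laplacian E) * (norm (P z))\<^sup>2" using C(1) by (simp add: \<kappa>_def)
    also have "\<dots> \<le> P z \<bullet> ?K (P z)" by (rule lambda2_kron_id[OF N E PE[OF z]])
    finally show ?thesis using KP[OF z] by (simp add: inner_commute)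
  qed
  moreover have "P z \<bullet> z' = z \<bullet> P z'" for z z' using symA[of "P z" "P z'"] by (simp add: P(3))
  moreover have "\<kappa> > 0" using l2 C(1) by (simp add: \<kappa>_def)
  ultimately show thesis using that[OF P(1) PE KP] by blast
qed

section \<open>Gradients, variational inequalities and multipliers\<close>

lemma blk_nth: "blk own i x $ k = (if own k = i then x $ k else 0)"
  by (simp add: blk_def)

lemma linear_blk: "linear (blk own i)"
  by (intro linearI) (auto simp: blk_def vec_eq_iff)

lemma blk_blk: "blk own i (blk own j x) = (if i = j then blk own i x else 0)"
  by (auto simp: blk_def vec_eq_iff)

lemma sum_blk: "(\<Sum>i\<in>UNIV. blk own i x) = x"
  by (simp add: blk_def vec_eq_iff)

lemma deviate_self: "deviate own i x x = x"
  by (simp add: deviate_def vec_eq_iff)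

lemma deviate_eq: "deviate own i y x = x + blk own i (y - x)"
  by (simp add: deviate_def blk_def vec_eq_iff)

text \<open>A pseudo-gradient takes its coordinate \<open>k\<close> from the gradient of the agent
  that owns \<open>k\<close>; against a vector it decomposes into one term per agent and
  block.\<close>

lemma sum_own_inner:
  fixes G :: "'i::finite \<Rightarrow> real^'n"
  shows "(\<chi> k. G (own k) $ k) \<bullet> v = (\<Sum>i\<in>UNIV. G i \<bullet> blk own i v)"
proof -
  have "(\<Sum>i\<in>UNIV. G i \<bullet> blk own i v) = (\<Sum>i\<in>UNIV. \<Sum>k\<in>UNIV. if own k = i then G i $ k * v $ k else 0)"
    by (simp add: inner_vec_def blk_nth if_distrib[of "\<lambda>a. _ * a"] cong: if_cong)
  also have "\<dots> = (\<Sum>k\<in>UNIV. \<Sum>i\<in>UNIV. if own k = i then G i $ k * v $ k else 0)" by (rule sum.swap)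
  also have "\<dots> = (\<Sum>k\<in>UNIV. G (own k) $ k * v $ k)" by simp
  finally show ?thesis by (simp add: inner_vec_def)
qed

text \<open>Existence and uniqueness of the Riesz representative, which give the definite
  description in \<open>grad\<close> its meaning.\<close>

lemma grad_inner:
  fixes h :: "'a::euclidean_space \<Rightarrow> real"
  assumes "(h has_derivative h') (at x)"
  shows "grad h x \<bullet> v = h' v"
proof -
  have lin: "linear h'" using assms has_derivative_linear by blast
  define D where "D = (\<Sum>b\<in>Basis. h' b *\<^sub>R b)"
  have D: "v \<bullet> D = h' v" for v
  proof -
    have "h' v = h' (\<Sum>b\<in>Basis. (v \<bullet> b) *\<^sub>R b)" by (simp add: euclidean_representation)
    also have "\<dots> = (\<Sum>b\<in>Basis. (v \<bullet> b) * h' b)" using lin by (simp add: linear_sum linear_scale)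
    finally show ?thesis by (simp add: D_def inner_sum_right mult.commute)
  qed
  have gD: "GDERIV h x :> D" unfolding gderiv_def using assms D by (simp add: fun_eq_iff)
  have "grad h x = D" unfolding grad_def
  proof (rule the_equality)
    show "GDERIV h x :> D" by (rule gD)
    fix D' assume "GDERIV h x :> D'"
    with gD have "(\<lambda>v. v \<bullet> D') = (\<lambda>v. v \<bullet> D)" unfolding gderiv_def by (metis has_derivative_unique)
    from fun_cong[OF this, of "D' - D"] have "(D' - D) \<bullet> (D' - D) = 0" by (simp add: inner_diff_right)
    then show "D' = D" by simp
  qed
  moreover have "D \<bullet> v = h' v" using D[of v] by (subst inner_commute)
  ultimately show ?thesis by simp
qed

text \<open>Along the segment to \<open>y\<close>, difference quotients are bounded by the chord
  slope; the derivative is their limit from the right.\<close>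

lemma convex_on_UNIV_above_tangent:
  fixes \<phi> :: "'a::real_normed_vector \<Rightarrow> real"
  assumes conv: "convex_on UNIV \<phi>" and der: "(\<phi> has_derivative \<phi>') (at x)"
  shows "\<phi>' (y - x) \<le> \<phi> y - \<phi> x"
proof -
  have lin: "linear \<phi>'" using der has_derivative_linear by blast
  have "((\<lambda>s::real. x + s *\<^sub>R (y - x)) has_derivative (\<lambda>s. s *\<^sub>R (y - x))) (at 0)"
    by (auto intro!: derivative_eq_intros)
  from diff_chain_at[OF this, of \<phi> \<phi>'] der
  have "((\<lambda>s. \<phi> (x + s *\<^sub>R (y - x))) has_derivative (\<lambda>s. \<phi>' (s *\<^sub>R (y - x)))) (at 0)"
    by (simp add: o_def)
  then have "((\<lambda>s. \<phi> (x + s *\<^sub>R (y - x))) has_real_derivative \<phi>' (y - x)) (at 0)"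
    by (simp add: has_field_derivative_def linear_scale[OF lin] mult.commute[of _ "\<phi>' (y - x)"])
  then have "((\<lambda>s. (\<phi> (x + s *\<^sub>R (y - x)) - \<phi> x) / s) \<longlongrightarrow> \<phi>' (y - x)) (at_right 0)"
    by (auto simp: has_field_derivative_iff intro: Lim_at_imp_Lim_at_within)
  then show ?thesis
  proof (rule tendsto_upperbound)
    have "eventually (\<lambda>s::real. s \<in> {0<..<1}) (at_right 0)" by (rule eventually_at_right_real) simp
    then show "\<forall>\<^sub>F s in at_right 0. (\<phi> (x + s *\<^sub>R (y - x)) - \<phi> x) / s \<le> \<phi> y - \<phi> x"
    proof eventually_elim
      case (elim s)
      have "\<phi> ((1 - s) *\<^sub>R x + s *\<^sub>R y) \<le> (1 - s) * \<phi> x + s * \<phi> y"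
        using convex_onD[OF conv, of s x y] elim by simp
      moreover have "(1 - s) *\<^sub>R x + s *\<^sub>R y = x + s *\<^sub>R (y - x)" by (simp add: algebra_simps)
      ultimately have "\<phi> (x + s *\<^sub>R (y - x)) - \<phi> x \<le> (\<phi> y - \<phi> x) * s" by (simp add: algebra_simps)
      with elim show ?case by (simp add: pos_divide_le_eq)
    qed
  qed simp
qed

lemma convex_on_range_linear:
  assumes "convex_on (range h) \<phi>" "linear h"
  shows "convex_on UNIV (\<lambda>y. \<phi> (h y))"
proof (rule convex_onI)
  fix t :: real and x y assume t: "0 < t" "t < 1"
  show "\<phi> (h ((1 - t) *\<^sub>R x + t *\<^sub>R y)) \<le> (1 - t) * \<phi> (h x) + t * \<phi> (h y)"
    using convex_onD[OF assms(1), of t "h x" "h y"] t by (simp add: linear_add[OF assms(2)] linear_scale[OF assms(2)])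
qed simp

text \<open>Solutions are the fixed points of x \<mapsto> proj(x - \<gamma> F x). The factor 1 - 2
  \<gamma> \<mu> + \<gamma>^2 L'^2 for squared distances is smallest for \<gamma> = \<mu>/L'^2,
  which makes the map a contraction.\<close>

theorem variational_inequality_exists:
  fixes F :: "'a::euclidean_space \<Rightarrow> 'a"
  assumes K: "closed K" "convex K" "K \<noteq> {}" and lip: "L-lipschitz_on UNIV F" and \<mu>: "\<mu> > 0"
    and mono: "\<And>x y. (F x - F y) \<bullet> (x - y) \<ge> \<mu> * (norm (x - y))\<^sup>2"
  obtains x where "x \<in> K" "\<And>y. y \<in> K \<Longrightarrow> F x \<bullet> (y - x) \<ge> 0"
proof -
  \<comment> \<open>The maximum ensures \<mu> \<le> L' and L' > 0, so the square root below is taken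
    of a number in [0,1).\<close>
  define L' where "L' = max L \<mu>"
  have L': "L' > 0" "\<mu> \<le> L'" using \<mu> by (auto simp: L'_def)
  have lip': "norm (F x - F y) \<le> L' * norm (x - y)" for x y
  proof -
    have "norm (F x - F y) \<le> L * norm (x - y)" using lipschitz_onD[OF lip, of x y] by (simp add: dist_norm)
    also have "\<dots> \<le> L' * norm (x - y)" by (intro mult_right_mono) (auto simp: L'_def)
    finally show ?thesis .
  qed
  define \<gamma> where "\<gamma> = \<mu> / L'\<^sup>2"
  have \<gamma>: "\<gamma> > 0" using \<mu> L' by (simp add: \<gamma>_def)
  define q where "q = sqrt (1 - \<mu>\<^sup>2 / L'\<^sup>2)"
  have q2: "0 \<le> 1 - \<mu>\<^sup>2 / L'\<^sup>2" "1 - \<mu>\<^sup>2 / L'\<^sup>2 < 1" using L' \<mu> by (auto simp: divide_le_eq power_mono)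
  define T where "T x = closest_point K (x - \<gamma> *\<^sub>R F x)" for x
  have "\<exists>!x\<in>K. T x = x"
  proof (rule Banach_fix)
    show "complete K" using K(1) by (simp add: complete_eq_closed)
    show "K \<noteq> {}" by fact
    show "0 \<le> q" "q < 1" using q2 by (auto simp: q_def)
    show "T ` K \<subseteq> K" using closest_point_in_set[OF K(1,3)] by (auto simp: T_def)
    have contr: "dist (T x) (T y) \<le> q * dist x y" for x y
    proof -
      have "(norm ((x - \<gamma> *\<^sub>R F x) - (y - \<gamma> *\<^sub>R F y)))\<^sup>2
          = (norm (x - y))\<^sup>2 - 2 * \<gamma> * ((F x - F y) \<bullet> (x - y)) + \<gamma>\<^sup>2 * (norm (F x - F y))\<^sup>2"
        by (simp only: power2_norm_eq_inner) (simp add: inner_diff_left inner_diff_right inner_commute algebra_simps power2_eq_square)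
      also have "\<dots> \<le> (norm (x - y))\<^sup>2 - 2 * \<gamma> * (\<mu> * (norm (x - y))\<^sup>2) + \<gamma>\<^sup>2 * (L' * norm (x - y))\<^sup>2"
        using mono[of x y] lip'[of x y] \<gamma>
        by (intro add_mono diff_mono mult_left_mono power_mono) auto
      also have "\<dots> = (1 - \<mu>\<^sup>2 / L'\<^sup>2) * (norm (x - y))\<^sup>2"
        using L' by (simp add: \<gamma>_def field_simps power2_eq_square)
      also have "\<dots> = (q * norm (x - y))\<^sup>2" using q2 by (simp add: q_def power_mult_distrib)
      finally have "norm ((x - \<gamma> *\<^sub>R F x) - (y - \<gamma> *\<^sub>R F y)) \<le> q * norm (x - y)"
        by (rule power2_le_imp_le) (use q2 in \<open>simp add: q_def\<close>)
      then show ?thesis unfolding T_def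
        using closest_point_lipschitz[OF K(2,1,3), of "x - \<gamma> *\<^sub>R F x" "y - \<gamma> *\<^sub>R F y"] by (simp add: dist_norm)
    qed
    then show "\<And>x y. x \<in> K \<Longrightarrow> y \<in> K \<Longrightarrow> dist (T x) (T y) \<le> q * dist x y" by blast
  qed
  then obtain x where x: "x \<in> K" "T x = x" by blast
  have "F x \<bullet> (y - x) \<ge> 0" if "y \<in> K" for y
  proof -
    have "(x - \<gamma> *\<^sub>R F x - x) \<bullet> (y - x) \<le> 0"
      using closest_point_dot[OF K(2,1) that, of "x - \<gamma> *\<^sub>R F x"] x(2) by (simp add: T_def)
    then have "\<gamma> * (F x \<bullet> (y - x)) \<ge> 0" by simp
    then show ?thesis using \<gamma> by (simp add: zero_le_mult_iff)
  qed
  with x(1) show thesis using that by blast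
qed

text \<open>Lagrange duality for a linear objective: a hyperplane separates 0 from the set of
  attainable pairs of objective and constraint bounds. Slater's point excludes a vertical
  hyperplane, so its objective coefficient can be normalised to 1.\<close>

theorem slater_multiplier:
  fixes G :: "'a::euclidean_space \<Rightarrow> real^'m"
  assumes S: "convex S" and G: "\<And>j. convex_on S (\<lambda>y. G y $ j)"
    and x: "x \<in> S" "\<And>j. G x $ j \<le> 0"
    and slater: "y0 \<in> S" "\<And>j. G y0 $ j < 0"
    and vi: "\<And>y. y \<in> S \<Longrightarrow> (\<And>j. G y $ j \<le> 0) \<Longrightarrow> 0 \<le> a \<bullet> (y - x)"
  obtains l where "\<And>j. 0 \<le> l $ j" "l \<bullet> G x = 0" "\<And>y. y \<in> S \<Longrightarrow> 0 \<le> a \<bullet> (y - x) + l \<bullet> G y"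
proof -
  define A :: "(real \<times> (real^'m)) set" where "A = {(r, w) | r w. \<exists>y\<in>S. a \<bullet> (y - x) < r \<and> (\<forall>j. G y $ j \<le> w $ j)}"
  have "convex A"
  proof (rule convexI)
    fix p q :: "real \<times> (real^'m)" and s t :: real
    assume p: "p \<in> A" and q: "q \<in> A" and st: "0 \<le> s" "0 \<le> t" "s + t = 1"
    obtain y where y: "y \<in> S" "a \<bullet> (y - x) < fst p" "\<And>j. G y $ j \<le> snd p $ j" using p by (auto simp: A_def)
    obtain z where z: "z \<in> S" "a \<bullet> (z - x) < fst q" "\<And>j. G z $ j \<le> snd q $ j" using q by (auto simp: A_def)
    let ?w = "s *\<^sub>R y + t *\<^sub>R z"
    have "?w \<in> S" using convexD[OF S y(1) z(1)] st by blast
    moreover have "a \<bullet> (?w - x) < fst (s *\<^sub>R p + t *\<^sub>R q)"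
    proof -
      have "x = s *\<^sub>R x + t *\<^sub>R x" using st by (simp add: scaleR_add_left[symmetric])
      then have "?w - x = s *\<^sub>R (y - x) + t *\<^sub>R (z - x)" by (simp add: algebra_simps)
      then have "a \<bullet> (?w - x) = s * (a \<bullet> (y - x)) + t * (a \<bullet> (z - x))" by (simp add: inner_add_right)
      also have "\<dots> < s * fst p + t * fst q"
      proof (cases "s = 0")
        case True then show ?thesis using st z by simp
      next
        case False
        then have "s * (a \<bullet> (y - x)) < s * fst p" using st y by simp
        moreover have "t * (a \<bullet> (z - x)) \<le> t * fst q" using st z by (intro mult_left_mono) auto
        ultimately show ?thesis by simp
      qed
      finally show ?thesis by simp
    qed
    moreover have "G ?w $ j \<le> snd (s *\<^sub>R p + t *\<^sub>R q) $ j" for j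
    proof -
      have s: "s = 1 - t" using st by simp
      have "G ?w $ j \<le> s * G y $ j + t * G z $ j"
        using convex_onD[OF G, of t y z j] st y(1) z(1) unfolding s by simp
      also have "\<dots> \<le> s * snd p $ j + t * snd q $ j" using st y z by (intro add_mono mult_left_mono) auto
      finally show ?thesis by simp
    qed
    ultimately show "s *\<^sub>R p + t *\<^sub>R q \<in> A" unfolding A_def mem_Collect_eq by (metis surjective_pairing)
  qed
  \<comment> \<open>The objective coordinate is strict in \<open>A\<close>: a point over 0 would be
    a feasible \<open>y\<close> of negative objective.\<close>
  moreover have "0 \<notin> A" using vi by (force simp: A_def zero_prod_def)
  ultimately have "\<exists>a. a \<noteq> 0 \<and> (\<forall>z\<in>A. 0 \<le> a \<bullet> z)" by (rule separating_hyperplane_set_0)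
  then obtain pl where pl: "pl \<noteq> 0" "\<And>z. z \<in> A \<Longrightarrow> 0 \<le> pl \<bullet> z" by blast
  obtain p l where pl_eq: "pl = (p, l)" by (cases pl)
  have sep: "0 \<le> p * r + l \<bullet> w" if "y \<in> S" "a \<bullet> (y - x) < r" "\<And>j. G y $ j \<le> w $ j" for y r w
    using pl(2)[of "(r, w)"] that by (auto simp: A_def pl_eq)
  \<comment> \<open>Strictness in the objective coordinate is removed by letting \<open>r\<close>
    decrease to its infimum.\<close>
  have sep': "0 \<le> p * (a \<bullet> (y - x)) + l \<bullet> G y" if y: "y \<in> S" for y
  proof -
    have "((\<lambda>r. p * r + l \<bullet> G y) \<longlongrightarrow> p * (a \<bullet> (y - x)) + l \<bullet> G y) (at_right (a \<bullet> (y - x)))"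
      by (intro tendsto_intros)
    then show ?thesis
    proof (rule tendsto_lowerbound)
      show "\<forall>\<^sub>F r in at_right (a \<bullet> (y - x)). 0 \<le> p * r + l \<bullet> G y"
        using sep[OF y _ order_refl] by (auto simp: eventually_at_filter)
    qed simp
  qed
  \<comment> \<open>\<open>A\<close> is closed under raising any coordinate; the separating
    functional stays nonnegative along such rays, so its coefficients are nonnegative.\<close>
  have linear_bound: "k \<ge> 0" if "\<And>t. t \<ge> 0 \<Longrightarrow> 0 \<le> C + t * k" for k C :: real
  proof (rule ccontr)
    assume k: "\<not> k \<ge> 0"
    define t where "t = (\<bar>C\<bar> + 1) / (- k)"
    have "t \<ge> 0" unfolding t_def using k by (intro divide_nonneg_pos) auto
    moreover have "t * k = - (\<bar>C\<bar> + 1)" using k by (simp add: t_def)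
    ultimately show False using that[of t] by linarith
  qed
  have p0: "p \<ge> 0"
  proof (rule linear_bound)
    fix t :: real assume "t \<ge> 0"
    then show "0 \<le> (p * 1 + l \<bullet> G x) + t * p" using sep[OF x(1), of "1 + t" "G x"] by (simp add: algebra_simps)
  qed
  have l0: "l $ j \<ge> 0" for j
  proof (rule linear_bound)
    fix t :: real assume t: "t \<ge> 0"
    have "0 \<le> p * 1 + l \<bullet> (G x + t *\<^sub>R axis j 1)"
      using t by (intro sep[OF x(1)]) (auto simp: axis_def)
    then show "0 \<le> (p * 1 + l \<bullet> G x) + t * l $ j" by (simp add: inner_add_right inner_axis algebra_simps)
  qed
  have p: "p > 0"
  proof (rule ccontr)
    assume "\<not> p > 0"
    then have p: "p = 0" using p0 by simp
    then have "l \<noteq> 0" using pl(1) by (simp add: pl_eq zero_prod_def)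
    then obtain j where j: "l $ j \<noteq> 0" by (auto simp: vec_eq_iff)
    have "l \<bullet> G y0 = (\<Sum>k\<in>UNIV. l $ k * G y0 $ k)" by (simp add: inner_vec_def)
    also have "\<dots> < 0"
    proof -
      have "(\<Sum>k\<in>UNIV. l $ k * G y0 $ k) < (\<Sum>k\<in>(UNIV::'m set). 0)"
      proof (rule sum_strict_mono_ex1)
        show "\<forall>k\<in>UNIV. l $ k * G y0 $ k \<le> 0"
          using l0 less_imp_le[OF slater(2)] by (simp add: mult_nonneg_nonpos)
        have "l $ j > 0" using l0[of j] j by simp
        then show "\<exists>k\<in>UNIV. l $ k * G y0 $ k < 0"
          using slater(2)[of j] by (auto intro!: exI[of _ j] mult_pos_neg)
      qed simp
      then show ?thesis by simp
    qed
    finally show False using sep'[OF slater(1)] p by simp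
  qed
  define l' where "l' = (1 / p) *\<^sub>R l"
  have l': "l' $ j \<ge> 0" for j using l0 p by (simp add: l'_def)
  have main: "0 \<le> a \<bullet> (y - x) + l' \<bullet> G y" if "y \<in> S" for y
  proof -
    have "a \<bullet> (y - x) + l' \<bullet> G y = (p * (a \<bullet> (y - x)) + l \<bullet> G y) / p" using p by (simp add: l'_def field_simps)
    then show ?thesis using sep'[OF that] p by simp
  qed
  have "l' \<bullet> G x \<le> 0"
    \<comment> \<open>Feasibility and the signs give one half of complementary slackness; the other
      half is the Lagrangian inequality at \<open>y = x\<close>.\<close>
    unfolding inner_vec_def using l' x(2) by (intro sum_nonpos) (simp add: mult_nonneg_nonpos)
  moreover have "l' \<bullet> G x \<ge> 0" using main[OF x(1)] by simp
  ultimately have "l' \<bullet> G x = 0" by simp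
  with l' main show thesis using that by blast
qed

section \<open>The game\<close>

lemma has_derivative_vec_lambda:
  fixes h :: "'i::finite \<Rightarrow> 'a::real_normed_vector \<Rightarrow> 'b::euclidean_space"
  assumes "\<And>i. (h i has_derivative h' i) F"
  shows "((\<lambda>x. \<chi> i. h i x) has_derivative (\<lambda>v. \<chi> i. h' i v)) F"
proof -
  have bl: "bounded_linear (axis i :: 'b \<Rightarrow> 'b^'i)" for i :: 'i
    by (intro linear_conv_bounded_linear[THEN iffD1] linearI) (auto simp: axis_def vec_eq_iff)
  have eq: "(\<chi> i. w i) = (\<Sum>i\<in>UNIV. axis i (w i))" for w :: "'i \<Rightarrow> 'b"
    by (simp add: vec_eq_iff axis_def)
  show ?thesis
    unfolding eq by (intro has_derivative_sum bounded_linear.has_derivative[OF bl] assms)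
qed

text \<open>Complementarity: the test points \<open>l + axis j 1\<close>, \<open>0\<close> and
  \<open>2 *\<^sub>R l\<close> yield the signs and the two inequalities for the inner
  product.\<close>

lemma normal_cone_nonneg_iff:
  fixes l w :: "real^'m"
  shows "0 \<le> l \<Longrightarrow> w \<in> normal_cone {0..} l \<longleftrightarrow> (\<forall>j. w $ j \<le> 0) \<and> l \<bullet> w = 0"
proof
  assume l: "0 \<le> l" and w: "w \<in> normal_cone {0..} l"
  then have le: "w \<bullet> (z - l) \<le> 0" if "0 \<le> z" for z using that by (auto simp: normal_cone_def)
  have "w $ j \<le> 0" for j
  proof -
    have "0 \<le> l + axis j 1" using l by (auto simp: less_eq_vec_def axis_def)
    from le[OF this] show ?thesis by (simp add: inner_axis)
  qed
  moreover have "w \<bullet> (- l) \<le> 0" using le[of 0] by simp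
  moreover have "0 \<le> 2 *\<^sub>R l" using l by (auto simp: less_eq_vec_def)
  from le[OF this] have "w \<bullet> l \<le> 0" by (simp add: scaleR_2)
  ultimately show "(\<forall>j. w $ j \<le> 0) \<and> l \<bullet> w = 0" by (auto simp: inner_commute)
next
  assume "0 \<le> l" and w: "(\<forall>j. w $ j \<le> 0) \<and> l \<bullet> w = 0"
  have "w \<bullet> z \<le> 0" if "0 \<le> z" for z
    using that w unfolding inner_vec_def less_eq_vec_def by (intro sum_nonpos) (simp add: mult_nonpos_nonneg)
  then show "w \<in> normal_cone {0..} l"
    using w by (auto simp: normal_cone_def inner_diff_right inner_commute)
qed

locale aggregative_game =
  fixes own :: "'n::finite \<Rightarrow> 'i::finite"
    and \<Omega> :: "'i \<Rightarrow> (real^'n) set"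
    and g :: "'i \<Rightarrow> real^'n \<Rightarrow> real^'m"
    and M :: "real^'n^'b"
    and d :: "'i \<Rightarrow> real^'b"
    and f :: "'i \<Rightarrow> real^'n \<Rightarrow> real^'b \<Rightarrow> real"
    and \<mu> \<theta> :: real
  assumes f_diff: "\<And>i x s. (\<lambda>(y, r). f i (blk own i y) r) differentiable (at (x, s))"
    and \<Omega>_closed: "\<And>i. closed (\<Omega> i)"
    and \<Omega>_convex: "\<And>i. convex (\<Omega> i)"
    and g_convex: "\<And>i j. convex_on (range (blk own i)) (\<lambda>y. g i y $ j)"
    and g_C1: "\<And>i. C1 (\<lambda>y. g i (blk own i y))"
    and slater: "\<exists>x\<in>joint own \<Omega>. \<forall>j. coupling own g x $ j < 0"
    and J_convex: "\<And>i x. convex_on (range (blk own i)) (\<lambda>y. cost own M d f i (deviate own i y x))"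
    and \<mu>_pos: "\<mu> > 0"
    and F_strongly_monotone: "\<And>x y. (pseudo_grad own M d f x - pseudo_grad own M d f y) \<bullet> (x - y)
                                \<ge> \<mu> * (norm (x - y))\<^sup>2"
    and Ft_lipschitz: "\<theta>-lipschitz_on UNIV (\<lambda>(x, \<sigma>). ext_pseudo_grad own M f x \<sigma>)"
begin

abbreviation "\<psi> \<equiv> psi own M d"
abbreviation "\<psi>s \<equiv> psi_stack own M d"
abbreviation "F \<equiv> pseudo_grad own M d f"
abbreviation "Ft \<equiv> ext_pseudo_grad own M f"
abbreviation "G \<equiv> coupling own g"
abbreviation "Gs \<equiv> coupling_stack own g"
abbreviation "X \<equiv> joint own \<Omega>"
abbreviation "JT x l \<equiv> adjoint (frechet_derivative Gs (at x)) l"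

text \<open>A single choice of derivative that also depends continuously on \<open>x\<close>; the
  continuity of \<open>JT\<close> rests on it.\<close>

definition Dg :: "'i \<Rightarrow> real^'n \<Rightarrow> (real^'n) \<Rightarrow>\<^sub>L (real^'m)"
  where "Dg i = (SOME h'. (\<forall>x. ((\<lambda>y. g i (blk own i y)) has_derivative blinfun_apply (h' x)) (at x))
                  \<and> continuous_on UNIV h')"

lemma Dg: "((\<lambda>y. g i (blk own i y)) has_derivative blinfun_apply (Dg i x)) (at x)" "continuous_on UNIV (Dg i)"
  using someI_ex[OF g_C1[of i, unfolded C1_def]] unfolding Dg_def by auto

lemma Gs_deriv: "(Gs has_derivative (\<lambda>v. \<chi> i. Dg i x v)) (at x)"
  unfolding coupling_stack_def[abs_def] by (intro has_derivative_vec_lambda Dg)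

lemma Gs_continuous: "continuous_on UNIV Gs"
  using Gs_deriv by (meson continuous_at_imp_continuous_on has_derivative_continuous)

lemma G_eq_sum: "G x = (\<Sum>i\<in>UNIV. Gs x $ i)"
  by (simp add: coupling_def coupling_stack_def)

lemma G_deriv: "(G has_derivative (\<lambda>v. \<Sum>i\<in>UNIV. Dg i x v)) (at x)"
  unfolding coupling_def[abs_def] by (intro has_derivative_sum Dg)

lemma JT_inner: "JT x l \<bullet> v = (\<Sum>i\<in>UNIV. Dg i x v \<bullet> l $ i)"
proof -
  have lin: "linear (\<lambda>v. \<chi> i. Dg i x v)" using Gs_deriv[of x] has_derivative_linear by blast
  have "JT x l = adjoint (\<lambda>v. \<chi> i. Dg i x v) l" using frechet_derivative_at[OF Gs_deriv[of x]] by simp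
  then have "JT x l \<bullet> v = (\<chi> i. Dg i x v) \<bullet> l" using adjoint_works[OF lin, of v l] by (simp add: inner_commute)
  then show ?thesis by (simp add: inner_vec_def[of "\<chi> i. Dg i x v"])
qed

text \<open>The bridge between the KKT system, which has one multiplier for the summed constraint,
  and the dynamics, where every agent holds its own copy.\<close>

lemma JT_consensus: "adjoint (frechet_derivative G (at x)) l = JT x (\<chi> i. l)"
proof -
  have lin: "linear (\<lambda>v. \<Sum>i\<in>UNIV. Dg i x v)" using G_deriv[of x] has_derivative_linear by blast
  have "adjoint (frechet_derivative G (at x)) l \<bullet> v = JT x (\<chi> i. l) \<bullet> v" for v
    using adjoint_works[OF lin, of v l] unfolding JT_inner frechet_derivative_at[OF G_deriv[of x], symmetric]
    by (simp add: inner_commute inner_sum_right)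
  then show ?thesis by (metis vector_eq_rdot inner_commute)
qed

lemma JT_continuous: "continuous_on UNIV (\<lambda>(x, l). JT x l)"
proof (rule continuous_on_vec_lambda[of UNIV "\<lambda>k (x, l). JT x l $ k", THEN continuous_on_eq])
  fix k
  have eq: "JT x l $ k = (\<Sum>i\<in>UNIV. Dg i x (axis k 1) \<bullet> l $ i)" for x l
    using JT_inner[of x l "axis k 1"] by (simp add: inner_axis)
  have "continuous_on UNIV (\<lambda>p. Dg i (fst p))" for i
    using continuous_on_compose2[OF Dg(2)[of i] continuous_on_fst[OF continuous_on_id]] by auto
  then have "continuous_on UNIV (\<lambda>p::(real^'n) \<times> (real^'m^'i). \<Sum>i\<in>UNIV. Dg i (fst p) (axis k 1) \<bullet> snd p $ i)"
    by (intro continuous_intros)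
  then show "continuous_on UNIV (\<lambda>(x, l). JT x l $ k)" by (simp add: eq split_def)
qed auto

lemma Gs_convex:
  assumes "0 \<le> l"
  shows "JT x l \<bullet> (y - x) \<le> l \<bullet> (Gs y - Gs x)"
proof -
  have "Dg i x (y - x) $ j \<le> Gs y $ i $ j - Gs x $ i $ j" for i j
  proof -
    have "convex_on UNIV (\<lambda>y. g i (blk own i y) $ j)"
      using convex_on_range_linear[OF g_convex linear_blk] .
    moreover have "((\<lambda>y. g i (blk own i y) $ j) has_derivative (\<lambda>v. Dg i x v $ j)) (at x)"
      by (rule bounded_linear.has_derivative[OF bounded_linear_vec_nth Dg(1)])
    ultimately show ?thesis using convex_on_UNIV_above_tangent[of "\<lambda>y. g i (blk own i y) $ j" _ x y]
      by (simp add: coupling_stack_def)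
  qed
  moreover have "0 \<le> l $ i $ j" for i j using assms by (simp add: less_eq_vec_def)
  ultimately have "(\<Sum>i\<in>UNIV. \<Sum>j\<in>UNIV. l $ i $ j * Dg i x (y - x) $ j) \<le> (\<Sum>i\<in>UNIV. \<Sum>j\<in>UNIV. l $ i $ j * (Gs y $ i $ j - Gs x $ i $ j))"
    by (intro sum_mono mult_left_mono) auto
  then show ?thesis unfolding JT_inner by (simp add: inner_vec_def mult.commute)
qed

text \<open>Saddle structure of the Lagrangian, which is convex in \<open>x\<close> for nonnegative
  \<open>l\<close> and affine in \<open>l\<close>: the gradient inequalities at the two points add
  up to monotonicity. This replaces a Lipschitz bound for \<open>JT\<close>.\<close>

lemma constraint_field_monotone:
  assumes "0 \<le> l" "0 \<le> l'"
  shows "(x - x') \<bullet> (- JT x l + JT x' l') + (l - l') \<bullet> (Gs x - Gs x') \<le> 0"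
  using Gs_convex[OF assms(1), of x x'] Gs_convex[OF assms(2), of x' x]
  by (simp add: algebra_simps inner_commute)

lemma \<psi>_eq: "\<psi> x = (1 / real CARD('i)) *\<^sub>R (M *v x + (\<Sum>i\<in>UNIV. d i))"
proof -
  have "(\<Sum>i\<in>UNIV. M *v blk own i x) = M *v x"
    by (simp add: linear_sum[OF matrix_vector_mul_linear, symmetric] sum_blk)
  then show ?thesis by (simp add: psi_def psi_stack_def sum.distrib)
qed

lemma \<psi>_deriv: "(\<psi> has_derivative (\<lambda>v. (1 / real CARD('i)) *\<^sub>R (M *v v))) (at x)"
proof -
  have "((\<lambda>x. M *v x) has_derivative (\<lambda>v. M *v v)) (at x)"
    by (intro bounded_linear_imp_has_derivative) (simp add: matrix_vector_mul_bounded_linear)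
  then have "((\<lambda>x. (1 / real CARD('i)) *\<^sub>R (M *v x + (\<Sum>i\<in>UNIV. d i))) has_derivative
      (\<lambda>v. (1 / real CARD('i)) *\<^sub>R (M *v v + 0))) (at x)"
    by (intro has_derivative_scaleR_right has_derivative_add has_derivative_const)
  then show ?thesis by (simp add: \<psi>_eq[abs_def])
qed

lemma mean_\<psi>s: "(\<Sum>i\<in>UNIV. \<psi>s x $ i) = real CARD('i) *\<^sub>R \<psi> x"
  by (simp add: psi_def)

lemma \<psi>s_eq: "\<psi>s x = B_diag own M x + (\<chi> i. d i)"
  by (simp add: psi_stack_def B_diag_def vec_eq_iff)

lemma linear_B: "linear (B_diag own M)"
  by (intro linearI)
     (simp_all add: B_diag_def vec_eq_iff linear_add[OF linear_blk] linear_scale[OF linear_blk]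
       matrix_vector_right_distrib matrix_vector_mult_scaleR)

section \<open>Derivatives of the costs and the two pseudo-gradients\<close>

definition Df :: "'i \<Rightarrow> real^'n \<Rightarrow> real^'b \<Rightarrow> (real^'n) \<times> (real^'b) \<Rightarrow> real"
  where "Df i x s = frechet_derivative (\<lambda>(y, r). f i (blk own i y) r) (at (x, s))"

lemma Df: "((\<lambda>(y, r). f i (blk own i y) r) has_derivative Df i x s) (at (x, s))"
  unfolding Df_def using f_diff frechet_derivative_works by blast

lemma linear_Df: "linear (Df i x s)"
  using Df has_derivative_linear by blast

lemma Df_fst: "((\<lambda>y. f i (blk own i y) s) has_derivative (\<lambda>v. Df i x s (v, 0))) (at x)"
proof -
  have "((\<lambda>y. (y, s)) has_derivative (\<lambda>v. (v, 0))) (at x)" by (auto intro!: derivative_eq_intros)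
  from diff_chain_at[OF this Df] show ?thesis by (simp add: o_def)
qed

lemma Df_snd: "((\<lambda>r. f i (blk own i x) r) has_derivative (\<lambda>v. Df i x s (0, v))) (at s)"
proof -
  have "((\<lambda>r. (x, r)) has_derivative (\<lambda>v. (0, v))) (at s)" by (auto intro!: derivative_eq_intros)
  from diff_chain_at[OF this Df] show ?thesis by (simp add: o_def)
qed

lemma cost_deriv: "(cost own M d f i has_derivative (\<lambda>v. Df i x (\<psi> x) (v, (1 / real CARD('i)) *\<^sub>R (M *v v)))) (at x)"
proof -
  have "((\<lambda>y. (y, \<psi> y)) has_derivative (\<lambda>v. (v, (1 / real CARD('i)) *\<^sub>R (M *v v)))) (at x)"
    by (intro has_derivative_Pair has_derivative_ident \<psi>_deriv)
  from diff_chain_at[OF this Df] show ?thesis by (simp add: o_def cost_def[abs_def])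
qed

lemma cost_deviate_deriv:
  "((\<lambda>y. cost own M d f i (deviate own i y x)) has_derivative
     (\<lambda>v. Df i x (\<psi> x) (blk own i v, (1 / real CARD('i)) *\<^sub>R (M *v blk own i v)))) (at x)"
proof -
  have "((\<lambda>y. x + blk own i (y - x)) has_derivative (\<lambda>v. blk own i v)) (at x)"
  proof -
    have "((\<lambda>y. blk own i (y - x)) has_derivative (\<lambda>v. blk own i (v - 0))) (at x)"
      by (intro bounded_linear.has_derivative[OF linear_conv_bounded_linear[THEN iffD1, OF linear_blk]]
          has_derivative_diff has_derivative_ident has_derivative_const)
    from has_derivative_add[OF has_derivative_const[of x] this] show ?thesis by simp
  qed
  then have "((\<lambda>y. deviate own i y x) has_derivative (\<lambda>v. blk own i v)) (at x)" by (simp add: deviate_eq)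
  from diff_chain_at[OF this, of "cost own M d f i"] cost_deriv[of i x]
  show ?thesis by (simp add: o_def deviate_self)
qed

lemma F_inner: "F x \<bullet> v = (\<Sum>i\<in>UNIV. Df i x (\<psi> x) (blk own i v, (1 / real CARD('i)) *\<^sub>R (M *v blk own i v)))"
proof -
  have "F x \<bullet> v = (\<Sum>i\<in>UNIV. grad (\<lambda>y. cost own M d f i (deviate own i y x)) x \<bullet> blk own i v)"
    unfolding pseudo_grad_def by (rule sum_own_inner)
  then show ?thesis by (simp add: grad_inner[OF cost_deviate_deriv] blk_blk)
qed

lemma Ft_inner: "Ft x \<sigma> \<bullet> v = (\<Sum>i\<in>UNIV. Df i x (\<sigma> $ i) (blk own i v, (1 / real CARD('i)) *\<^sub>R (M *v blk own i v)))"
proof -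
  have "Ft x \<sigma> \<bullet> v = (\<Sum>i\<in>UNIV. (grad (\<lambda>y. f i (blk own i y) (\<sigma> $ i)) x
               + (1 / real CARD('i)) *\<^sub>R (transpose M *v grad (\<lambda>s. f i (blk own i x) s) (\<sigma> $ i))) \<bullet> blk own i v)"
    unfolding ext_pseudo_grad_def Let_def by (rule sum_own_inner)
  also have "\<dots> = (\<Sum>i\<in>UNIV. Df i x (\<sigma> $ i) (blk own i v, 0) + (1 / real CARD('i)) * Df i x (\<sigma> $ i) (0, M *v blk own i v))"
  proof (intro sum.cong refl)
    fix i
    have "(transpose M *v grad (\<lambda>s. f i (blk own i x) s) (\<sigma> $ i)) \<bullet> blk own i v
        = grad (\<lambda>s. f i (blk own i x) s) (\<sigma> $ i) \<bullet> (M *v blk own i v)"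
      by (metis dot_lmul_matrix inner_commute transpose_matrix_vector)
    also have "\<dots> = Df i x (\<sigma> $ i) (0, M *v blk own i v)" by (rule grad_inner[OF Df_snd])
    finally show "(grad (\<lambda>y. f i (blk own i y) (\<sigma> $ i)) x
               + (1 / real CARD('i)) *\<^sub>R (transpose M *v grad (\<lambda>s. f i (blk own i x) s) (\<sigma> $ i))) \<bullet> blk own i v
        = Df i x (\<sigma> $ i) (blk own i v, 0) + (1 / real CARD('i)) * Df i x (\<sigma> $ i) (0, M *v blk own i v)"
      by (simp add: inner_add_left grad_inner[OF Df_fst])
  qed
  also have "\<dots> = (\<Sum>i\<in>UNIV. Df i x (\<sigma> $ i) (blk own i v, (1 / real CARD('i)) *\<^sub>R (M *v blk own i v)))"
  proof (intro sum.cong refl)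
    fix i
    have "(blk own i v, (1 / real CARD('i)) *\<^sub>R (M *v blk own i v)) = (blk own i v, 0) + (1 / real CARD('i)) *\<^sub>R (0, M *v blk own i v)"
      by simp
    then show "Df i x (\<sigma> $ i) (blk own i v, 0) + (1 / real CARD('i)) * Df i x (\<sigma> $ i) (0, M *v blk own i v)
       = Df i x (\<sigma> $ i) (blk own i v, (1 / real CARD('i)) *\<^sub>R (M *v blk own i v))"
      by (simp only: linear_add[OF linear_Df] linear_scale[OF linear_Df]) simp
  qed
  finally show ?thesis .
qed

text \<open>The factor B_i^T/N in the convention for the extended gradient is the chain rule for
  \<psi>; so both gradients evaluate the same \<open>Df\<close> in the same direction once every
  estimate equals \<psi>(x).\<close>

lemma F_eq_Ft: "F x = Ft x (\<chi> i. \<psi> x)"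
proof -
  have "F x \<bullet> v = Ft x (\<chi> i. \<psi> x) \<bullet> v" for v unfolding F_inner Ft_inner by simp
  then show ?thesis by (metis vector_eq_rdot inner_commute)
qed

lemma Ft_lip: "norm (Ft x \<sigma> - Ft x' \<sigma>') \<le> \<theta> * norm ((x, \<sigma>) - (x', \<sigma>'))"
  using lipschitz_onD[OF Ft_lipschitz, of "(x, \<sigma>)" "(x', \<sigma>')"] by (simp add: dist_norm)

text \<open>\<open>F\<close> is the extended pseudo-gradient along an affine map of
  \<open>x\<close>; \<open>T\<close> is the linear part of that map.\<close>

lemma F_lipschitz: "\<exists>C. C-lipschitz_on UNIV F"
proof -
  define T where "T v = (v, \<chi> i::'i. (1 / real CARD('i)) *\<^sub>R (M *v v))" for v
  have "linear T" unfolding T_def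
    by (intro linearI) (auto simp: vec_eq_iff matrix_vector_right_distrib matrix_vector_mult_scaleR scaleR_add_right algebra_simps add_divide_distrib)
  then obtain C where C: "C > 0" "\<And>v. norm (T v) \<le> C * norm v" using linear_bounded_pos by blast
  have \<theta>: "\<theta> \<ge> 0" using Ft_lipschitz lipschitz_on_nonneg by blast
  have "(\<theta> * C)-lipschitz_on UNIV F"
  proof (rule lipschitz_onI)
    fix x y
    have "(x, \<chi> i. \<psi> x) - (y, \<chi> i. \<psi> y) = T (x - y)"
      by (simp add: T_def \<psi>_eq vec_eq_iff matrix_vector_mult_diff_distrib algebra_simps diff_divide_distrib)
    then have "dist (F x) (F y) \<le> \<theta> * norm (T (x - y))"
      using Ft_lip[of x "\<chi> i. \<psi> x" y "\<chi> i. \<psi> y"] by (simp add: F_eq_Ft dist_norm)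
    also have "\<dots> \<le> \<theta> * (C * norm (x - y))" using C \<theta> by (intro mult_left_mono) auto
    finally show "dist (F x) (F y) \<le> \<theta> * C * dist x y" by (simp add: dist_norm)
  qed (use \<theta> C in auto)
  then show ?thesis by blast
qed

section \<open>Geometry of the feasible set\<close>

lemma X_closed: "closed X"
proof -
  have "X = (\<Inter>i. blk own i -` \<Omega> i)" by (auto simp: joint_def)
  moreover have "closed (blk own i -` \<Omega> i)" for i
    by (intro continuous_closed_vimage \<Omega>_closed linear_continuous_at linear_conv_bounded_linear[THEN iffD1] linear_blk)
  ultimately show ?thesis by auto
qed

lemma X_convex: "convex X"
proof -
  have "X = (\<Inter>i. blk own i -` \<Omega> i)" by (auto simp: joint_def)
  moreover have "convex (blk own i -` \<Omega> i)" for i by (intro convex_linear_vimage linear_blk \<Omega>_convex)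
  ultimately show ?thesis by (simp add: convex_INT)
qed

lemma X_nonempty: "X \<noteq> {}"
  using slater by blast

lemma G_convex: "convex_on UNIV (\<lambda>x. G x $ j)"
proof -
  have "convex_on UNIV (\<lambda>x. \<Sum>i\<in>I. g i (blk own i x) $ j)" if "finite I" for I
    using that
    by induction (auto intro!: convex_on_add convex_on_range_linear[OF g_convex linear_blk] simp: convex_on_const)
  from this[of UNIV] show ?thesis by (simp add: coupling_def)
qed

lemma feasible_iff: "x \<in> feasible own \<Omega> g \<longleftrightarrow> x \<in> X \<and> (\<forall>j. G x $ j \<le> 0)"
  by (simp add: feasible_def less_eq_vec_def)

lemma feasible_closed: "closed (feasible own \<Omega> g)"
proof -
  have c: "continuous_on UNIV G" using G_deriv by (meson continuous_at_imp_continuous_on has_derivative_continuous)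
  have "feasible own \<Omega> g = X \<inter> (\<Inter>j. {x. G x $ j \<le> 0})" by (auto simp: feasible_iff)
  moreover have "closed {x. G x $ j \<le> 0}" for j by (intro closed_Collect_le continuous_intros c)
  ultimately show ?thesis using X_closed by (simp add: closed_Int closed_INT)
qed

lemma feasible_convex: "convex (feasible own \<Omega> g)"
proof -
  have "feasible own \<Omega> g = X \<inter> (\<Inter>j. {x. G x $ j \<le> 0})" by (auto simp: feasible_iff)
  moreover have "convex {x. G x $ j \<le> 0}" for j
  proof (rule convexI)
    fix x y and u v :: real assume "x \<in> {x. G x $ j \<le> 0}" "y \<in> {x. G x $ j \<le> 0}" and uv: "0 \<le> u" "0 \<le> v" "u + v = 1"
    then have xy: "u * G x $ j \<le> 0" "v * G y $ j \<le> 0" by (auto intro: mult_nonneg_nonpos)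
    have u: "u = 1 - v" using uv by simp
    have "G (u *\<^sub>R x + v *\<^sub>R y) $ j \<le> u * G x $ j + v * G y $ j"
      using convex_onD[OF G_convex, of v x y j] uv unfolding u by simp
    with xy show "u *\<^sub>R x + v *\<^sub>R y \<in> {x. G x $ j \<le> 0}" by simp
  qed
  ultimately show ?thesis using X_convex by (auto intro!: convex_Int convex_INT)
qed

section \<open>KKT pairs, variational inequalities and equilibria\<close>

lemma KKT_iff:
  "KKT own \<Omega> g M d f x l \<longleftrightarrow> x \<in> X \<and> 0 \<le> l \<and> - (F x + JT x (\<chi> i. l)) \<in> normal_cone X x
     \<and> (\<forall>j. G x $ j \<le> 0) \<and> l \<bullet> G x = 0"
proof -
  have 1: "0 \<in> (\<lambda>v. a + v) ` N \<longleftrightarrow> - a \<in> N" for a :: "'z::real_vector" and N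
    by (auto simp: image_iff eq_neg_iff_add_eq_0 add.commute intro: bexI[of _ "-a"]) (metis add.commute eq_neg_iff_add_eq_0)
  show ?thesis
    unfolding KKT_def JT_consensus using 1[of "F x + JT x (\<chi> i. l)"] 1[of "- G x"] normal_cone_nonneg_iff[of l "G x"] by auto
qed

text \<open>The multiplier makes \<open>x\<close> a minimiser over \<open>X\<close> of the
  Lagrangian with linearised objective \<open>F x \<bullet> (y - x)\<close>. Its first-order
  condition, taken along segments inside \<open>X\<close>, is the normal-cone inclusion.\<close>

lemma KKT_exists: "\<exists>x l. KKT own \<Omega> g M d f x l"
proof -
  obtain y0 where y0: "y0 \<in> X" "\<And>j. G y0 $ j < 0" using slater by blast
  then have ne: "feasible own \<Omega> g \<noteq> {}" using feasible_iff less_imp_le by blast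
  obtain C where C: "C-lipschitz_on UNIV F" using F_lipschitz by blast
  obtain x where x: "x \<in> feasible own \<Omega> g" "\<And>y. y \<in> feasible own \<Omega> g \<Longrightarrow> F x \<bullet> (y - x) \<ge> 0"
    using variational_inequality_exists[OF feasible_closed feasible_convex ne C \<mu>_pos F_strongly_monotone] by blast
  have conv: "convex_on X (\<lambda>x. G x $ j)" for j
    using convex_on_subset[OF G_convex[of j] subset_UNIV X_convex] by simp
  obtain l where l: "\<And>j. 0 \<le> l $ j" "l \<bullet> G x = 0" "\<And>y. y \<in> X \<Longrightarrow> 0 \<le> F x \<bullet> (y - x) + l \<bullet> G y"
  proof (rule slater_multiplier[OF X_convex conv _ _ y0, of x "F x"])
    show "x \<in> X" "\<And>j. G x $ j \<le> 0" using x(1) by (auto simp: feasible_iff)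
    show "\<And>y. y \<in> X \<Longrightarrow> (\<And>j. G y $ j \<le> 0) \<Longrightarrow> 0 \<le> F x \<bullet> (y - x)" using x(2) by (simp add: feasible_iff)
  qed (use that in blast)
  have xX: "x \<in> X" using x(1) by (simp add: feasible_iff)
  have "- (F x + JT x (\<chi> i. l)) \<bullet> (y - x) \<le> 0" if y: "y \<in> X" for y
  proof -
    define h where "h = y - x"
    have "((\<lambda>s::real. x + s *\<^sub>R h) has_derivative (\<lambda>s. s *\<^sub>R h)) (at 0)" by (auto intro!: derivative_eq_intros)
    from diff_chain_at[OF this, of G "\<lambda>v. \<Sum>i\<in>UNIV. Dg i x v"] G_deriv[of x]
    have "((\<lambda>s. G (x + s *\<^sub>R h)) has_derivative (\<lambda>s. \<Sum>i\<in>UNIV. Dg i x (s *\<^sub>R h))) (at 0)"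
      by (simp add: o_def)
    then have "((\<lambda>s. F x \<bullet> (s *\<^sub>R h) + l \<bullet> G (x + s *\<^sub>R h)) has_derivative
        (\<lambda>s. F x \<bullet> (s *\<^sub>R h) + l \<bullet> (\<Sum>i\<in>UNIV. Dg i x (s *\<^sub>R h)))) (at 0)"
      by (intro has_derivative_add has_derivative_inner_right has_derivative_scaleR_left has_derivative_ident)
    moreover have "F x \<bullet> (s *\<^sub>R h) + l \<bullet> (\<Sum>i\<in>UNIV. Dg i x (s *\<^sub>R h)) = ((F x + JT x (\<chi> i. l)) \<bullet> h) * s" for s
    proof -
      have "(F x + JT x (\<chi> i. l)) \<bullet> h = F x \<bullet> h + l \<bullet> (\<Sum>i\<in>UNIV. Dg i x h)"
        using JT_inner[of x "\<chi> i. l" h] by (simp add: inner_add_left inner_add_right inner_sum_right inner_commute)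
      then show ?thesis by (simp add: blinfun.scaleR_right scaleR_sum_right[symmetric] algebra_simps)
    qed
    ultimately have "((\<lambda>s. F x \<bullet> (s *\<^sub>R h) + l \<bullet> G (x + s *\<^sub>R h)) has_real_derivative (F x + JT x (\<chi> i. l)) \<bullet> h) (at 0)"
      by (simp add: has_field_derivative_def)
    \<comment> \<open>Complementary slackness makes the Lagrangian vanish at \<open>s = 0\<close>,
      so the difference quotient has no subtracted term.\<close>
    then have "((\<lambda>s. (F x \<bullet> (s *\<^sub>R h) + l \<bullet> G (x + s *\<^sub>R h)) / s) \<longlongrightarrow> (F x + JT x (\<chi> i. l)) \<bullet> h) (at_right 0)"
      using l(2) by (auto simp: has_field_derivative_iff intro: Lim_at_imp_Lim_at_within)
    then have "(F x + JT x (\<chi> i. l)) \<bullet> h \<ge> 0"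
    proof (rule tendsto_lowerbound)
      have "eventually (\<lambda>s::real. s \<in> {0<..<1}) (at_right 0)" by (rule eventually_at_right_real) simp
      then show "\<forall>\<^sub>F s in at_right 0. 0 \<le> (F x \<bullet> (s *\<^sub>R h) + l \<bullet> G (x + s *\<^sub>R h)) / s"
      proof eventually_elim
        case (elim s)
        have "x + s *\<^sub>R h = (1 - s) *\<^sub>R x + s *\<^sub>R y" by (simp add: h_def algebra_simps)
        also have "\<dots> \<in> X" using elim by (intro convexD_alt[OF X_convex xX y]) auto
        finally have "0 \<le> F x \<bullet> (s *\<^sub>R h) + l \<bullet> G (x + s *\<^sub>R h)" using l(3)[of "x + s *\<^sub>R h"] by simp
        then show ?case using elim by simp
      qed
    qed simp
    then show ?thesis by (simp add: h_def inner_add_left inner_diff_left)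
  qed
  then have "KKT own \<Omega> g M d f x l"
    using xX x(1) l(1,2) by (auto simp: KKT_iff feasible_iff normal_cone_def less_eq_vec_def)
  then show ?thesis by blast
qed

text \<open>Eliminates the multiplier: convexity bounds its gradient term by
  \<open>l \<bullet> G y - l \<bullet> G x\<close>, which is nonpositive by feasibility of
  \<open>y\<close> and complementarity.\<close>

lemma KKT_imp_VI:
  assumes "KKT own \<Omega> g M d f x l" "y \<in> feasible own \<Omega> g"
  shows "x \<in> feasible own \<Omega> g" "0 \<le> F x \<bullet> (y - x)"
proof -
  note k = assms(1)[unfolded KKT_iff]
  show "x \<in> feasible own \<Omega> g" using k by (simp add: feasible_iff)
  have yf: "y \<in> X" "\<And>j. G y $ j \<le> 0" using assms(2) by (auto simp: feasible_iff)
  have "- (F x + JT x (\<chi> i. l)) \<bullet> (y - x) \<le> 0" using k yf by (auto simp: normal_cone_def)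
  moreover have "JT x (\<chi> i. l) \<bullet> (y - x) \<le> (\<chi> i. l) \<bullet> (Gs y - Gs x)"
    using k by (intro Gs_convex) (simp add: less_eq_vec_def)
  moreover have "(\<chi> i. l) \<bullet> (Gs y - Gs x) = l \<bullet> G y - l \<bullet> G x"
    by (simp add: inner_vec_def[of "\<chi> i. l"] G_eq_sum inner_sum_right inner_diff_right sum_subtractf)
  moreover have "l \<bullet> G y \<le> 0"
    unfolding inner_vec_def using k yf by (intro sum_nonpos) (simp add: less_eq_vec_def mult_nonneg_nonpos)
  ultimately show "0 \<le> F x \<bullet> (y - x)" using k by (simp add: inner_add_left inner_diff_left)
qed

text \<open>A unilateral deviation that keeps the point feasible is a test point of the variational
  inequality. Its direction lives in the block of agent \<open>i\<close>, so only that agent's own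
  gradient is seen, and convexity of its cost turns the first-order condition into
  optimality.\<close>

lemma KKT_imp_vGNE:
  assumes K: "KKT own \<Omega> g M d f x l"
  shows "is_vGNE own \<Omega> g M d f x"
proof -
  have xf: "x \<in> feasible own \<Omega> g" using K by (simp add: KKT_iff feasible_iff)
  have "cost own M d f i x \<le> cost own M d f i (deviate own i y x)" if y: "deviate own i y x \<in> feasible own \<Omega> g" for i y
  proof -
    let ?\<phi> = "\<lambda>y. cost own M d f i (deviate own i y x)"
    have eq: "deviate own i (blk own i y) x = deviate own i y x" for y by (simp add: deviate_def blk_def vec_eq_iff)
    have "convex_on UNIV (\<lambda>y. ?\<phi> (blk own i y))" by (rule convex_on_range_linear[OF J_convex linear_blk])
    then have "convex_on UNIV ?\<phi>" by (simp add: eq)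
    from convex_on_UNIV_above_tangent[OF this cost_deviate_deriv, of y]
    have "Df i x (\<psi> x) (blk own i (y - x), (1 / real CARD('i)) *\<^sub>R (M *v blk own i (y - x)))
        \<le> cost own M d f i (deviate own i y x) - cost own M d f i x" by (simp add: deviate_self)
    moreover have "F x \<bullet> blk own i (y - x)
        = (\<Sum>j\<in>UNIV. if j = i then Df i x (\<psi> x) (blk own i (y - x), (1 / real CARD('i)) *\<^sub>R (M *v blk own i (y - x))) else 0)"
      unfolding F_inner by (intro sum.cong) (auto simp: blk_blk linear_0[OF linear_Df] zero_prod_def[symmetric])
    moreover have "0 \<le> F x \<bullet> (deviate own i y x - x)" using KKT_imp_VI(2)[OF K y] .
    ultimately show ?thesis by (simp add: deviate_eq)
  qed
  then show ?thesis using K xf by (auto simp: is_vGNE_def is_GNE_def is_arg_min_def deviate_self not_less)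
qed

lemma KKT_unique:
  assumes "KKT own \<Omega> g M d f x l" "KKT own \<Omega> g M d f y l'"
  shows "y = x"
proof -
  have f: "x \<in> feasible own \<Omega> g" "y \<in> feasible own \<Omega> g" using assms by (auto simp: KKT_iff feasible_iff)
  have "0 \<le> F x \<bullet> (y - x)" "0 \<le> F y \<bullet> (x - y)" using KKT_imp_VI(2)[OF assms(1) f(2)] KKT_imp_VI(2)[OF assms(2) f(1)] .
  then have "(F x - F y) \<bullet> (x - y) \<le> 0" by (simp add: inner_diff_left inner_diff_right)
  then have "\<mu> * (norm (x - y))\<^sup>2 \<le> 0" using F_strongly_monotone[of x y] by linarith
  then show ?thesis using \<mu>_pos by (simp add: mult_le_0_iff)
qed

end

section \<open>Projected dynamical systems\<close>

text \<open>
  For a curve that stays in \<open>K\<close>, the condition on the normal cone says that the velocity is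
  \<open>proj_vf K (u t) (\<Phi> (u t))\<close>; see \<open>proj_vf_of_curve\<close>. Unlike the tangent cone, the normal cone of a
  product splits into its factors for trivial reasons.
\<close>

definition proj_solution :: "'a::euclidean_space set \<Rightarrow> ('a \<Rightarrow> 'a) \<Rightarrow> (real \<Rightarrow> 'a) \<Rightarrow> bool"
  where "proj_solution K \<Phi> u \<longleftrightarrow>
           (\<forall>t\<ge>0. u t \<in> K) \<and> (\<forall>T\<ge>0. abs_cont_on {0..T} u) \<and>
           (AE t in lebesgue. 0 < t \<longrightarrow>
              (\<exists>w. (u has_vector_derivative w) (at t) \<and> \<Phi> (u t) - w \<in> normal_cone K (u t)))"

lemma proj_solutionD:
  assumes "proj_solution K \<Phi> u"
  shows "0 \<le> t \<Longrightarrow> u t \<in> K" "0 \<le> T \<Longrightarrow> abs_cont_on {0..T} u"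
    "AE t in lebesgue. 0 < t \<longrightarrow> (\<exists>w. (u has_vector_derivative w) (at t) \<and> \<Phi> (u t) - w \<in> normal_cone K (u t))"
  using assms by (auto simp: proj_solution_def)

lemma AE_pos_imp_nonneg:
  assumes "AE t in lebesgue. (0::real) < t \<longrightarrow> P t"
  shows "AE t in lebesgue. 0 \<le> t \<longrightarrow> P t"
proof -
  have "AE t in lebesgue. t \<noteq> (0::real)"
    by (rule AE_I'[of "{0}"]) (auto simp: negligible_iff_null_sets[symmetric])
  with assms show ?thesis by eventually_elim auto
qed

text \<open>A decay rate becomes plain monotonicity after adding the linear term
  \<open>2 * \<eta> * t\<close>; the factor 2 comes from differentiating a form with symmetric
  \<open>Q\<close>.\<close>

lemma quadratic_nonincreasing:
  fixes u :: "real \<Rightarrow> 'a::euclidean_space"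
  assumes ac: "\<And>T. T \<ge> 0 \<Longrightarrow> abs_cont_on {0..T} u" and Q: "linear Q" "\<And>x y. Q x \<bullet> y = x \<bullet> Q y"
    and s: "0 \<le> s" "s \<le> r"
    and der: "AE t in lebesgue. 0 < t \<longrightarrow> s \<le> t \<longrightarrow> t \<le> r \<longrightarrow> (\<exists>w. (u has_vector_derivative w) (at t) \<and> w \<bullet> Q (u t - a) \<le> - \<eta>)"
  shows "(u r - a) \<bullet> Q (u r - a) + 2 * \<eta> * (r - s) \<le> (u s - a) \<bullet> Q (u s - a)"
proof -
  have blQ: "bounded_linear Q" using Q(1) linear_conv_bounded_linear by blast
  define \<phi> where "\<phi> t = (u t - a) \<bullet> Q (u t - a) + (2 * \<eta>) * t" for t
  have "abs_cont_on {s..r} u"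
    using abs_cont_on_subset[OF ac[of r]] s by auto
  then have 1: "abs_cont_on {s..r} (\<lambda>t. u t - a)" by (intro abs_cont_on_diff abs_cont_on_const)
  have "abs_cont_on {s..r} \<phi>" unfolding \<phi>_def
    by (intro abs_cont_on_add abs_cont_on_inner 1 abs_cont_on_linear[OF 1 blQ]
        abs_cont_on_linear[OF abs_cont_on_id bounded_linear_mult_right])
  moreover have "AE t in lebesgue. s \<le> t \<and> t \<le> r \<longrightarrow> (\<exists>D\<le>0. (\<phi> has_real_derivative D) (at t))"
    using AE_pos_imp_nonneg[OF der]
  proof eventually_elim
    case (elim t)
    show ?case
    proof
      assume t: "s \<le> t \<and> t \<le> r"
      with elim s obtain w where w: "(u has_vector_derivative w) (at t)" "w \<bullet> Q (u t - a) \<le> - \<eta>" by auto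
      have d1: "((\<lambda>t. u t - a) has_vector_derivative (w - 0)) (at t)"
        by (intro has_vector_derivative_diff w has_vector_derivative_const)
      have "((\<lambda>t. (u t - a) \<bullet> Q (u t - a)) has_vector_derivative ((u t - a) \<bullet> Q (w - 0) + (w - 0) \<bullet> Q (u t - a))) (at t)"
        by (intro bounded_bilinear.has_vector_derivative[OF bounded_bilinear_inner] d1 bounded_linear.has_vector_derivative[OF blQ])
      then have "((\<lambda>t. (u t - a) \<bullet> Q (u t - a)) has_real_derivative 2 * (w \<bullet> Q (u t - a))) (at t)"
        using Q(2)[of "u t - a" w] by (simp add: has_real_derivative_iff_has_vector_derivative inner_commute)
      then have "(\<phi> has_real_derivative 2 * (w \<bullet> Q (u t - a)) + 2 * \<eta>) (at t)"
        unfolding \<phi>_def by (auto intro!: derivative_eq_intros)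
      moreover have "2 * (w \<bullet> Q (u t - a)) + 2 * \<eta> \<le> 0" using w by simp
      ultimately show "\<exists>D\<le>0. (\<phi> has_real_derivative D) (at t)" by blast
    qed
  qed
  ultimately have "\<phi> r \<le> \<phi> s" by (rule abs_cont_on_nonincreasing[OF _ s(2)])
  then show ?thesis by (simp add: \<phi>_def algebra_simps)
qed

text \<open>Gronwall's argument with the weight exp(-2 \<kappa> t). Each curve is a test point for
  the normal cone of the other, so the projection terms have a favourable sign and only the
  one-sided Lipschitz bound of \<Phi> remains. Uniqueness and continuous dependence both follow from
  it.\<close>

lemma proj_solution_distance:
  fixes \<Phi> :: "'a::euclidean_space \<Rightarrow> 'a"
  assumes lip: "\<And>x y. x \<in> K \<Longrightarrow> y \<in> K \<Longrightarrow> (\<Phi> x - \<Phi> y) \<bullet> (x - y) \<le> \<kappa> * (norm (x - y))\<^sup>2"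
    and u: "proj_solution K \<Phi> u" and v: "proj_solution K \<Phi> v" and t: "0 \<le> t"
  shows "norm (u t - v t) \<le> exp (\<kappa> * t) * norm (u 0 - v 0)"
proof -
  define \<phi> where "\<phi> t = exp (- 2 * \<kappa> * t) *\<^sub>R ((u t - v t) \<bullet> (u t - v t))" for t
  have ac: "abs_cont_on {0..t} (\<lambda>t. u t - v t)"
    using u v t by (intro abs_cont_on_diff) (auto simp: proj_solution_def)
  have "\<exists>C. C-lipschitz_on {0..t} (\<lambda>t. exp (- 2 * \<kappa> * t))"
  proof -
    \<comment> \<open>Bound for the derivative of the weight on \<open>{0..t}\<close>; absolute
      values appear because \<kappa> has no prescribed sign.\<close>
    define C where "C = 2 * \<bar>\<kappa>\<bar> * exp (2 * \<bar>\<kappa>\<bar> * t)"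
    have "norm (exp (- 2 * \<kappa> * x) - exp (- 2 * \<kappa> * y)) \<le> C * norm (x - y)" if "x \<in> {0..t}" "y \<in> {0..t}" for x y
    proof (rule field_differentiable_bound[of "{0..t}" _ "\<lambda>s. exp (- 2 * \<kappa> * s) * (- 2 * \<kappa>)"])
      fix s assume s: "s \<in> {0..t}"
      show "((\<lambda>s. exp (- 2 * \<kappa> * s)) has_field_derivative exp (- 2 * \<kappa> * s) * (- 2 * \<kappa>)) (at s within {0..t})"
        by (auto intro!: derivative_eq_intros)
      have "- \<kappa> * s \<le> \<bar>\<kappa>\<bar> * s" using s by (intro mult_right_mono) auto
      also have "\<dots> \<le> \<bar>\<kappa>\<bar> * t" using s by (intro mult_left_mono) auto
      finally have "- 2 * \<kappa> * s \<le> 2 * \<bar>\<kappa>\<bar> * t" by linarith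
      then have "exp (- 2 * \<kappa> * s) \<le> exp (2 * \<bar>\<kappa>\<bar> * t)" by (simp only: exp_le_cancel_iff)
      then have "exp (- 2 * \<kappa> * s) * (2 * \<bar>\<kappa>\<bar>) \<le> exp (2 * \<bar>\<kappa>\<bar> * t) * (2 * \<bar>\<kappa>\<bar>)" by (intro mult_right_mono) auto
      then show "norm (exp (- 2 * \<kappa> * s) * (- 2 * \<kappa>)) \<le> C" by (simp add: C_def abs_mult mult.commute)
    qed (use that in auto)
    moreover have "C \<ge> 0" by (simp add: C_def)
    ultimately show ?thesis by (intro exI[of _ C] lipschitz_onI) (auto simp: dist_norm)
  qed
  then obtain C where "C-lipschitz_on {0..t} (\<lambda>t. exp (- 2 * \<kappa> * t))" by blast
  from lipschitz_imp_abs_cont_on[OF this]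
  have "abs_cont_on {0..t} (\<lambda>t. exp (- 2 * \<kappa> * t) \<bullet> ((u t - v t) \<bullet> (u t - v t)))"
    by (intro abs_cont_on_inner ac)
  then have "abs_cont_on {0..t} \<phi>" by (simp add: \<phi>_def[abs_def] inner_real_def)
  moreover have "AE s in lebesgue. 0 \<le> s \<and> s \<le> t \<longrightarrow> (\<exists>D\<le>0. (\<phi> has_real_derivative D) (at s))"
    using AE_pos_imp_nonneg[OF proj_solutionD(3)[OF u]] AE_pos_imp_nonneg[OF proj_solutionD(3)[OF v]]
  proof eventually_elim
    case (elim s)
    show ?case
    proof
      assume s: "0 \<le> s \<and> s \<le> t"
      then have K: "u s \<in> K" "v s \<in> K" using u v by (auto simp: proj_solution_def)
      obtain w where w: "(u has_vector_derivative w) (at s)" "\<Phi> (u s) - w \<in> normal_cone K (u s)" using elim s by blast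
      obtain w' where w': "(v has_vector_derivative w') (at s)" "\<Phi> (v s) - w' \<in> normal_cone K (v s)" using elim s by blast
      have d1: "((\<lambda>t. u t - v t) has_vector_derivative (w - w')) (at s)"
        by (intro has_vector_derivative_diff w w')
      have "((\<lambda>t. (u t - v t) \<bullet> (u t - v t)) has_vector_derivative ((u s - v s) \<bullet> (w - w') + (w - w') \<bullet> (u s - v s))) (at s)"
        by (intro bounded_bilinear.has_vector_derivative[OF bounded_bilinear_inner] d1)
      then have d2: "((\<lambda>t. (u t - v t) \<bullet> (u t - v t)) has_real_derivative 2 * ((w - w') \<bullet> (u s - v s))) (at s)"
        by (simp add: has_real_derivative_iff_has_vector_derivative inner_commute)
      have d3: "((\<lambda>s. exp (- 2 * \<kappa> * s)) has_real_derivative exp (- 2 * \<kappa> * s) * (- 2 * \<kappa>)) (at s)"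
        by (auto intro!: derivative_eq_intros)
      let ?D = "exp (- 2 * \<kappa> * s) * (2 * ((w - w') \<bullet> (u s - v s)) - 2 * \<kappa> * ((u s - v s) \<bullet> (u s - v s)))"
      have "(\<phi> has_real_derivative ?D) (at s)"
        using DERIV_mult[OF d3 d2] unfolding \<phi>_def by (simp add: algebra_simps)
      moreover have "?D \<le> 0"
      proof -
        have "(\<Phi> (u s) - w) \<bullet> (v s - u s) \<le> 0" "(\<Phi> (v s) - w') \<bullet> (u s - v s) \<le> 0"
          using w(2) w'(2) K by (auto simp: normal_cone_def)
        then have "(w - w') \<bullet> (u s - v s) \<le> (\<Phi> (u s) - \<Phi> (v s)) \<bullet> (u s - v s)"
          by (simp add: algebra_simps)
        also have "\<dots> \<le> \<kappa> * ((u s - v s) \<bullet> (u s - v s))" using lip[OF K] by (simp add: power2_norm_eq_inner)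
        finally show ?thesis by (simp add: mult_le_0_iff)
      qed
      ultimately show "\<exists>D\<le>0. (\<phi> has_real_derivative D) (at s)" by blast
    qed
  qed
  ultimately have "\<phi> t \<le> \<phi> 0" by (rule abs_cont_on_nonincreasing[OF _ t])
  then have "exp (- 2 * \<kappa> * t) * (norm (u t - v t))\<^sup>2 \<le> (norm (u 0 - v 0))\<^sup>2"
    by (simp add: \<phi>_def power2_norm_eq_inner)
  then have "exp (2 * \<kappa> * t) * (exp (- 2 * \<kappa> * t) * (norm (u t - v t))\<^sup>2) \<le> exp (2 * \<kappa> * t) * (norm (u 0 - v 0))\<^sup>2"
    by (rule mult_left_mono) simp
  then have "(norm (u t - v t))\<^sup>2 \<le> exp (2 * \<kappa> * t) * (norm (u 0 - v 0))\<^sup>2"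
    by (simp add: mult.assoc[symmetric] exp_add[symmetric])
  also have "\<dots> = (exp (\<kappa> * t) * norm (u 0 - v 0))\<^sup>2"
    by (simp add: power_mult_distrib power2_eq_square exp_add[symmetric])
  finally show ?thesis by (rule power2_le_imp_le) simp
qed

text \<open>Autonomy of the system, in the form used to restart a trajectory at late times:
  divisions and exceptional null sets are translated along with time.\<close>

lemma proj_solution_shift:
  assumes u: "proj_solution K \<Phi> u" and s: "0 \<le> s"
  shows "proj_solution K \<Phi> (\<lambda>t. u (s + t))"
  unfolding proj_solution_def
proof (intro conjI allI impI)
  fix T :: real assume T: "0 \<le> T"
  show "abs_cont_on {0..T} (\<lambda>t. u (s + t))"
    unfolding abs_cont_on_def
  proof (intro allI impI)
    fix e :: real assume "e > 0"
    moreover have "abs_cont_on {0..s + T} u" using u s T by (simp add: proj_solution_def)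
    ultimately obtain \<delta> where \<delta>: "\<delta> > 0"
      and small: "\<And>D T'. D division_of T' \<Longrightarrow> T' \<subseteq> {0..s + T} \<Longrightarrow> (\<Sum>K\<in>D. Sup K - Inf K) < \<delta>
                    \<Longrightarrow> (\<Sum>K\<in>D. norm (u (Sup K) - u (Inf K))) < e"
      unfolding abs_cont_on_def by meson
    show "\<exists>\<delta>>0. \<forall>D T'. D division_of T' \<and> T' \<subseteq> {0..T} \<and> (\<Sum>K\<in>D. Sup K - Inf K) < \<delta> \<longrightarrow>
          (\<Sum>K\<in>D. norm (u (s + Sup K) - u (s + Inf K))) < e"
    proof (intro exI[of _ \<delta>] conjI allI impI, rule \<delta>)
      fix D T' assume *: "D division_of T' \<and> T' \<subseteq> {0..T} \<and> (\<Sum>K\<in>D. Sup K - Inf K) < \<delta>"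
      let ?D = "(\<lambda>K. (+) s ` K) ` D"
      have inj: "inj_on (\<lambda>K. (+) s ` K) D" by (intro inj_onI) (simp add: inj_image_eq_iff inj_def)
      have div: "?D division_of ((+) s ` T')"
      proof (rule division_ofI)
        note dd = division_ofD[OF *[THEN conjunct1]]
        show "finite ?D" using dd(1) by simp
        show "\<Union>?D = (+) s ` T'" using dd(6) by auto
        fix L assume "L \<in> ?D"
        then obtain K1 where K1: "K1 \<in> D" "L = (+) s ` K1" by blast
        show "L \<subseteq> (+) s ` T'" "L \<noteq> {}" using dd(2,3)[OF K1(1)] K1(2) by auto
        show "\<exists>a b. L = cbox a b" using dd(4)[OF K1(1)] K1(2) by (metis cbox_translation)
        fix L' assume "L' \<in> ?D" and neq: "L \<noteq> L'"
        then obtain K2 where K2: "K2 \<in> D" "L' = (+) s ` K2" by blast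
        have "K1 \<noteq> K2" using neq K1 K2 by blast
        then have "interior K1 \<inter> interior K2 = {}" using dd(5)[OF K1(1) K2(1)] by blast
        then show "interior L \<inter> interior L' = {}" unfolding K1 K2 interior_translation by auto
      qed
      have KI: "Sup ((+) s ` K) = s + Sup K \<and> Inf ((+) s ` K) = s + Inf K" if KD: "K \<in> D" for K
      proof -
        obtain a b where "K = cbox a b" "K \<noteq> {}" using division_ofD(3,4)[OF *[THEN conjunct1] KD] by blast
        then show ?thesis by auto
      qed
      have "(\<Sum>K\<in>?D. Sup K - Inf K) = (\<Sum>K\<in>D. Sup K - Inf K)"
        by (subst sum.reindex[OF inj]) (auto intro!: sum.cong simp: KI)
      moreover have "(\<Sum>K\<in>?D. norm (u (Sup K) - u (Inf K))) = (\<Sum>K\<in>D. norm (u (s + Sup K) - u (s + Inf K)))"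
        by (subst sum.reindex[OF inj]) (auto intro!: sum.cong simp: KI)
      moreover have "(+) s ` T' \<subseteq> {0..s + T}" using * s by force
      ultimately show "(\<Sum>K\<in>D. norm (u (s + Sup K) - u (s + Inf K))) < e"
        using small[OF div] * by simp
    qed
  qed
next
  from proj_solutionD(3)[OF u] obtain N where N: "N \<in> null_sets lebesgue"
    "\<And>t. t \<notin> N \<Longrightarrow> 0 < t \<Longrightarrow> \<exists>w. (u has_vector_derivative w) (at t) \<and> \<Phi> (u t) - w \<in> normal_cone K (u t)"
    by (rule AE_E3) auto
  have "negligible ((+) (- s) ` N)"
    using N(1) by (intro negligible_translation) (simp add: negligible_iff_null_sets)
  moreover have "\<exists>w. ((\<lambda>t. u (s + t)) has_vector_derivative w) (at t) \<and> \<Phi> (u (s + t)) - w \<in> normal_cone K (u (s + t))"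
    if t: "t \<notin> (+) (- s) ` N" "0 < t" for t
  proof -
    have "s + t \<notin> N" using t(1) by force
    then obtain w where w: "(u has_vector_derivative w) (at (s + t))" "\<Phi> (u (s + t)) - w \<in> normal_cone K (u (s + t))"
      using N(2)[of "s + t"] t s by auto
    have "((+) s has_vector_derivative 1) (at t)" by (auto intro!: derivative_eq_intros)
    from vector_diff_chain_at[OF this w(1)] have "((\<lambda>t. u (s + t)) has_vector_derivative w) (at t)" by (simp add: o_def)
    with w(2) show ?thesis by blast
  qed
  ultimately show "AE t in lebesgue. 0 < t \<longrightarrow> (\<exists>w. ((\<lambda>t. u (s + t)) has_vector_derivative w) (at t) \<and> \<Phi> (u (s + t)) - w \<in> normal_cone K (u (s + t)))"
    by (intro AE_I'[of "(+) (- s) ` N"]) (auto simp: negligible_iff_null_sets)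
qed (use u s in \<open>simp add: proj_solution_def\<close>)

text \<open>The abstract setting of the convergence proof. \<open>decay\<close> allows a factor
  \<rho> because the existence proof runs with a rescaled field, and it concerns every
  \<open>w\<close> whose residual is normal, since velocities are known only through that inclusion.
  \<open>zero_dissipation\<close> asks only for convergence of the curve, not for an identification
  of the invariant set. \<open>Q\<close> is coercive merely on differences of points of
  \<open>K\<close>.\<close>

locale proj_lyapunov =
  fixes K :: "'a::euclidean_space set" and \<Phi> Q :: "'a \<Rightarrow> 'a" and D :: "'a \<Rightarrow> 'a \<Rightarrow> real" and \<kappa> \<kappa>\<^sub>0 :: real
  assumes K: "closed K" "convex K"
    and \<Phi>_cont: "continuous_on K \<Phi>"
    and \<Phi>_lip: "\<And>x y. x \<in> K \<Longrightarrow> y \<in> K \<Longrightarrow> (\<Phi> x - \<Phi> y) \<bullet> (x - y) \<le> \<kappa> * (norm (x - y))\<^sup>2"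
    and Q_lin: "linear Q" and Q_sym: "\<And>x y. Q x \<bullet> y = x \<bullet> Q y"
    and \<kappa>\<^sub>0: "0 < \<kappa>\<^sub>0"
    and Q_coercive: "\<And>x y. x \<in> K \<Longrightarrow> y \<in> K \<Longrightarrow> \<kappa>\<^sub>0 * (norm (x - y))\<^sup>2 \<le> (x - y) \<bullet> Q (x - y)"
    and D_cont: "\<And>p. continuous_on K (D p)"
    and D_nonneg: "\<And>p u. p \<in> K \<Longrightarrow> u \<in> K \<Longrightarrow> 0 \<le> D p u"
    and equilibrium_exists: "\<exists>p\<in>K. \<Phi> p \<in> normal_cone K p"
    and decay: "\<And>p u w \<rho>. p \<in> K \<Longrightarrow> \<Phi> p \<in> normal_cone K p \<Longrightarrow> u \<in> K \<Longrightarrow> 0 \<le> \<rho> \<Longrightarrow>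
        \<rho> *\<^sub>R \<Phi> u - w \<in> normal_cone K u \<Longrightarrow> w \<bullet> Q (u - p) \<le> - (\<rho> * D p u)"
    and zero_dissipation: "\<And>p u. p \<in> K \<Longrightarrow> \<Phi> p \<in> normal_cone K p \<Longrightarrow> proj_solution K \<Phi> u \<Longrightarrow>
        bounded (u ` {0..}) \<Longrightarrow> (\<And>t. 0 \<le> t \<Longrightarrow> D p (u t) = 0) \<Longrightarrow> \<exists>q. (u \<longlongrightarrow> q) at_top"
begin

abbreviation "W p x \<equiv> (x - p) \<bullet> Q (x - p)"

lemma W_continuous: "continuous_on S (W p)"
  using Q_lin by (intro continuous_intros linear_continuous_on_compose[of S "\<lambda>x. x - p" Q, simplified])

lemma W_sublevel_compact:
  assumes "p \<in> K"
  shows "compact {x \<in> K. W p x \<le> k}"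
proof -
  have "{x \<in> K. W p x \<le> k} = K \<inter> {x. W p x \<le> k}" by blast
  moreover have "closed {x. W p x \<le> k}" by (intro closed_Collect_le W_continuous continuous_intros)
  ultimately have "closed {x \<in> K. W p x \<le> k}" using K(1) by (simp only: closed_Int)
  moreover have "{x \<in> K. W p x \<le> k} \<subseteq> cball p (sqrt (k / \<kappa>\<^sub>0))"
  proof clarify
    fix x assume x: "x \<in> K" "W p x \<le> k"
    have "\<kappa>\<^sub>0 * (norm (x - p))\<^sup>2 \<le> k" using Q_coercive[OF x(1) assms] x(2) by simp
    then have "(norm (x - p))\<^sup>2 \<le> k / \<kappa>\<^sub>0" using \<kappa>\<^sub>0 by (simp add: field_simps)
    then have "norm (x - p) \<le> sqrt (k / \<kappa>\<^sub>0)" by (rule real_le_rsqrt)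
    then show "x \<in> cball p (sqrt (k / \<kappa>\<^sub>0))" by (simp add: dist_norm norm_minus_commute)
  qed
  then have "bounded {x \<in> K. W p x \<le> k}" using bounded_cball bounded_subset by blast
  ultimately show ?thesis using compact_eq_bounded_closed by blast
qed

lemma W_nonincreasing:
  assumes p: "p \<in> K" "\<Phi> p \<in> normal_cone K p" and u: "proj_solution K \<Phi> u" and s: "0 \<le> s" "s \<le> r"
    and \<eta>: "\<And>t. s \<le> t \<Longrightarrow> t \<le> r \<Longrightarrow> \<eta> \<le> D p (u t)"
  shows "W p (u r) + 2 * \<eta> * (r - s) \<le> W p (u s)"
proof (rule quadratic_nonincreasing[OF _ Q_lin Q_sym s])
  show "AE t in lebesgue. 0 < t \<longrightarrow> s \<le> t \<longrightarrow> t \<le> r \<longrightarrow> (\<exists>w. (u has_vector_derivative w) (at t) \<and> w \<bullet> Q (u t - p) \<le> - \<eta>)"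
    using proj_solutionD(3)[OF u]
  proof eventually_elim
    case (elim t)
    show ?case
    proof (intro impI)
      assume t: "0 < t" "s \<le> t" "t \<le> r"
      obtain w where w: "(u has_vector_derivative w) (at t)" "\<Phi> (u t) - w \<in> normal_cone K (u t)" using elim t by blast
      have "u t \<in> K" using u t by (simp add: proj_solution_def)
      then have "w \<bullet> Q (u t - p) \<le> - (1 * D p (u t))" using w(2) by (intro decay[OF p]) auto
      also have "\<dots> \<le> - \<eta>" using \<eta>[of t] t by simp
      finally show "\<exists>w. (u has_vector_derivative w) (at t) \<and> w \<bullet> Q (u t - p) \<le> - \<eta>" using w(1) by blast
    qed
  qed
qed (use u in \<open>simp add: proj_solution_def\<close>)

lemma W_mono:
  assumes p: "p \<in> K" "\<Phi> p \<in> normal_cone K p" and u: "proj_solution K \<Phi> u" and s: "0 \<le> s" "s \<le> r"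
  shows "W p (u r) \<le> W p (u s)"
proof -
  have "0 \<le> D p (u t)" if "s \<le> t" for t using u s that p by (intro D_nonneg) (auto simp: proj_solution_def)
  from W_nonincreasing[OF assms, of 0] this show ?thesis by simp
qed

text \<open>
  Clipping \<open>\<Phi>\<close> to a ball multiplies it by a positive scalar, that is, it only changes the speed of time;
  so \<open>W p\<close> still decreases, and the trajectory never reaches the region where the clipping is active.
\<close>

lemma proj_solution_exists:
  assumes u0: "u0 \<in> K"
  obtains u where "u 0 = u0" "proj_solution K \<Phi> u"
proof -
  obtain p where p: "p \<in> K" "\<Phi> p \<in> normal_cone K p" using equilibrium_exists by blast
  define B where "B = {x \<in> K. W p x \<le> W p u0}"
  have "compact (\<Phi> ` B)"
    unfolding B_def using W_sublevel_compact[OF p(1)]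
    by (intro compact_continuous_image continuous_on_subset[OF \<Phi>_cont]) auto
  then obtain R where R: "R > 0" "\<And>x. x \<in> B \<Longrightarrow> norm (\<Phi> x) \<le> R"
    using compact_imp_bounded bounded_pos by (metis imageI)
  \<comment> \<open>Equals 1 on the sublevel set \<open>B\<close>, where \<open>R\<close> bounds
    \<Phi>; the maximum keeps the denominator positive and the factor continuous.\<close>
  define \<rho> where "\<rho> x = R / max R (norm (\<Phi> x))" for x
  have \<rho>: "0 \<le> \<rho> x" for x using R by (simp add: \<rho>_def)
  define \<Psi> where "\<Psi> x = \<rho> x *\<^sub>R \<Phi> x" for x
  have "continuous_on K \<Psi>" unfolding \<Psi>_def \<rho>_def using R(1)
    by (intro continuous_intros \<Phi>_cont) (auto simp: max_def)
  moreover have "norm (\<Psi> x) \<le> R" for x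
  proof -
    have "norm (\<Psi> x) = R * (norm (\<Phi> x) / max R (norm (\<Phi> x)))" using R(1) by (simp add: \<Psi>_def \<rho>_def)
    also have "\<dots> \<le> R * 1" using R(1) by (intro mult_left_mono) (auto simp: divide_le_eq)
    finally show ?thesis by simp
  qed
  ultimately obtain u where u: "u 0 = u0" "\<And>t. u t \<in> K" "R-lipschitz_on UNIV u"
    "\<And>t w z. 0 < t \<Longrightarrow> (u has_vector_derivative w) (at t) \<Longrightarrow> z \<in> K \<Longrightarrow> (\<Psi> (u t) - w) \<bullet> (z - u t) \<le> 0"
    using projected_euler_limit[OF K _ _ u0, of \<Psi> R] by blast
  have der: "AE t in lebesgue. 0 < t \<longrightarrow> (\<exists>w. (u has_vector_derivative w) (at t) \<and> \<Psi> (u t) - w \<in> normal_cone K (u t))"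
    using lipschitz_differentiable_AE[OF u(3)]
  proof eventually_elim
    case (elim t)
    then obtain w where "(u has_vector_derivative w) (at t)" using vector_derivative_works by blast
    with u(4)[of t w] show ?case by (auto simp: normal_cone_def)
  qed
  have ac: "abs_cont_on {0..T} u" for T
    using lipschitz_imp_abs_cont_on lipschitz_on_subset[OF u(3)] by blast
  have "u t \<in> B" if t: "t \<ge> 0" for t
  proof -
    have "W p (u t) + 2 * 0 * (t - 0) \<le> W p (u 0)"
    proof (rule quadratic_nonincreasing[OF ac Q_lin Q_sym order_refl t])
      show "AE s in lebesgue. 0 < s \<longrightarrow> 0 \<le> s \<longrightarrow> s \<le> t \<longrightarrow> (\<exists>w. (u has_vector_derivative w) (at s) \<and> w \<bullet> Q (u s - p) \<le> - 0)"
        using der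
      proof eventually_elim
        case (elim s)
        show ?case
        proof (intro impI)
          assume "0 < s"
          with elim obtain w where w: "(u has_vector_derivative w) (at s)" "\<Psi> (u s) - w \<in> normal_cone K (u s)" by blast
          have "w \<bullet> Q (u s - p) \<le> - (\<rho> (u s) * D p (u s))"
            using decay[OF p u(2) \<rho>[of "u s"]] w(2) by (simp add: \<Psi>_def)
          also have "\<dots> \<le> - 0" using \<rho>[of "u s"] D_nonneg[OF p(1) u(2)[of s]] by simp
          finally show "\<exists>w. (u has_vector_derivative w) (at s) \<and> w \<bullet> Q (u s - p) \<le> - 0" using w(1) by blast
        qed
      qed
    qed
    then show ?thesis using u(1,2) by (simp add: B_def)
  qed
  then have "\<Psi> (u t) = \<Phi> (u t)" if "t \<ge> 0" for t
    using R(1) R(2)[of "u t"] that by (simp add: \<Psi>_def \<rho>_def max_absorb1)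
  then have "proj_solution K \<Phi> u"
    unfolding proj_solution_def using u(2) ac der by (auto elim!: eventually_mono)
  with u(1) show thesis using that by blast
qed

lemma proj_solution_continuous:
  assumes "proj_solution K \<Phi> u"
  shows "continuous_on {0..T} u"
proof (cases "0 \<le> T")
  case True
  then show ?thesis using assms by (intro abs_cont_on_imp_continuous_on) (simp add: proj_solution_def)
qed simp

text \<open>The inclusion holds only almost everywhere, but a single good time in (0,1) suffices:
  there the velocity is 0.\<close>

lemma constant_proj_solution_equilibrium:
  assumes "proj_solution K \<Phi> u" "\<And>t. 0 \<le> t \<Longrightarrow> u t = q"
  shows "\<Phi> q \<in> normal_cone K q"
proof -
  from proj_solutionD(3)[OF assms(1)] obtain N where N: "N \<in> null_sets lebesgue"
    "\<And>t. t \<notin> N \<Longrightarrow> 0 < t \<Longrightarrow> \<exists>w. (u has_vector_derivative w) (at t) \<and> \<Phi> (u t) - w \<in> normal_cone K (u t)"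
    by (rule AE_E3) auto
  have "\<not> {0<..<1::real} \<subseteq> N"
    using open_not_negligible[of "{0<..<1::real}"] N(1) negligible_subset by (auto simp: negligible_iff_null_sets[symmetric])
  then obtain t where t: "0 < t" "t \<notin> N" by (meson greaterThanLessThan_iff subsetI)
  then obtain w where w: "(u has_vector_derivative w) (at t)" "\<Phi> (u t) - w \<in> normal_cone K (u t)" using N(2) by blast
  have "(u has_vector_derivative 0) (at t)"
  proof (rule has_vector_derivative_transform_within_open[OF has_vector_derivative_const[of q]])
    show "open {0::real<..}" "t \<in> {0<..}" using t by auto
  qed (use assms(2) in auto)
  then have "w = 0" using w(1) vector_derivative_unique_at by blast
  then show ?thesis using w(2) assms(2)[of t] t by simp
qed

text \<open>
  LaSalle's argument: the solution \<open>v\<close> that starts at an \<open>\<omega>\<close>-limit point \<open>y\<close> of \<open>u\<close> has constant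
  \<open>W p\<close>, hence no dissipation, hence a limit \<open>q\<close>. This \<open>q\<close> is an equilibrium and again an
  \<open>\<omega>\<close>-limit point of \<open>u\<close>, so the decreasing function \<open>W q (u t)\<close> tends to 0.
\<close>

theorem proj_solution_converges:
  assumes u: "proj_solution K \<Phi> u"
  obtains q where "q \<in> K" "\<Phi> q \<in> normal_cone K q" "(u \<longlongrightarrow> q) at_top"
proof -
  obtain p where p: "p \<in> K" "\<Phi> p \<in> normal_cone K p" using equilibrium_exists by blast
  have uK: "u t \<in> K" if "0 \<le> t" for t using u that by (simp add: proj_solution_def)
  define B where "B = {x \<in> K. W p x \<le> W p (u 0)}"
  have B: "compact B" unfolding B_def by (rule W_sublevel_compact[OF p(1)])
  have "\<forall>n. u (real n) \<in> B" using uK W_mono[OF p u order_refl] by (simp add: B_def)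
  then obtain y r where y: "y \<in> B" and r: "strict_mono (r :: nat \<Rightarrow> nat)" "((\<lambda>n. u (real n)) \<circ> r) \<longlonglongrightarrow> y"
    using B unfolding compact_def by metis
  have lim0: "(\<lambda>n. u (real (r n))) \<longlonglongrightarrow> y" using r(2) by (simp add: o_def)
  have yK: "y \<in> K" using y by (simp add: B_def)
  obtain v where v: "v 0 = y" "proj_solution K \<Phi> v" using proj_solution_exists[OF yK] by blast
  have vK: "v t \<in> K" if "0 \<le> t" for t using v(2) that by (simp add: proj_solution_def)
  \<comment> \<open>Continuous dependence: the restarted curves have initial values tending to
    \<open>y\<close>, so they follow the solution from \<open>y\<close> on.\<close>
  have lim: "(\<lambda>n. u (real (r n) + s)) \<longlonglongrightarrow> v s" if s: "0 \<le> s" for s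
  proof (rule Lim_null[THEN iffD2, OF tendsto_norm_zero_cancel])
    have "(\<lambda>n. exp (\<kappa> * s) * norm (u (real (r n)) - y)) \<longlonglongrightarrow> exp (\<kappa> * s) * norm (y - y)"
      by (intro tendsto_intros lim0)
    then have z: "(\<lambda>n. exp (\<kappa> * s) * norm (u (real (r n)) - y)) \<longlonglongrightarrow> 0" by simp
    show "(\<lambda>n. norm (u (real (r n) + s) - v s)) \<longlonglongrightarrow> 0"
    proof (rule tendsto_sandwich[OF _ _ tendsto_const z])
      show "\<forall>\<^sub>F n in sequentially. norm (u (real (r n) + s) - v s) \<le> exp (\<kappa> * s) * norm (u (real (r n)) - y)"
      proof (rule always_eventually, rule allI)
        fix n
        have "proj_solution K \<Phi> (\<lambda>t. u (real (r n) + t))" by (rule proj_solution_shift[OF u]) simp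
        from proj_solution_distance[OF \<Phi>_lip this v(2) s]
        show "norm (u (real (r n) + s) - v s) \<le> exp (\<kappa> * s) * norm (u (real (r n)) - y)" by (simp add: v(1))
      qed
    qed simp
  qed
  have Wlim: "(\<lambda>n. W p' (u (real (r n) + s))) \<longlonglongrightarrow> W p' (v s)" if "0 \<le> s" for s p'
    using continuous_on_tendsto_compose[OF W_continuous[of UNIV p'] lim[OF that]] by simp
  have Wconst: "W p (v s) = W p y" if s: "0 \<le> s" for s
  proof (rule antisym)
    show "W p (v s) \<le> W p y" using W_mono[OF p v(2) order_refl s] v(1) by simp
    \<comment> \<open>\<open>W p (u t)\<close> is nonincreasing, so each of its values dominates the
      limit along the sequence \<open>r\<close>.\<close>
    have "W p y \<le> W p (u (real (r n) + s))" for n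
    proof -
      obtain m0 where m0: "real (r n) + s \<le> real m0" using real_arch_simple by blast
      have "(\<lambda>m. W p (u (real (r m)))) \<longlonglongrightarrow> W p y" using Wlim[of 0 p] v(1) by simp
      then show ?thesis
      proof (rule LIMSEQ_le_const2)
        have "W p (u (real (r m))) \<le> W p (u (real (r n) + s))" if "m \<ge> m0" for m
        proof -
          have "real m0 \<le> real (r m)" using seq_suble[OF r(1), of m] that by simp
          then show ?thesis using m0 s by (intro W_mono[OF p u]) auto
        qed
        then show "\<exists>N. \<forall>m\<ge>N. W p (u (real (r m))) \<le> W p (u (real (r n) + s))" by blast
      qed
    qed
    then show "W p y \<le> W p (v s)" by (intro LIMSEQ_le_const[OF Wlim[OF s]]) auto
  qed
  have "D p (v t0) = 0" if t0: "0 \<le> t0" for t0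
  proof (rule ccontr)
    assume "D p (v t0) \<noteq> 0"
    then have pos: "D p (v t0) > 0" using D_nonneg[OF p(1) vK[OF t0]] by simp
    define \<eta> where "\<eta> = D p (v t0) / 2"
    have "continuous_on {0..t0 + 1} (\<lambda>t. D p (v t))"
      by (rule continuous_on_compose2[OF D_cont proj_solution_continuous[OF v(2)]]) (use vK in auto)
    then obtain \<delta>' where \<delta>': "\<delta>' > 0" "\<And>t. t \<in> {0..t0 + 1} \<Longrightarrow> dist t t0 < \<delta>' \<Longrightarrow> dist (D p (v t)) (D p (v t0)) < \<eta>"
      unfolding continuous_on_iff using t0 pos by (metis \<eta>_def atLeastAtMost_iff half_gt_zero le_add_same_cancel1 zero_le_one)
    \<comment> \<open>By continuity the dissipation would exceed \<eta> on a whole interval of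
      length \<delta>, and \<open>W p\<close> would strictly drop there.\<close>
    define \<delta> where "\<delta> = min 1 (\<delta>' / 2)"
    have \<delta>: "\<delta> > 0" "\<delta> \<le> 1" "\<delta> < \<delta>'" using \<delta>' by (auto simp: \<delta>_def)
    have "\<eta> \<le> D p (v t)" if "t0 \<le> t" "t \<le> t0 + \<delta>" for t
      using \<delta>'(2)[of t] that \<delta> t0 unfolding \<eta>_def by (simp add: dist_real_def abs_if split: if_splits)
    from W_nonincreasing[OF p v(2) t0 _ this, of "t0 + \<delta>"] \<delta>
    have "W p (v (t0 + \<delta>)) + 2 * \<eta> * \<delta> \<le> W p (v t0)" by simp
    moreover have "2 * \<eta> * \<delta> > 0" using pos \<delta> by (simp add: \<eta>_def)
    ultimately show False using Wconst[of t0] Wconst[of "t0 + \<delta>"] t0 \<delta> by simp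
  qed
  moreover have "bounded (v ` {0..})"
  proof (rule bounded_subset[OF compact_imp_bounded[OF W_sublevel_compact[OF p(1)]]])
    show "v ` {0..} \<subseteq> {x \<in> K. W p x \<le> W p y}" using vK Wconst by auto
  qed
  ultimately obtain q where q: "(v \<longlongrightarrow> q) at_top" using zero_dissipation[OF p v(2)] by blast
  have qK: "q \<in> K"
  proof (rule Lim_in_closed_set[OF K(1) _ _ q])
    show "\<forall>\<^sub>F t in at_top. v t \<in> K" using eventually_ge_at_top[of 0] by eventually_elim (rule vK)
  qed simp
  obtain v' where v': "v' 0 = q" "proj_solution K \<Phi> v'" using proj_solution_exists[OF qK] by blast
  \<comment> \<open>The limit of a trajectory is invariant: shifting \<open>v\<close> by
    \<open>s\<close> changes neither its limit nor, by continuous dependence, the fact that the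
    limit is \<open>v' s\<close>.\<close>
  have "v' s = q" if s: "0 \<le> s" for s
  proof -
    have "((\<lambda>t. exp (\<kappa> * s) * norm (v t - q)) \<longlongrightarrow> exp (\<kappa> * s) * norm (q - q)) at_top" by (intro tendsto_intros q)
    then have z: "((\<lambda>t. exp (\<kappa> * s) * norm (v t - q)) \<longlongrightarrow> 0) at_top" by simp
    have "((\<lambda>t. norm (v (t + s) - v' s)) \<longlongrightarrow> 0) at_top"
    proof (rule tendsto_sandwich[OF _ _ tendsto_const z])
      show "\<forall>\<^sub>F t in at_top. norm (v (t + s) - v' s) \<le> exp (\<kappa> * s) * norm (v t - q)"
        using eventually_ge_at_top[of 0]
      proof eventually_elim
        case (elim t)
        from proj_solution_distance[OF \<Phi>_lip proj_solution_shift[OF v(2) elim] v'(2) s]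
        show ?case by (simp add: v'(1))
      qed
    qed simp
    then have "((\<lambda>t. v (t + s)) \<longlongrightarrow> v' s) at_top" by (rule Lim_null[THEN iffD2, OF tendsto_norm_zero_cancel])
    moreover have "((\<lambda>t. v (t + s)) \<longlongrightarrow> q) at_top"
      by (rule filterlim_compose[OF q]) (rule filterlim_tendsto_add_at_top[OF tendsto_const filterlim_ident, of s, simplified add.commute])
    ultimately show ?thesis by (rule tendsto_unique[OF trivial_limit_at_top_linorder])
  qed
  then have qE: "\<Phi> q \<in> normal_cone K q" using constant_proj_solution_equilibrium[OF v'(2)] by blast
  have "(u \<longlongrightarrow> q) at_top"
  proof (rule tendstoI)
    fix e :: real assume e: "e > 0"
    define \<epsilon> where "\<epsilon> = \<kappa>\<^sub>0 * e\<^sup>2"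
    have \<epsilon>: "\<epsilon> > 0" using e \<kappa>\<^sub>0 by (simp add: \<epsilon>_def)
    have "((\<lambda>t. W q (v t)) \<longlongrightarrow> W q q) at_top"
      using continuous_on_tendsto_compose[OF W_continuous[of UNIV q] q] by simp
    then have "\<forall>\<^sub>F t in at_top. W q (v t) < \<epsilon>" using \<epsilon> by (intro order_tendstoD) auto
    then have "\<forall>\<^sub>F t in at_top. W q (v t) < \<epsilon> \<and> 0 \<le> t" using eventually_ge_at_top[of 0] by eventually_elim auto
    then obtain s where s: "W q (v s) < \<epsilon>" "0 \<le> s" using eventually_happens[of _ "at_top :: real filter"] by auto
    \<comment> \<open>A single late time at which \<open>u\<close> is close to \<open>v s\<close>,
      itself close to \<open>q\<close>, is enough: \<open>W q (u t)\<close> cannot increase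
      afterwards.\<close>
    have "\<forall>\<^sub>F n in sequentially. W q (u (real (r n) + s)) < \<epsilon>"
      using order_tendstoD(2)[OF Wlim[OF s(2)] s(1)] .
    then obtain n where n: "W q (u (real (r n) + s)) < \<epsilon>" using eventually_happens[of _ sequentially] by auto
    have "dist (u t) q < e" if t: "t \<ge> real (r n) + s" for t
    proof -
      have "0 \<le> t" using t s by simp
      then have "\<kappa>\<^sub>0 * (norm (u t - q))\<^sup>2 \<le> W q (u t)" by (intro Q_coercive uK qK)
      also have "\<dots> \<le> W q (u (real (r n) + s))" using t s by (intro W_mono[OF qK qE u]) auto
      also note n
      finally have "(norm (u t - q))\<^sup>2 < e\<^sup>2" using \<kappa>\<^sub>0 by (simp add: \<epsilon>_def)
      then show ?thesis using e by (simp add: dist_norm power_less_imp_less_base)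
    qed
    then show "\<forall>\<^sub>F t in at_top. dist (u t) q < e" by (auto simp: eventually_at_top_linorder)
  qed
  with qK qE show thesis using that by blast
qed

end

section \<open>The aggregative dynamics\<close>

lemma normal_cone_Times:
  assumes "x \<in> A" "y \<in> B"
  shows "(a, b) \<in> normal_cone (A \<times> B) (x, y) \<longleftrightarrow> a \<in> normal_cone A x \<and> b \<in> normal_cone B y"
proof
  assume n: "(a, b) \<in> normal_cone (A \<times> B) (x, y)"
  then have le: "a \<bullet> (z - x) + b \<bullet> (w - y) \<le> 0" if "z \<in> A" "w \<in> B" for z w
    using that by (auto simp: normal_cone_def)
  show "a \<in> normal_cone A x \<and> b \<in> normal_cone B y"
    using le[OF _ assms(2)] le[OF assms(1)] by (simp add: normal_cone_def)
next
  assume "a \<in> normal_cone A x \<and> b \<in> normal_cone B y"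
  then show "(a, b) \<in> normal_cone (A \<times> B) (x, y)"
    by (auto simp: normal_cone_def intro: add_nonpos_nonpos)
qed

lemma normal_cone_subspace:
  assumes "subspace A" "x \<in> A"
  shows "a \<in> normal_cone A x \<longleftrightarrow> (\<forall>y\<in>A. a \<bullet> y = 0)"
proof
  assume n: "a \<in> normal_cone A x"
  show "\<forall>y\<in>A. a \<bullet> y = 0"
  proof
    fix y assume y: "y \<in> A"
    have "a \<bullet> ((x + y) - x) \<le> 0" "a \<bullet> ((x - y) - x) \<le> 0"
      using n subspace_add[OF assms y] subspace_diff[OF assms y] unfolding normal_cone_def by blast+
    then show "a \<bullet> y = 0" by simp
  qed
next
  assume "\<forall>y\<in>A. a \<bullet> y = 0"
  then show "a \<in> normal_cone A x"
    using subspace_diff[OF assms(1) _ assms(2)] by (auto simp: normal_cone_def)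
qed

lemma nonneg_stack_iff: "0 \<le> (l :: real^'m^'i) \<longleftrightarrow> (\<forall>i j. 0 \<le> l $ i $ j)"
  by (simp add: less_eq_vec_def)

lemma nonneg_stack_set: "{0..} = (\<Inter>i. \<Inter>j. {l :: real^'m^'i. 0 \<le> l $ i $ j})"
  by (auto simp: nonneg_stack_iff)

lemma nonneg_stack_closed: "closed {0 :: real^'m^'i..}"
  unfolding nonneg_stack_set by (intro closed_INT ballI closed_Collect_le continuous_intros)

lemma nonneg_stack_convex: "convex {0 :: real^'m^'i..}"
  by (rule convexI) (simp add: nonneg_stack_iff)

lemma normal_cone_nonneg_stack:
  fixes l v :: "real^'m^'i"
  assumes l: "0 \<le> l"
  shows "v \<in> normal_cone {0..} l \<longleftrightarrow> (\<forall>i j. v $ i $ j \<le> 0 \<and> l $ i $ j * v $ i $ j = 0)"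
proof
  assume n: "v \<in> normal_cone {0..} l"
  have key: "v $ i $ j * a \<le> 0" if "0 \<le> l $ i $ j + a" for i j a
  proof -
    define e where "e = axis i (axis j a) + l"
    have "e $ i' $ j' = (if i' = i \<and> j' = j then a else 0) + l $ i' $ j'" for i' j'
      by (auto simp: e_def axis_def)
    then have "0 \<le> e" using l that by (auto simp: nonneg_stack_iff add.commute)
    then have "v \<bullet> (e - l) \<le> 0" using n by (auto simp: normal_cone_def)
    then show ?thesis by (simp add: e_def inner_axis)
  qed
  show "\<forall>i j. v $ i $ j \<le> 0 \<and> l $ i $ j * v $ i $ j = 0"
  proof (intro allI)
    fix i j
    have lij: "0 \<le> l $ i $ j" using l by (simp add: nonneg_stack_iff)
    have "v $ i $ j \<le> 0" using key[of i j 1] lij by simp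
    moreover have "v $ i $ j * (- (l $ i $ j)) \<le> 0" by (rule key) simp
    moreover have "v $ i $ j * l $ i $ j \<le> 0" by (rule key) (use lij in simp)
    ultimately show "v $ i $ j \<le> 0 \<and> l $ i $ j * v $ i $ j = 0" by (simp add: mult.commute)
  qed
next
  assume v: "\<forall>i j. v $ i $ j \<le> 0 \<and> l $ i $ j * v $ i $ j = 0"
  have "v \<bullet> (y - l) \<le> 0" if "0 \<le> y" for y
  proof -
    have "v \<bullet> (y - l) = (\<Sum>i\<in>UNIV. \<Sum>j\<in>UNIV. v $ i $ j * y $ i $ j - l $ i $ j * v $ i $ j)"
      by (simp add: inner_vec_def algebra_simps)
    also have "\<dots> \<le> 0"
    proof (intro sum_nonpos)
      fix i j
      have "v $ i $ j * y $ i $ j \<le> 0" using v that by (simp add: nonneg_stack_iff mult_nonpos_nonneg)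
      then show "v $ i $ j * y $ i $ j - l $ i $ j * v $ i $ j \<le> 0" using v by (metis diff_zero)
    qed
    finally show ?thesis .
  qed
  then show "v \<in> normal_cone {0..} l" by (simp add: normal_cone_def)
qed

lemma tendsto_at_top_decreasing:
  fixes h :: "real \<Rightarrow> real"
  assumes dec: "\<And>s t. 0 \<le> s \<Longrightarrow> s \<le> t \<Longrightarrow> h t \<le> h s" and lb: "\<And>t. 0 \<le> t \<Longrightarrow> b \<le> h t"
  shows "\<exists>a. (h \<longlongrightarrow> a) at_top"
proof
  let ?a = "Inf (h ` {0..})"
  have bdd: "bdd_below (h ` {0..})" using lb by (auto simp: bdd_below_def)
  show "(h \<longlongrightarrow> ?a) at_top"
  proof (rule tendstoI)
    fix e :: real assume "e > 0"
    then obtain s where s: "0 \<le> s" "h s < ?a + e" using cInf_lessD[of "h ` {0..}" "?a + e"] by auto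
    have "dist (h t) ?a < e" if "s \<le> t" for t
    proof -
      have "?a \<le> h t" using s that by (intro cInf_lower bdd) auto
      moreover have "h t \<le> h s" using dec s that by blast
      ultimately show ?thesis using s by (simp add: dist_real_def)
    qed
    then show "\<forall>\<^sub>F t in at_top. dist (h t) ?a < e" by (auto simp: eventually_at_top_linorder)
  qed
qed

text \<open>The squared distance to \<open>A\<close> is differentiable and decreases along the
  curve, so it stays 0. The angle condition concerns the curve wherever it may be, hence invariance
  is not presupposed.\<close>

lemma closed_convex_invariant:
  fixes y :: "real \<Rightarrow> 'a::euclidean_space"
  assumes A: "closed A" "convex A" and y0: "y 0 \<in> A" and T: "0 \<le> T" and ac: "abs_cont_on {0..T} y"
    and der: "AE t in lebesgue. 0 \<le> t \<longrightarrow> (\<exists>w. (y has_vector_derivative w) (at t) \<and> (y t - closest_point A (y t)) \<bullet> w \<le> 0)"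
  shows "y T \<in> A"
proof -
  have ne: "A \<noteq> {}" using y0 by blast
  define r where "r t = norm (y t - closest_point A (y t))" for t
  have "abs_cont_on {0..T} r"
  proof (rule abs_cont_on_transfer[OF ac, of _ 2])
    fix s t
    have "norm (r t - r s) \<le> norm ((y t - closest_point A (y t)) - (y s - closest_point A (y s)))"
      unfolding r_def real_norm_def by (rule norm_triangle_ineq3)
    also have "\<dots> \<le> norm (y t - y s) + norm (closest_point A (y t) - closest_point A (y s))"
      using norm_triangle_ineq4[of "y t - y s" "closest_point A (y t) - closest_point A (y s)"] by (simp add: algebra_simps)
    also have "\<dots> \<le> 2 * norm (y t - y s)"
      using closest_point_lipschitz[OF A(2,1) ne, of "y t" "y s"] by (simp add: dist_norm)
    finally show "norm (r t - r s) \<le> 2 * norm (y t - y s)" .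
  qed
  from abs_cont_on_inner[OF this this] have "abs_cont_on {0..T} (\<lambda>t. (r t)\<^sup>2)"
    by (simp add: power2_eq_square inner_real_def)
  moreover have "AE t in lebesgue. 0 \<le> t \<and> t \<le> T \<longrightarrow> (\<exists>D\<le>0. ((\<lambda>t. (r t)\<^sup>2) has_real_derivative D) (at t))"
    using der
  proof eventually_elim
    case (elim t)
    show ?case
    proof
      assume "0 \<le> t \<and> t \<le> T"
      with elim obtain w where w: "(y has_vector_derivative w) (at t)" "(y t - closest_point A (y t)) \<bullet> w \<le> 0" by blast
      have "((\<lambda>t. (norm (y t - closest_point A (y t)))\<^sup>2) has_derivative
          (\<lambda>h. 2 * ((y t - closest_point A (y t)) \<bullet> (h *\<^sub>R w)))) (at t)"
        using diff_chain_at[OF w(1)[unfolded has_vector_derivative_def] has_derivative_square_dist_closest_point[OF A(2,1) ne]]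
        by (simp add: o_def)
      moreover have "(\<lambda>h. 2 * ((y t - closest_point A (y t)) \<bullet> (h *\<^sub>R w))) = (*) (2 * ((y t - closest_point A (y t)) \<bullet> w))"
        by (simp add: fun_eq_iff)
      ultimately have "((\<lambda>t. (r t)\<^sup>2) has_real_derivative 2 * ((y t - closest_point A (y t)) \<bullet> w)) (at t)"
        unfolding r_def has_field_derivative_def by simp
      then show "\<exists>D\<le>0. ((\<lambda>t. (r t)\<^sup>2) has_real_derivative D) (at t)" using w(2)
        by (intro exI[of _ "2 * ((y t - closest_point A (y t)) \<bullet> w)"]) simp
    qed
  qed
  ultimately have "(r T)\<^sup>2 \<le> (r 0)\<^sup>2" by (rule abs_cont_on_nonincreasing[OF _ T])
  also have "r 0 = 0" using y0 by (simp add: r_def closest_point_self)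
  finally have "y T = closest_point A (y T)" by (simp add: r_def)
  then show ?thesis using closest_point_in_set[OF A(1) ne, of "y T"] by simp
qed

lemma closest_point_subspace_orthogonal:
  fixes A :: "'a::euclidean_space set"
  assumes A: "subspace A" and w: "w \<in> A"
  shows "(y - closest_point A y) \<bullet> w = 0"
proof -
  let ?p = "closest_point A y"
  have c: "convex A" "closed A" "A \<noteq> {}" using A subspace_imp_convex closed_subspace subspace_0 by blast+
  have p: "?p \<in> A" by (rule closest_point_in_set[OF c(2,3)])
  have "(y - ?p) \<bullet> (?p + w - ?p) \<le> 0" "(y - ?p) \<bullet> (?p - w - ?p) \<le> 0"
    by (intro closest_point_dot c subspace_add subspace_diff A p w)+
  then show ?thesis by simp
qed

text \<open>Lets the unprojected equations for \<open>s\<close> and \<open>z\<close> be read as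
  projected ones on \<open>E_perp\<close>, so the whole system is a projection onto one convex
  set.\<close>

lemma proj_vf_subspace:
  fixes A :: "'a::euclidean_space set"
  assumes A: "subspace A" and x: "x \<in> A" and v: "v \<in> A"
  shows "proj_vf A x v = v"
proof (rule proj_vf_eqI)
  show "v \<in> tangent_cone A x" using tangent_cone_diff[OF subspace_add[OF A v x], of x] by simp
qed (use A subspace_imp_convex in \<open>auto simp: normal_cone_def\<close>)

type_synonym ('n, 'b, 'm, 'i) state =
  "(real, 'n) vec \<times> ((real, 'b) vec, 'i) vec \<times> ((real, 'm) vec, 'i) vec \<times> ((real, 'm) vec, 'i) vec"

lemma bounded_linear_components:
  "bounded_linear (\<lambda>p :: 'a::real_normed_vector \<times> 'b::real_normed_vector \<times> 'c::real_normed_vector \<times> 'd::real_normed_vector. fst p)"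
  "bounded_linear (\<lambda>p :: 'a::real_normed_vector \<times> 'b::real_normed_vector \<times> 'c::real_normed_vector \<times> 'd::real_normed_vector. fst (snd p))"
  "bounded_linear (\<lambda>p :: 'a::real_normed_vector \<times> 'b::real_normed_vector \<times> 'c::real_normed_vector \<times> 'd::real_normed_vector. fst (snd (snd p)))"
  "bounded_linear (\<lambda>p :: 'a::real_normed_vector \<times> 'b::real_normed_vector \<times> 'c::real_normed_vector \<times> 'd::real_normed_vector. snd (snd (snd p)))"
  by (intro bounded_linear_intros)+

locale aggregative_dynamics = aggregative_game own \<Omega> g M d f \<mu> \<theta>
  for own :: "'n::finite \<Rightarrow> 'i::finite" and \<Omega> and g :: "'i \<Rightarrow> real^'n \<Rightarrow> real^'m" and M :: "real^'n^'b"
    and d f \<mu> \<theta> +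
  fixes E :: "('i \<times> 'i) set" and \<theta>\<^sub>\<sigma> c :: real
  assumes N_ge_2: "2 \<le> CARD('i)"
    and graph_undirected: "sym E"
    and graph_connected: "\<And>i j. (i, j) \<in> E\<^sup>*"
    and \<theta>\<sigma>_pos: "0 < \<theta>\<^sub>\<sigma>"
    and Ft_lipschitz_\<sigma>: "\<And>x. \<theta>\<^sub>\<sigma>-lipschitz_on UNIV (ext_pseudo_grad own M f x)"
    and c_large: "c > \<theta>\<^sub>\<sigma>\<^sup>2 / (4 * \<mu> * lambda2 (laplacian E))"
begin

abbreviation "Lap \<equiv> kron_id (laplacian E)"
abbreviation "\<Lambda>2 \<equiv> lambda2 (laplacian E)"
abbreviation "S \<equiv> state_set own \<Omega>"
abbreviation "dyn \<equiv> dynamics own \<Omega> g M d f (laplacian E) c"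
abbreviation "BT \<equiv> adjoint (B_diag own M)"

definition field_x :: "real^'n \<Rightarrow> real^'b^'i \<Rightarrow> real^'m^'i \<Rightarrow> real^'n"
  where "field_x x s l = - Ft x (\<psi>s x + s) - JT x l - c *\<^sub>R BT (Lap (\<psi>s x + s))"

text \<open>The right-hand side before projection. It is continuous everywhere, whereas
  \<open>dyn\<close> can jump at the boundary of \<open>S\<close>.\<close>

definition field :: "('n, 'b, 'm, 'i) state \<Rightarrow> ('n, 'b, 'm, 'i) state"
  where "field = (\<lambda>(x, s, z, l).
           (field_x x s l, - c *\<^sub>R Lap (\<psi>s x + s), Lap l, Gs x - z - Lap l))"

lemma field_simp: "field (x, s, z, l) = (field_x x s l, - c *\<^sub>R Lap (\<psi>s x + s), Lap l, Gs x - z - Lap l)"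
  by (simp add: field_def)

lemma dyn_simp: "dyn (x, s, z, l) =
    (proj_vf X x (field_x x s l), - c *\<^sub>R Lap (\<psi>s x + s), Lap l, proj_vf {0..} l (Gs x - z - Lap l))"
  by (simp add: dynamics_def Let_def field_x_def)

lemma S_iff: "(x, s, z, l) \<in> S \<longleftrightarrow> x \<in> X \<and> s \<in> E_perp \<and> z \<in> E_perp \<and> 0 \<le> l"
  by (simp add: state_set_def)

lemma S_closed: "closed S"
  unfolding state_set_def
  by (intro closed_Times X_closed closed_subspace subspace_E_perp nonneg_stack_closed)

lemma S_convex: "convex S"
  unfolding state_set_def
  by (intro convex_Times X_convex subspace_imp_convex subspace_E_perp nonneg_stack_convex)

lemma normal_cone_S:
  assumes "(x, s, z, l) \<in> S"
  shows "(a, b, e, h) \<in> normal_cone S (x, s, z, l) \<longleftrightarrow>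
    a \<in> normal_cone X x \<and> (\<forall>y\<in>E_perp. b \<bullet> y = 0) \<and> (\<forall>y\<in>E_perp. e \<bullet> y = 0) \<and> h \<in> normal_cone {0..} l"
  using assms unfolding S_iff state_set_def
  by (subst normal_cone_Times, simp, simp)+ (simp add: normal_cone_subspace[OF subspace_E_perp])

lemma \<Lambda>2_pos: "0 < \<Lambda>2"
  by (rule lambda2_laplacian_bounds(1)[OF N_ge_2 graph_undirected graph_connected])

lemma c_bound: "0 < c" "\<theta>\<^sub>\<sigma>\<^sup>2 < 4 * \<mu> * (c * \<Lambda>2)"
proof -
  have "0 < 4 * \<mu> * \<Lambda>2" using \<mu>_pos \<Lambda>2_pos by simp
  then show "\<theta>\<^sub>\<sigma>\<^sup>2 < 4 * \<mu> * (c * \<Lambda>2)" using c_large by (simp add: divide_less_eq algebra_simps)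
  have "0 \<le> \<theta>\<^sub>\<sigma>\<^sup>2 / (4 * \<mu> * \<Lambda>2)" using \<open>0 < 4 * \<mu> * \<Lambda>2\<close> by simp
  then show "0 < c" using c_large by linarith
qed

text \<open>
  Lower bound for the dissipation in terms of \<open>a = norm (x - x')\<close> and the distance \<open>b\<close> of \<open>\<sigma>\<close> from
  consensus. It is positive definite exactly when \<open>c\<close> exceeds the threshold of the theorem.
\<close>

definition quad :: "real \<Rightarrow> real \<Rightarrow> real"
  where "quad a b = \<mu> * a\<^sup>2 - \<theta>\<^sub>\<sigma> * a * b + c * \<Lambda>2 * b\<^sup>2"

text \<open>Completing the square; the coefficient of b^2 is positive by the condition on
  \<open>c\<close>.\<close>

lemma quad_square: "4 * \<mu> * quad a b = (2 * \<mu> * a - \<theta>\<^sub>\<sigma> * b)\<^sup>2 + (4 * \<mu> * (c * \<Lambda>2) - \<theta>\<^sub>\<sigma>\<^sup>2) * b\<^sup>2"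
  by (simp add: quad_def power2_eq_square algebra_simps)

lemma quad_nonneg: "0 \<le> quad a b"
proof -
  have "0 \<le> 4 * \<mu> * quad a b" unfolding quad_square using c_bound by simp
  then show ?thesis using \<mu>_pos by (simp add: zero_le_mult_iff)
qed

lemma quad_zero: "quad a b = 0 \<Longrightarrow> a = 0 \<and> b = 0"
proof -
  assume 0: "quad a b = 0"
  have "0 \<le> (4 * \<mu> * (c * \<Lambda>2) - \<theta>\<^sub>\<sigma>\<^sup>2) * b\<^sup>2" using c_bound by simp
  then have 1: "(4 * \<mu> * (c * \<Lambda>2) - \<theta>\<^sub>\<sigma>\<^sup>2) * b\<^sup>2 = 0" "(2 * \<mu> * a - \<theta>\<^sub>\<sigma> * b)\<^sup>2 = 0"
    using quad_square[of a b, unfolded 0 mult_zero_right] zero_le_power2[of "2 * \<mu> * a - \<theta>\<^sub>\<sigma> * b"] by linarith+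
  then have "b = 0" using c_bound by simp
  then show ?thesis using 1(2) \<mu>_pos by simp
qed

text \<open>Measures the error of x, the disagreement of \<sigma> around \<psi>(x) and the
  disagreement of \<lambda>. It does not see z or the common value of the multipliers, which is why
  an invariance argument is required.\<close>

definition dissip :: "('n, 'b, 'm, 'i) state \<Rightarrow> ('n, 'b, 'm, 'i) state \<Rightarrow> real"
  where "dissip p u = quad (norm (fst u - fst p)) (norm (\<psi>s (fst u) + fst (snd u) - (\<chi> i. \<psi> (fst u))))
           + snd (snd (snd u)) \<bullet> Lap (snd (snd (snd u)))"

lemma Lap_nonneg: "0 \<le> y \<bullet> Lap y"
  unfolding kron_id_inner laplacian_bilinear[OF graph_undirected]
  by (intro divide_nonneg_nonneg sum_nonneg mult_nonneg_nonneg adjacency_nonneg) auto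

lemma dissip_nonneg: "0 \<le> dissip p u"
  unfolding dissip_def by (intro add_nonneg_nonneg quad_nonneg Lap_nonneg)

lemma Lap_sym: "x \<bullet> Lap y = Lap x \<bullet> y"
  by (rule kron_id_laplacian_sym[OF graph_undirected])

lemma Lap_E_perp: "Lap y \<in> E_perp"
  by (rule kron_id_laplacian_E_perp[OF graph_undirected])

lemma deviation_E_perp:
  assumes "s \<in> E_perp"
  shows "\<psi>s x + s - (\<chi> i. \<psi> x) \<in> E_perp"
  using assms mean_\<psi>s[of x] by (simp add: E_perp_def sum_subtractf sum.distrib scaleR_conv_of_real sum_constant_scaleR)

lemma Lap_deviation: "Lap (y - (\<chi> i. v)) = Lap y"
  by (simp add: linear_diff[OF linear_kron_id] kron_id_laplacian_consensus)

text \<open>Averaging over the agents: \<open>s\<close> sums to zero, so the mean of \<sigma> is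
  always \<psi>(x).\<close>

lemma consensus_value:
  assumes "s \<in> E_perp" "\<psi>s x + s = (\<chi> i. v)"
  shows "v = \<psi> x"
proof -
  have "(\<chi> i::'i. v - \<psi> x) \<in> E_perp"
  proof -
    have "(\<chi> i::'i. v - \<psi> x) = \<psi>s x + s - (\<chi> i. \<psi> x)" unfolding assms(2) by (simp add: vec_eq_iff)
    then show ?thesis using deviation_E_perp[OF assms(1), of x] by simp
  qed
  then have "(\<Sum>i\<in>(UNIV :: 'i set). v - \<psi> x) = 0" unfolding E_perp_def mem_Collect_eq vec_lambda_beta .
  then have "real CARD('i) *\<^sub>R (v - \<psi> x) = 0" by (simp only: sum_constant_scaleR)
  then show ?thesis by simp
qed

text \<open>Normality to \<open>E_perp\<close> means orthogonality to it, and images of the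
  Laplacian belong to \<open>E_perp\<close>; testing \<open>Lap y\<close> with itself forces it to
  vanish, and connectedness then gives consensus.\<close>

lemma equilibriumD:
  assumes S: "(x, s, z, l) \<in> S" and n: "field (x, s, z, l) \<in> normal_cone S (x, s, z, l)"
  shows "Lap (\<psi>s x + s) = 0" "\<psi>s x + s = (\<chi> i. \<psi> x)" "Lap l = 0" "\<exists>l'. l = (\<chi> i. l')"
    "- (F x + JT x l) \<in> normal_cone X x" "Gs x - z \<in> normal_cone {0..} l"
proof -
  note n' = n[unfolded field_simp normal_cone_S[OF S]]
  have "(- c *\<^sub>R Lap (\<psi>s x + s)) \<bullet> Lap (\<psi>s x + s) = 0" using n' Lap_E_perp by blast
  then show L1: "Lap (\<psi>s x + s) = 0" using c_bound(1) by simp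
  have "Lap l \<bullet> Lap l = 0" using n' Lap_E_perp by blast
  then show L2: "Lap l = 0" by simp
  show "\<exists>l'. l = (\<chi> i. l')"
    using kron_id_laplacian_zero_iff[OF graph_undirected graph_connected, of l] L2 by simp
  obtain v where v: "\<psi>s x + s = (\<chi> i. v)"
    using kron_id_laplacian_zero_iff[OF graph_undirected graph_connected, of "\<psi>s x + s"] L1 by auto
  then show cons: "\<psi>s x + s = (\<chi> i. \<psi> x)" using consensus_value[of s x v] S by (simp add: S_iff)
  have "BT 0 = 0" using adjoint_linear[OF linear_B] by (rule linear_0)
  then have "field_x x s l = - (F x + JT x l)"
    unfolding field_x_def cons F_eq_Ft by (simp add: kron_id_laplacian_consensus)
  then show "- (F x + JT x l) \<in> normal_cone X x" using n' by simp
  show "Gs x - z \<in> normal_cone {0..} l" using n' L2 by simp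
qed

text \<open>Here the normal cones at \<open>u\<close> and at the equilibrium are played against each
  other. What remains after the monotone terms are discarded is strong monotonicity, the error of
  using \<sigma> in place of \<psi>(x), and two Laplacian forms.\<close>

lemma Lyapunov_decay:
  fixes P :: "real^'m^'i \<Rightarrow> real^'m^'i"
  assumes P: "linear P" "\<And>z. z \<in> E_perp \<Longrightarrow> P z \<in> E_perp" "\<And>z. z \<in> E_perp \<Longrightarrow> Lap (P z) = z"
    and p: "(x', s', z', l') \<in> S" "field (x', s', z', l') \<in> normal_cone S (x', s', z', l')"
    and u: "(x, s, z, l) \<in> S" and \<rho>: "0 \<le> \<rho>"
    and n: "\<rho> *\<^sub>R field (x, s, z, l) - (wx, ws, wz, wl) \<in> normal_cone S (x, s, z, l)"
  shows "wx \<bullet> (x - x') + ws \<bullet> (s - s') + wz \<bullet> P (z - z') + wl \<bullet> (l - l')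
     \<le> - (\<rho> * dissip (x', s', z', l') (x, s, z, l))"
proof -
  note eq = equilibriumD[OF p]
  let ?\<sigma> = "\<psi>s x + s" and ?\<sigma>' = "\<psi>s x' + s'"
  let ?b = "?\<sigma> - (\<chi> i. \<psi> x)"
  have uS: "x \<in> X" "s \<in> E_perp" "z \<in> E_perp" "0 \<le> l" and pS: "x' \<in> X" "s' \<in> E_perp" "z' \<in> E_perp" "0 \<le> l'"
    using u p(1) by (auto simp: S_iff)
  have n': "\<rho> *\<^sub>R field_x x s l - wx \<in> normal_cone X x"
    "\<And>y. y \<in> E_perp \<Longrightarrow> (\<rho> *\<^sub>R (- c *\<^sub>R Lap ?\<sigma>) - ws) \<bullet> y = 0"
    "\<And>y. y \<in> E_perp \<Longrightarrow> (\<rho> *\<^sub>R Lap l - wz) \<bullet> y = 0"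
    "\<rho> *\<^sub>R (Gs x - z - Lap l) - wl \<in> normal_cone {0..} l"
    using n unfolding field_simp by (simp_all add: normal_cone_S[OF u])
  have sE: "s - s' \<in> E_perp" and zE: "z - z' \<in> E_perp" using uS pS subspace_diff[OF subspace_E_perp] by auto
  have 1: "wx \<bullet> (x - x') \<le> \<rho> * (field_x x s l \<bullet> (x - x'))"
  proof -
    have "(\<rho> *\<^sub>R field_x x s l - wx) \<bullet> (x' - x) \<le> 0" using n'(1) pS by (auto simp: normal_cone_def)
    then show ?thesis by (simp add: algebra_simps)
  qed
  have 2: "ws \<bullet> (s - s') = \<rho> * (- c * (Lap ?\<sigma> \<bullet> (s - s')))"
    using n'(2)[OF sE] by (simp add: inner_diff_left)
  \<comment> \<open>\<open>P\<close> undoes the Laplacian. The equilibrium multiplier may be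
    inserted because it is in consensus and \<open>z - z'\<close> is orthogonal to consensus; the
    result cancels against the -z of the multiplier equation.\<close>
  have 3: "wz \<bullet> P (z - z') = \<rho> * ((l - l') \<bullet> (z - z'))"
  proof -
    have "wz \<bullet> P (z - z') = \<rho> * (Lap l \<bullet> P (z - z'))" using n'(3)[OF P(2)[OF zE]] by (simp add: inner_diff_left)
    also have "Lap l \<bullet> P (z - z') = l \<bullet> (z - z')" using P(3)[OF zE] by (simp add: Lap_sym[symmetric])
    also have "\<dots> = (l - l') \<bullet> (z - z')"
      using eq(4) E_perp_inner_consensus[OF zE] by (auto simp: inner_diff_left inner_commute)
    finally show ?thesis .
  qed
  have 4: "wl \<bullet> (l - l') \<le> \<rho> * ((Gs x - z - Lap l) \<bullet> (l - l'))"
  proof -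
    have "(\<rho> *\<^sub>R (Gs x - z - Lap l) - wl) \<bullet> (l' - l) \<le> 0" using n'(4) pS by (auto simp: normal_cone_def)
    then show ?thesis by (simp add: algebra_simps)
  qed
  have 5: "- (F x' + JT x' l') \<bullet> (x - x') \<le> 0" using eq(5) uS by (auto simp: normal_cone_def)
  have 6: "(Gs x' - z') \<bullet> (l - l') \<le> 0" using eq(6) uS by (auto simp: normal_cone_def)
  have 7: "(x - x') \<bullet> (- JT x l + JT x' l') + (l - l') \<bullet> (Gs x - Gs x') \<le> 0"
    by (rule constraint_field_monotone[OF uS(4) pS(4)])
  \<comment> \<open>The gain term of the x-equation and the \<varsigma>-equation combine into one
    quadratic form, since \<open>B_diag own M (x - x') + (s - s')\<close> is exactly the difference
    of the \<sigma>-values.\<close>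
  have 8: "BT (Lap ?\<sigma>) \<bullet> (x - x') + Lap ?\<sigma> \<bullet> (s - s') \<ge> \<Lambda>2 * (norm ?b)\<^sup>2"
  proof -
    have "BT (Lap ?\<sigma>) \<bullet> (x - x') = Lap ?\<sigma> \<bullet> B_diag own M (x - x')"
      using adjoint_works[OF linear_B, of "x - x'" "Lap ?\<sigma>"] by (simp add: inner_commute)
    moreover have "B_diag own M (x - x') + (s - s') = ?\<sigma> - ?\<sigma>'"
      by (simp add: \<psi>s_eq linear_diff[OF linear_B])
    ultimately have "BT (Lap ?\<sigma>) \<bullet> (x - x') + Lap ?\<sigma> \<bullet> (s - s') = Lap ?\<sigma> \<bullet> (?\<sigma> - ?\<sigma>')"
      by (simp only: inner_add_right[symmetric])
    also have "\<dots> = Lap ?\<sigma> \<bullet> ?\<sigma>"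
      using Lap_sym[of ?\<sigma> ?\<sigma>'] eq(1) by (simp add: inner_diff_right)
    also have "\<dots> = ?b \<bullet> Lap ?b"
    proof -
      have "(\<chi> i. \<psi> x) \<bullet> Lap ?\<sigma> = 0" using E_perp_inner_consensus[OF Lap_E_perp] by (simp add: inner_commute)
      then show ?thesis by (simp only: Lap_deviation inner_diff_left inner_diff_right inner_commute diff_0_right)
    qed
    also have "\<dots> \<ge> \<Lambda>2 * (norm ?b)\<^sup>2"
      by (rule lambda2_kron_id[OF N_ge_2 graph_undirected graph_connected deviation_E_perp[OF uS(2)]])
    finally show ?thesis .
  qed
  \<comment> \<open>Source of the mixed term of \<open>quad\<close>: \<open>F\<close> is
    \<open>Ft\<close> at consensus, so the gap is governed by the Lipschitz constant in \<sigma>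
    alone.\<close>
  have 9: "- (Ft x ?\<sigma> - F x) \<bullet> (x - x') \<le> \<theta>\<^sub>\<sigma> * norm (x - x') * norm ?b"
  proof -
    have "norm (Ft x ?\<sigma> - F x) \<le> \<theta>\<^sub>\<sigma> * norm ?b"
      using lipschitz_onD[OF Ft_lipschitz_\<sigma>[of x], of ?\<sigma> "\<chi> i. \<psi> x"] by (simp add: dist_norm F_eq_Ft)
    moreover have "- (Ft x ?\<sigma> - F x) \<bullet> (x - x') \<le> norm (Ft x ?\<sigma> - F x) * norm (x - x')"
      by (metis norm_cauchy_schwarz norm_minus_cancel)
    ultimately show ?thesis
      by (smt (verit) mult.commute mult.left_commute mult_left_mono norm_ge_zero)
  qed
  have 10: "l' \<bullet> Lap l = 0" using Lap_sym[of l' l] eq(3) by simp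
  have "wx \<bullet> (x - x') + ws \<bullet> (s - s') + wz \<bullet> P (z - z') + wl \<bullet> (l - l')
     \<le> \<rho> * (field_x x s l \<bullet> (x - x') - c * (Lap ?\<sigma> \<bullet> (s - s')) + (l - l') \<bullet> (z - z') + (Gs x - z - Lap l) \<bullet> (l - l'))"
    using 1 2 3 4 by (simp add: algebra_simps)
  also have "\<dots> \<le> \<rho> * (- dissip (x', s', z', l') (x, s, z, l))"
  proof (rule mult_left_mono[OF _ \<rho>])
    \<comment> \<open>An exact regrouping: the equilibrium terms are added and subtracted so that
      each parenthesis carries one of the estimates above.\<close>
    have "field_x x s l \<bullet> (x - x') - c * (Lap ?\<sigma> \<bullet> (s - s')) + (l - l') \<bullet> (z - z') + (Gs x - z - Lap l) \<bullet> (l - l')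
      = - (Ft x ?\<sigma> - F x) \<bullet> (x - x') - (F x - F x') \<bullet> (x - x')
        + ((x - x') \<bullet> (- JT x l + JT x' l') + (l - l') \<bullet> (Gs x - Gs x'))
        - c * (BT (Lap ?\<sigma>) \<bullet> (x - x') + Lap ?\<sigma> \<bullet> (s - s'))
        + (- (F x' + JT x' l') \<bullet> (x - x')) + (Gs x' - z') \<bullet> (l - l') - l \<bullet> Lap l + l' \<bullet> Lap l"
      by (simp add: field_x_def inner_add_left inner_add_right inner_diff_left inner_diff_right inner_commute algebra_simps)
    also have "\<dots> \<le> \<theta>\<^sub>\<sigma> * norm (x - x') * norm ?b - \<mu> * (norm (x - x'))\<^sup>2 - c * (\<Lambda>2 * (norm ?b)\<^sup>2) - l \<bullet> Lap l"
      using 5 6 7 9 10 F_strongly_monotone[of x x'] mult_left_mono[OF 8, of c] c_bound(1) by linarith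
    also have "\<dots> = - dissip (x', s', z', l') (x, s, z, l)"
      by (simp add: dissip_def quad_def algebra_simps)
    finally show "field_x x s l \<bullet> (x - x') - c * (Lap ?\<sigma> \<bullet> (s - s')) + (l - l') \<bullet> (z - z') + (Gs x - z - Lap l) \<bullet> (l - l')
       \<le> - dissip (x', s', z', l') (x, s, z, l)" .
  qed
  finally show ?thesis by simp
qed

end

section \<open>Regularity of the field, equilibria and the case without dissipation\<close>

context aggregative_dynamics
begin

text \<open>Uniqueness is claimed among all solutions, including any that might leave
  \<open>S\<close>. The angle condition is therefore demanded at every point \<open>p\<close>, and
  it is checked for one component at a time.\<close>

lemma caratheodory_component_invariant:
  fixes h :: "'u::euclidean_space \<Rightarrow> 'v::euclidean_space"
  assumes v: "caratheodory_solution \<Psi> u0 v" and h: "bounded_linear h" and A: "closed A" "convex A"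
    and 0: "h u0 \<in> A" and T: "0 \<le> T"
    and obt: "\<And>p. (h p - closest_point A (h p)) \<bullet> h (\<Psi> p) \<le> 0"
  shows "h (v T) \<in> A"
proof (rule closed_convex_invariant[OF A _ T])
  show "h (v 0) \<in> A" using 0 v by (simp add: caratheodory_solution_def)
  show "abs_cont_on {0..T} (\<lambda>t. h (v t))"
    using v T by (intro abs_cont_on_linear[OF _ h]) (simp add: caratheodory_solution_def)
  have "AE t in lebesgue. 0 \<le> t \<longrightarrow> (v has_vector_derivative \<Psi> (v t)) (at t)"
    using v by (simp add: caratheodory_solution_def)
  then show "AE t in lebesgue. 0 \<le> t \<longrightarrow> (\<exists>w. ((\<lambda>t. h (v t)) has_vector_derivative w) (at t) \<and> (h (v t) - closest_point A (h (v t))) \<bullet> w \<le> 0)"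
  proof eventually_elim
    case (elim t)
    then show ?case using bounded_linear.has_vector_derivative[OF h, of v] obt by blast
  qed
qed

lemma S_components:
  "p \<in> S \<Longrightarrow> fst p \<in> X" "p \<in> S \<Longrightarrow> fst (snd p) \<in> E_perp" "p \<in> S \<Longrightarrow> fst (snd (snd p)) \<in> E_perp"
  "p \<in> S \<Longrightarrow> 0 \<le> snd (snd (snd p))"
  by (simp_all add: state_set_def mem_Times_iff)

lemma field_continuous: "continuous_on A field"
proof -
  have lin: "continuous_on UNIV (Lap :: real^'q^'i \<Rightarrow> real^'q^'i)"
    by (intro linear_continuous_on linear_conv_bounded_linear[THEN iffD1] linear_kron_id)
  have linBT: "continuous_on UNIV BT"
    by (intro linear_continuous_on linear_conv_bounded_linear[THEN iffD1] adjoint_linear linear_B)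
  have linB: "continuous_on UNIV (B_diag own M)"
    by (intro linear_continuous_on linear_conv_bounded_linear[THEN iffD1] linear_B)
  have Ft: "continuous_on UNIV (\<lambda>(x, \<sigma>). Ft x \<sigma>)" by (rule lipschitz_on_continuous_on[OF Ft_lipschitz])
  let ?\<sigma> = "\<lambda>p :: ('n, 'b, 'm, 'i) state. \<psi>s (fst p) + fst (snd p)"
  have \<sigma>: "continuous_on UNIV ?\<sigma>"
    unfolding \<psi>s_eq by (intro continuous_intros continuous_on_compose2[OF linB]) auto
  have L\<sigma>: "continuous_on UNIV (\<lambda>p. Lap (?\<sigma> p))" by (rule continuous_on_compose2[OF lin \<sigma>]) auto
  have 1: "continuous_on UNIV (\<lambda>p. Ft (fst p) (?\<sigma> p))"
    using continuous_on_compose2[OF Ft continuous_on_Pair[OF continuous_on_fst[OF continuous_on_id] \<sigma>]] by simp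
  have 2: "continuous_on UNIV (\<lambda>p :: ('n, 'b, 'm, 'i) state. JT (fst p) (snd (snd (snd p))))"
    using continuous_on_compose2[OF JT_continuous, of UNIV "\<lambda>p. (fst p, snd (snd (snd p)))"]
    by (simp add: continuous_intros)
  have 3: "continuous_on UNIV (\<lambda>p. BT (Lap (?\<sigma> p)))" by (rule continuous_on_compose2[OF linBT L\<sigma>]) auto
  have 4: "continuous_on UNIV (\<lambda>p :: ('n, 'b, 'm, 'i) state. Lap (snd (snd (snd p))))"
    by (rule continuous_on_compose2[OF lin]) (auto intro!: continuous_intros)
  have 5: "continuous_on UNIV (\<lambda>p :: ('n, 'b, 'm, 'i) state. Gs (fst p))"
    by (rule continuous_on_compose2[OF Gs_continuous]) (auto intro!: continuous_intros)
  have "continuous_on UNIV (\<lambda>p. (- Ft (fst p) (?\<sigma> p) - JT (fst p) (snd (snd (snd p))) - c *\<^sub>R BT (Lap (?\<sigma> p)),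
      - c *\<^sub>R Lap (?\<sigma> p), Lap (snd (snd (snd p))), Gs (fst p) - fst (snd (snd p)) - Lap (snd (snd (snd p)))))"
    by (intro continuous_intros 1 2 3 4 5 L\<sigma>)
  then have "continuous_on UNIV field" by (simp add: field_def field_x_def split_def)
  then show ?thesis using continuous_on_subset by blast
qed

text \<open>
  The constraint terms are only locally Lipschitz, but by convexity of \<open>g\<close> they are monotone on \<open>S\<close>, and
  a one-sided bound is all that uniqueness needs.
\<close>

lemma field_one_sided_lipschitz:
  "\<exists>\<kappa>. \<forall>u\<in>S. \<forall>v\<in>S. (field u - field v) \<bullet> (u - v) \<le> \<kappa> * (norm (u - v))\<^sup>2"
proof -
  \<comment> \<open>\<open>T\<close> is the linear part of the pair (x, \<sigma>), the argument of
    the extended pseudo-gradient.\<close>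
  define T :: "('n, 'b, 'm, 'i) state \<Rightarrow> (real^'n) \<times> (real^'b^'i)"
    where "T w = (fst w, B_diag own M (fst w) + fst (snd w))" for w
  define A :: "('n, 'b, 'm, 'i) state \<Rightarrow> ('n, 'b, 'm, 'i) state"
    where "A w = (- c *\<^sub>R BT (Lap (snd (T w))), - c *\<^sub>R Lap (snd (T w)), Lap (snd (snd (snd w))),
        - fst (snd (snd w)) - Lap (snd (snd (snd w))))" for w
  have linT: "linear T"
    unfolding T_def by (intro linearI) (auto simp: linear_add[OF linear_B] linear_scale[OF linear_B] scaleR_add_right)
  have linA: "linear A"
    unfolding A_def
    by (intro linearI)
       (simp_all add: linear_add[OF linT] linear_scale[OF linT] linear_add[OF linear_kron_id] linear_scale[OF linear_kron_id]
         linear_add[OF adjoint_linear[OF linear_B]] linear_scale[OF adjoint_linear[OF linear_B]] algebra_simps)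
  obtain C where C: "C > 0" "\<And>w. norm (A w) \<le> C * norm w" using linear_bounded_pos[OF linA] by blast
  obtain C' where C': "C' > 0" "\<And>w. norm (T w) \<le> C' * norm w" using linear_bounded_pos[OF linT] by blast
  have \<theta>: "\<theta> \<ge> 0" using Ft_lipschitz lipschitz_on_nonneg by blast
  have "(field u - field v) \<bullet> (u - v) \<le> (C + \<theta> * C') * (norm (u - v))\<^sup>2" if uv: "u \<in> S" "v \<in> S" for u v
  proof -
    obtain x s z l where u: "u = (x, s, z, l)" using prod_cases4 by blast
    obtain x' s' z' l' where v: "v = (x', s', z', l')" using prod_cases4 by blast
    have l: "0 \<le> l" "0 \<le> l'" using uv by (auto simp: u v S_iff)
    let ?F = "Ft x (\<psi>s x + s) - Ft x' (\<psi>s x' + s')"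
    have \<sigma>: "(x, \<psi>s x + s) - (x', \<psi>s x' + s') = T (u - v)"
      by (simp add: T_def u v \<psi>s_eq linear_diff[OF linear_B])
    have snd\<sigma>: "snd (T (u - v)) = (\<psi>s x + s) - (\<psi>s x' + s')" using \<sigma> by (metis snd_conv snd_diff)
    \<comment> \<open>The field difference is split into a linear part, a Lipschitz part and the
      constraint part, which is not bounded but monotone.\<close>
    have eq: "field u - field v = A (u - v) + (- ?F, 0, 0, 0) + (- JT x l + JT x' l', 0, 0, Gs x - Gs x')"
      unfolding u v field_simp field_x_def A_def snd\<sigma>[unfolded u v]
      by (simp add: linear_diff[OF linear_kron_id] linear_diff[OF adjoint_linear[OF linear_B]] algebra_simps)
    have "A (u - v) \<bullet> (u - v) \<le> C * norm (u - v) * norm (u - v)"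
      using C(2)[of "u - v"] by (intro order_trans[OF norm_cauchy_schwarz] mult_right_mono) auto
    moreover have "(- ?F, 0, 0, 0) \<bullet> (u - v) \<le> \<theta> * C' * norm (u - v) * norm (u - v)"
    proof -
      have "norm ?F \<le> \<theta> * norm (T (u - v))" using Ft_lip[of x "\<psi>s x + s" x' "\<psi>s x' + s'"] unfolding \<sigma> .
      also have "\<dots> \<le> \<theta> * (C' * norm (u - v))" using C'(2) \<theta> by (intro mult_left_mono) auto
      finally have 1: "norm ?F \<le> \<theta> * C' * norm (u - v)" by (simp add: mult.assoc)
      have "norm (x - x') \<le> norm (u - v)" using norm_fst_le[of "x - x'" "(s - s', z - z', l - l')"] by (simp add: u v)
      have "(- ?F, 0, 0, 0) \<bullet> (u - v) = (- ?F) \<bullet> (x - x')" by (simp add: u v)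
      also have "\<dots> \<le> norm ?F * norm (x - x')" using norm_cauchy_schwarz[of "- ?F" "x - x'"] by (simp only: norm_minus_cancel)
      also have "\<dots> \<le> (\<theta> * C' * norm (u - v)) * norm (u - v)"
        using 1 \<open>norm (x - x') \<le> norm (u - v)\<close> \<theta> C'(1) by (intro mult_mono) auto
      finally show ?thesis .
    qed
    moreover have "(- JT x l + JT x' l', 0, 0, Gs x - Gs x') \<bullet> (u - v) \<le> 0"
      using constraint_field_monotone[OF l, of x x'] by (simp add: u v inner_commute)
    moreover have "(C + \<theta> * C') * (norm (u - v))\<^sup>2 = C * norm (u - v) * norm (u - v) + \<theta> * C' * norm (u - v) * norm (u - v)"
      by (simp add: power2_eq_square algebra_simps)
    ultimately show ?thesis unfolding eq inner_add_left by linarith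
  qed
  then show ?thesis by blast
qed

lemma equilibriumI:
  assumes K: "KKT own \<Omega> g M d f x l"
  obtains s z where "(x, s, z, \<chi> i. l) \<in> S" "field (x, s, z, \<chi> i. l) \<in> normal_cone S (x, s, z, \<chi> i. l)"
proof -
  note k = K[unfolded KKT_iff]
  \<comment> \<open>\<open>s\<close> corrects each local aggregate to the average. \<open>z\<close>
    redistributes the constraint values so that every agent sees the same share, the N-th part of
    \<open>G x\<close>.\<close>
  define s where "s = (\<chi> i. \<psi> x) - \<psi>s x"
  define z where "z = Gs x - (\<chi> i. (1 / real CARD('i)) *\<^sub>R G x)"
  have s: "s \<in> E_perp" using mean_\<psi>s[of x] by (simp add: E_perp_def s_def sum_subtractf sum_constant_scaleR del: sum_constant)
  have z: "z \<in> E_perp" by (simp add: E_perp_def z_def sum_subtractf G_eq_sum sum_constant_scaleR del: sum_constant)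
  have S: "(x, s, z, \<chi> i. l) \<in> S" using k s z by (simp add: S_iff nonneg_stack_iff less_eq_vec_def)
  have \<sigma>: "\<psi>s x + s = (\<chi> i. \<psi> x)" by (simp add: s_def)
  have BT0: "BT 0 = 0" using adjoint_linear[OF linear_B] by (rule linear_0)
  have fx: "field_x x s (\<chi> i. l) = - (F x + JT x (\<chi> i. l))"
    unfolding field_x_def \<sigma> F_eq_Ft by (simp add: kron_id_laplacian_consensus BT0)
  have "Gs x - z \<in> normal_cone {0..} (\<chi> i. l)"
  proof (subst normal_cone_nonneg_stack)
    show "0 \<le> (\<chi> i::'i. l)" using k by (simp add: nonneg_stack_iff less_eq_vec_def)
    have "l $ j * G x $ j = 0" for j
    proof -
      have "(\<Sum>j\<in>UNIV. - (l $ j * G x $ j)) = 0" using k by (simp add: inner_vec_def sum_negf)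
      moreover have "0 \<le> - (l $ j * G x $ j)" for j
        using k by (simp add: less_eq_vec_def mult_nonneg_nonpos)
      ultimately show ?thesis by (simp only: sum_nonneg_eq_0_iff finite) simp
    qed
    then show "\<forall>i j. (Gs x - z) $ i $ j \<le> 0 \<and> (\<chi> i. l) $ i $ j * (Gs x - z) $ i $ j = 0"
      using k by (auto simp: z_def divide_le_0_iff)
  qed
  then have "field (x, s, z, \<chi> i. l) \<in> normal_cone S (x, s, z, \<chi> i. l)"
    unfolding field_simp fx normal_cone_S[OF S] using k by (simp add: \<sigma> kron_id_laplacian_consensus)
  with S show thesis using that by blast
qed

text \<open>Local complementarity adds up to the global one: \<open>z\<close> sums to zero, so
  \<open>G x\<close> is the sum of the local residuals, each nonpositive and complementary to the
  common multiplier.\<close>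

lemma equilibrium_KKT:
  assumes S: "(x, s, z, l) \<in> S" and n: "field (x, s, z, l) \<in> normal_cone S (x, s, z, l)"
  obtains l' where "l = (\<chi> i. l')" "KKT own \<Omega> g M d f x l'" "dyn (x, s, z, l) = 0"
proof -
  note e = equilibriumD[OF S n]
  obtain l' where l': "l = (\<chi> i. l')" using e(4) by blast
  have uS: "x \<in> X" "z \<in> E_perp" "0 \<le> l" using S by (auto simp: S_iff)
  have l0: "0 \<le> l'" using uS(3) unfolding l' by (simp add: nonneg_stack_iff less_eq_vec_def)
  have v: "(Gs x - z) $ i $ j \<le> 0" "l' $ j * (Gs x - z) $ i $ j = 0" for i j
    using e(6) unfolding normal_cone_nonneg_stack[OF uS(3)] unfolding l' by auto
  have G: "G x $ j = (\<Sum>i\<in>UNIV. (Gs x - z) $ i $ j)" for j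
  proof -
    have "G x = (\<Sum>i\<in>UNIV. (Gs x - z) $ i)"
      using uS(2) by (simp add: G_eq_sum sum_subtractf E_perp_def)
    then show ?thesis by simp
  qed
  have "G x $ j \<le> 0" for j unfolding G by (intro sum_nonpos v)
  moreover have "l' \<bullet> G x = 0"
  proof -
    have "l' $ j * G x $ j = 0" for j unfolding G sum_distrib_left by (intro sum.neutral ballI v)
    then show ?thesis unfolding inner_vec_def inner_real_def by (intro sum.neutral ballI)
  qed
  ultimately have K: "KKT own \<Omega> g M d f x l'"
    using e(5) uS(1) l0 unfolding KKT_iff l' by blast
  have n': "field_x x s l \<in> normal_cone X x" "Gs x - z - Lap l \<in> normal_cone {0..} l"
    using n unfolding field_simp normal_cone_S[OF S] by auto
  have "dyn (x, s, z, l) = 0"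
    unfolding dyn_simp using e(1,3) proj_vf_eq_0_iff[OF X_convex uS(1)] n'(1)
      proj_vf_eq_0_iff[OF nonneg_stack_convex, of l] uS(3) n'(2) by (simp add: zero_prod_def)
  with l' K show thesis using that by blast
qed

text \<open>With x, \<varsigma> and z frozen and the multipliers in consensus, each multiplier
  component moves on the half-line under a constant drift. A positive drift would contradict
  boundedness, so the component decreases and is bounded below by 0.\<close>

lemma zero_dissipation_converges:
  fixes u :: "real \<Rightarrow> ('n, 'b, 'm, 'i) state"
  assumes u: "proj_solution S field u" and bdd: "bounded (u ` {0..})"
    and D: "\<And>t. 0 \<le> t \<Longrightarrow> dissip p (u t) = 0"
  shows "\<exists>q. (u \<longlongrightarrow> q) at_top"
proof -
  define xx where "xx = fst p"
  define ss where "ss = (\<chi> i. \<psi> xx) - \<psi>s xx"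
  define zz where "zz = fst (snd (snd (u 0)))"
  define l where "l t = snd (snd (snd (u t)))" for t
  have uS: "u t \<in> S" if "0 \<le> t" for t using u that by (simp add: proj_solution_def)
  have D': "fst (u t) = xx" "fst (snd (u t)) = ss" "Lap (l t) = 0" if t: "0 \<le> t" for t
  proof -
    let ?a = "norm (fst (u t) - fst p)" and ?b = "norm (\<psi>s (fst (u t)) + fst (snd (u t)) - (\<chi> i. \<psi> (fst (u t))))"
    have "quad ?a ?b + l t \<bullet> Lap (l t) = 0" using D[OF t] by (simp add: dissip_def l_def)
    then have "quad ?a ?b = 0" "l t \<bullet> Lap (l t) = 0" using quad_nonneg[of ?a ?b] Lap_nonneg[of "l t"] by linarith+
    then show x: "fst (u t) = xx" and "Lap (l t) = 0"
      using quad_zero[of ?a ?b] kron_id_laplacian_zero_iff[OF graph_undirected graph_connected, of "l t"]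
      by (auto simp: xx_def kron_id_laplacian_consensus)
    have "\<psi>s (fst (u t)) + fst (snd (u t)) = (\<chi> i. \<psi> (fst (u t)))"
    proof -
      have "?b = 0" using quad_zero[OF \<open>quad ?a ?b = 0\<close>] by blast
      then show ?thesis by (simp only: norm_eq_zero right_minus_eq)
    qed
    then show "fst (snd (u t)) = ss" unfolding x ss_def by (simp add: eq_diff_eq add.commute)
  qed
  have der: "AE t in lebesgue. 0 < t \<longrightarrow> (\<exists>w. (u has_vector_derivative w) (at t) \<and> field (u t) - w \<in> normal_cone S (u t))"
    using u by (simp add: proj_solution_def)
  have ac: "abs_cont_on {0..T} u" if "0 \<le> T" for T using u that by (simp add: proj_solution_def)
  have n: "(\<forall>y\<in>E_perp. fst (snd (snd w)) \<bullet> y = 0) \<and>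
       Gs xx - fst (snd (snd (u t))) - snd (snd (snd w)) \<in> normal_cone {0..} (l t)"
    if t: "0 < t" and "field (u t) - w \<in> normal_cone S (u t)" for t w
  proof -
    obtain x s z l' where ut: "u t = (x, s, z, l')" using prod_cases4 by blast
    obtain wx ws wz wl where w: "w = (wx, ws, wz, wl)" using prod_cases4 by blast
    have "Lap l' = 0" "x = xx" "l t = l'" using D'[of t] t ut by (auto simp: l_def)
    then show ?thesis using that(2) uS[of t] t unfolding ut w field_simp
      by (simp add: normal_cone_S)
  qed
  \<comment> \<open>A degenerate weight that sees only the z-component: its form has zero
    derivative, since the z-velocity is orthogonal to \<open>E_perp\<close> while z - z(0) lies in
    it.\<close>
  define Q :: "('n, 'b, 'm, 'i) state \<Rightarrow> ('n, 'b, 'm, 'i) state"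
    where "Q w = (0, 0, fst (snd (snd w)), 0)" for w
  have Q: "linear Q" "\<And>x y. Q x \<bullet> y = x \<bullet> Q y"
    unfolding Q_def by (auto intro!: linearI simp: inner_prod_def)
  have zconst: "fst (snd (snd (u t))) = zz" if t: "0 \<le> t" for t
  proof -
    have "(u t - u 0) \<bullet> Q (u t - u 0) + 2 * 0 * (t - 0) \<le> (u 0 - u 0) \<bullet> Q (u 0 - u 0)"
    proof (rule quadratic_nonincreasing[OF ac Q order_refl t])
      show "AE s in lebesgue. 0 < s \<longrightarrow> 0 \<le> s \<longrightarrow> s \<le> t \<longrightarrow> (\<exists>w. (u has_vector_derivative w) (at s) \<and> w \<bullet> Q (u s - u 0) \<le> - 0)"
        using der
      proof eventually_elim
        case (elim s)
        show ?case
        proof (intro impI)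
          assume s: "0 < s"
          with elim obtain w where w: "(u has_vector_derivative w) (at s)" "field (u s) - w \<in> normal_cone S (u s)" by blast
          have "fst (snd (snd (u s - u 0))) \<in> E_perp"
            using uS[of s] uS[of 0] s subspace_diff[OF subspace_E_perp] by (auto simp: state_set_def)
          then have "w \<bullet> Q (u s - u 0) = 0" using n[OF s w(2)] by (simp add: Q_def inner_prod_def)
          with w(1) show "\<exists>w. (u has_vector_derivative w) (at s) \<and> w \<bullet> Q (u s - u 0) \<le> - 0"
            by (intro exI[of _ w]) simp
        qed
      qed
    qed
    then have "(norm (fst (snd (snd (u t - u 0)))))\<^sup>2 \<le> 0" by (simp add: Q_def inner_prod_def power2_norm_eq_inner)
    then show ?thesis by (simp add: zz_def)
  qed
  define b where "b = Gs xx - zz"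
  have lpos: "0 \<le> l t $ i $ j" if "0 \<le> t" for t i j
    using uS[OF that] by (auto simp: state_set_def l_def nonneg_stack_iff)
  have lconv: "\<exists>a. ((\<lambda>t. l t $ i $ j) \<longlongrightarrow> a) at_top" for i j
  proof -
    have bl: "bounded_linear (\<lambda>w :: ('n, 'b, 'm, 'i) state. snd (snd (snd w)) $ i $ j)"
      by (intro bounded_linear_compose[OF bounded_linear_vec_nth[of j]]
          bounded_linear_compose[OF bounded_linear_vec_nth[of i]] bounded_linear_components)
    have hac: "abs_cont_on {0..T} (\<lambda>t. l t $ i $ j)" if "0 \<le> T" for T
      using abs_cont_on_linear[OF ac[OF that] bl] by (simp add: l_def)
    have hder: "AE t in lebesgue. 0 < t \<longrightarrow> (\<exists>w. ((\<lambda>t. l t $ i $ j) has_real_derivative w) (at t)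
        \<and> b $ i $ j - w \<le> 0 \<and> l t $ i $ j * (b $ i $ j - w) = 0)"
      using der
    proof eventually_elim
      case (elim t)
      show ?case
      proof
        assume t: "0 < t"
        with elim obtain w where w: "(u has_vector_derivative w) (at t)" "field (u t) - w \<in> normal_cone S (u t)" by blast
        have "((\<lambda>t. l t $ i $ j) has_real_derivative snd (snd (snd w)) $ i $ j) (at t)"
          using bounded_linear.has_vector_derivative[OF bl w(1)]
          by (simp add: l_def has_real_derivative_iff_has_vector_derivative)
        moreover have "b - snd (snd (snd w)) \<in> normal_cone {0..} (l t)"
          using n[OF t w(2)] zconst[of t] t by (simp add: b_def)
        moreover have "0 \<le> l t" using lpos t by (simp add: nonneg_stack_iff)
        ultimately show "\<exists>w. ((\<lambda>t. l t $ i $ j) has_real_derivative w) (at t)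
            \<and> b $ i $ j - w \<le> 0 \<and> l t $ i $ j * (b $ i $ j - w) = 0"
          by (auto simp: normal_cone_nonneg_stack)
      qed
    qed
    have bij: "b $ i $ j \<le> 0"
    proof (rule ccontr)
      assume "\<not> b $ i $ j \<le> 0"
      then have bpos: "b $ i $ j > 0" by simp
      have grow: "b $ i $ j * t \<le> l t $ i $ j" if t: "0 \<le> t" for t
      proof -
        have "(\<lambda>t. (b $ i $ j) * t - l t $ i $ j) t \<le> (\<lambda>t. (b $ i $ j) * t - l t $ i $ j) 0"
        proof (rule abs_cont_on_nonincreasing[OF _ t])
          show "abs_cont_on {0..t} (\<lambda>t. (b $ i $ j) * t - l t $ i $ j)"
            by (intro abs_cont_on_diff hac t abs_cont_on_linear[OF abs_cont_on_id bounded_linear_mult_right])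
          show "AE s in lebesgue. 0 \<le> s \<and> s \<le> t \<longrightarrow> (\<exists>D\<le>0. ((\<lambda>t. (b $ i $ j) * t - l t $ i $ j) has_real_derivative D) (at s))"
            using AE_pos_imp_nonneg[OF hder]
          proof eventually_elim
            case (elim s)
            show ?case
            proof
              assume "0 \<le> s \<and> s \<le> t"
              with elim obtain w where "((\<lambda>t. l t $ i $ j) has_real_derivative w) (at s)" "b $ i $ j - w \<le> 0" by blast
              then show "\<exists>D\<le>0. ((\<lambda>t. (b $ i $ j) * t - l t $ i $ j) has_real_derivative D) (at s)"
                by (intro exI[of _ "b $ i $ j - w"]) (auto intro!: derivative_eq_intros)
            qed
          qed
        qed
        then show ?thesis using lpos[of 0 i j] by simp
      qed
      obtain C where C: "\<And>t. 0 \<le> t \<Longrightarrow> norm (u t) \<le> C" using bdd by (auto simp: bounded_iff)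
      have lC: "l t $ i $ j \<le> C" if "0 \<le> t" for t
      proof -
        have "l t $ i $ j \<le> norm (l t $ i)" using component_le_norm_cart[of "l t $ i" j] by linarith
        also have "\<dots> \<le> norm (l t)" by (rule Finite_Cartesian_Product.norm_nth_le)
        also have "\<dots> \<le> norm (u t)"
        proof -
          obtain x s z l' where ut: "u t = (x, s, z, l')" using prod_cases4 by blast
          show ?thesis unfolding l_def ut snd_conv
            by (rule order_trans[OF norm_snd_le order_trans[OF norm_snd_le norm_snd_le]])
        qed
        finally show ?thesis using C[OF that] by linarith
      qed
      have "0 \<le> C" using C[of 0] norm_ge_zero order_trans by blast
      \<comment> \<open>The time at which linear growth would reach C + 1.\<close>
      then have "b $ i $ j * ((C + 1) / b $ i $ j) \<le> C" using grow[of "(C + 1) / b $ i $ j"] lC[of "(C + 1) / b $ i $ j"] bpos by simp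
      then show False using bpos by simp
    qed
    show ?thesis
    proof (rule tendsto_at_top_decreasing)
      fix s t :: real assume st: "0 \<le> s" "s \<le> t"
      show "l t $ i $ j \<le> l s $ i $ j"
      proof (rule abs_cont_on_nonincreasing[OF _ st(2)])
        show "abs_cont_on {s..t} (\<lambda>t. l t $ i $ j)" using abs_cont_on_subset[OF hac[of t]] st by auto
        show "AE r in lebesgue. s \<le> r \<and> r \<le> t \<longrightarrow> (\<exists>D\<le>0. ((\<lambda>t. l t $ i $ j) has_real_derivative D) (at r))"
        proof -
          have "AE r in lebesgue. 0 < r \<longrightarrow> (\<exists>D\<le>0. ((\<lambda>t. l t $ i $ j) has_real_derivative D) (at r))"
            using hder
          proof eventually_elim
            case (elim r)
            show ?case
            proof
              assume r: "0 < r"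
              with elim obtain w where w: "((\<lambda>t. l t $ i $ j) has_real_derivative w) (at r)"
                "b $ i $ j - w \<le> 0" "l r $ i $ j * (b $ i $ j - w) = 0" by blast
              \<comment> \<open>At value 0 the component has a minimum in time, so its derivative
                vanishes; at a positive value complementarity makes the derivative equal to the
                drift.\<close>
              have "w \<le> 0"
              proof (cases "l r $ i $ j = 0")
                case True
                have "w = 0"
                  by (rule DERIV_local_min[OF w(1) r]) (use lpos True in auto)
                then show ?thesis by simp
              next
                case False
                then show ?thesis using w(3) bij by simp
              qed
              with w(1) show "\<exists>D\<le>0. ((\<lambda>t. l t $ i $ j) has_real_derivative D) (at r)" by blast
            qed
          qed
          from AE_pos_imp_nonneg[OF this] show ?thesis by eventually_elim (use st in auto)
        qed
      qed
    qed (rule lpos)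
  qed
  then obtain a where a: "\<And>i j. ((\<lambda>t. l t $ i $ j) \<longlongrightarrow> a i j) at_top" by metis
  have "(l \<longlongrightarrow> (\<chi> i j. a i j)) at_top"
    by (intro vec_tendstoI) (simp add: a)
  then have "((\<lambda>t. (xx, ss, zz, l t)) \<longlongrightarrow> (xx, ss, zz, \<chi> i j. a i j)) at_top" by (intro tendsto_intros)
  then have "(u \<longlongrightarrow> (xx, ss, zz, \<chi> i j. a i j)) at_top"
  proof (rule Lim_transform_eventually)
    show "\<forall>\<^sub>F t in at_top. (xx, ss, zz, l t) = u t"
      using eventually_ge_at_top[of 0]
    proof eventually_elim
      case (elim t)
      show ?case using D'(1,2)[OF elim] zconst[OF elim] by (simp add: l_def prod_eq_iff)
    qed
  qed
  then show ?thesis by blast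
qed

text \<open>Invariance of \<open>S\<close> is the substance: at points of \<open>S\<close>, the
  residual of the projection is normal by Moreau's decomposition.\<close>

lemma caratheodory_imp_proj_solution:
  assumes v: "caratheodory_solution dyn u0 v" and u0: "u0 \<in> S"
  shows "proj_solution S field v"
proof -
  have v0: "v 0 = u0" and ac: "\<And>T. 0 \<le> T \<Longrightarrow> abs_cont_on {0..T} v"
    and der: "AE t in lebesgue. 0 \<le> t \<longrightarrow> (v has_vector_derivative dyn (v t)) (at t)"
    using v by (auto simp: caratheodory_solution_def)
  have vS: "v t \<in> S" if t: "0 \<le> t" for t
  proof -
    have "fst (v t) \<in> X"
    proof (rule caratheodory_component_invariant[OF v bounded_linear_components(1) X_closed X_convex _ t])
      show "fst u0 \<in> X" using u0 by (auto simp: state_set_def)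
      fix p :: "('n, 'b, 'm, 'i) state"
      obtain x s z l where p: "p = (x, s, z, l)" using prod_cases4 by blast
      show "(fst p - closest_point X (fst p)) \<bullet> fst (dyn p) \<le> 0"
        unfolding p dyn_simp
        using closest_point_obtuse[OF X_convex X_closed X_nonempty proj_vf_in_tangent_cone[OF X_nonempty]] by simp
    qed
    moreover have "fst (snd (v t)) \<in> E_perp"
    proof (rule caratheodory_component_invariant[OF v bounded_linear_components(2) closed_subspace[OF subspace_E_perp] subspace_imp_convex[OF subspace_E_perp] _ t])
      show "fst (snd u0) \<in> E_perp" using u0 by (auto simp: state_set_def)
      fix p :: "('n, 'b, 'm, 'i) state"
      obtain x s z l where p: "p = (x, s, z, l)" using prod_cases4 by blast
      have "(s - closest_point E_perp s) \<bullet> (- c *\<^sub>R Lap (\<psi>s x + s)) = 0"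
        by (intro closest_point_subspace_orthogonal subspace_E_perp subspace_scale[OF subspace_E_perp] Lap_E_perp)
      then show "(fst (snd p) - closest_point E_perp (fst (snd p))) \<bullet> fst (snd (dyn p)) \<le> 0"
        unfolding p dyn_simp fst_conv snd_conv by (rule eq_refl)
    qed
    moreover have "fst (snd (snd (v t))) \<in> E_perp"
    proof (rule caratheodory_component_invariant[OF v bounded_linear_components(3) closed_subspace[OF subspace_E_perp] subspace_imp_convex[OF subspace_E_perp] _ t])
      show "fst (snd (snd u0)) \<in> E_perp" using u0 by (auto simp: state_set_def)
      fix p :: "('n, 'b, 'm, 'i) state"
      obtain x s z l where p: "p = (x, s, z, l)" using prod_cases4 by blast
      have "(z - closest_point E_perp z) \<bullet> Lap l = 0"
        by (intro closest_point_subspace_orthogonal subspace_E_perp Lap_E_perp)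
      then show "(fst (snd (snd p)) - closest_point E_perp (fst (snd (snd p)))) \<bullet> fst (snd (snd (dyn p))) \<le> 0"
        unfolding p dyn_simp fst_conv snd_conv by (rule eq_refl)
    qed
    moreover have "snd (snd (snd (v t))) \<in> {0..}"
    proof (rule caratheodory_component_invariant[OF v bounded_linear_components(4) nonneg_stack_closed nonneg_stack_convex _ t])
      show "snd (snd (snd u0)) \<in> {0..}" using u0 by (auto simp: state_set_def)
      fix p :: "('n, 'b, 'm, 'i) state"
      obtain x s z l where p: "p = (x, s, z, l)" using prod_cases4 by blast
      have ne: "{0 :: real^'m^'i..} \<noteq> {}" by blast
      show "(snd (snd (snd p)) - closest_point {0..} (snd (snd (snd p)))) \<bullet> snd (snd (snd (dyn p))) \<le> 0"
        unfolding p dyn_simp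
        using closest_point_obtuse[OF nonneg_stack_convex nonneg_stack_closed ne proj_vf_in_tangent_cone[OF ne]] by simp
    qed
    ultimately show ?thesis by (simp add: state_set_def mem_Times_iff)
  qed
  have "field p - dyn p \<in> normal_cone S p" if pS: "p \<in> S" for p
  proof -
    obtain x s z l where p: "p = (x, s, z, l)" using prod_cases4 by blast
    have "x \<in> X" "0 \<le> l" using pS by (auto simp: p S_iff)
    then show ?thesis
      unfolding p field_simp dyn_simp using pS
      by (simp add: p normal_cone_S proj_vf_residual_normal[OF X_convex] proj_vf_residual_normal[OF nonneg_stack_convex])
  qed
  then have n: "field (v t) - dyn (v t) \<in> normal_cone S (v t)" if "0 < t" for t using vS that by simp
  have "AE t in lebesgue. 0 < t \<longrightarrow> (\<exists>w. (v has_vector_derivative w) (at t) \<and> field (v t) - w \<in> normal_cone S (v t))"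
    using der
  proof eventually_elim
    case (elim t)
    show ?case using elim n[of t] by (intro impI exI[of _ "dyn (v t)"]) simp
  qed
  with vS ac show ?thesis by (simp add: proj_solution_def)
qed

text \<open>Normality of the residual splits over the four factors; in each factor a curve that
  stays in its set has the projected velocity. On the subspace factors the projection is the
  identity.\<close>

lemma proj_solution_imp_caratheodory:
  assumes u: "proj_solution S field u"
  shows "caratheodory_solution dyn (u 0) u"
proof -
  have uS: "u t \<in> S" if "0 \<le> t" for t using u that by (simp add: proj_solution_def)
  have "AE t in lebesgue. 0 < t \<longrightarrow> (\<exists>w. (u has_vector_derivative w) (at t) \<and> field (u t) - w \<in> normal_cone S (u t))"
    using u by (simp add: proj_solution_def)
  then have "AE t in lebesgue. 0 < t \<longrightarrow> (u has_vector_derivative dyn (u t)) (at t)"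
  proof eventually_elim
    case (elim t)
    show ?case
    proof
      assume t: "0 < t"
      with elim obtain w where w: "(u has_vector_derivative w) (at t)" "field (u t) - w \<in> normal_cone S (u t)" by blast
      obtain x s z l where ut: "u t = (x, s, z, l)" using prod_cases4 by blast
      obtain wx ws wz wl where we: "w = (wx, ws, wz, wl)" using prod_cases4 by blast
      have pS: "(x, s, z, l) \<in> S" using uS[of t] t ut by simp
      have n: "field_x x s l - wx \<in> normal_cone X x" "- c *\<^sub>R Lap (\<psi>s x + s) - ws \<in> normal_cone E_perp s"
        "Lap l - wz \<in> normal_cone E_perp z" "Gs x - z - Lap l - wl \<in> normal_cone {0..} l"
        using w(2) pS unfolding ut we field_simp
        by (simp_all add: normal_cone_S[OF pS] normal_cone_subspace[OF subspace_E_perp] S_iff)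
      have d: "((\<lambda>t. h (u t)) has_vector_derivative h w) (at t)" if "bounded_linear h"
        for h :: "('n, 'b, 'm, 'i) state \<Rightarrow> 'z::euclidean_space"
        by (rule bounded_linear.has_vector_derivative[OF that w(1)])
      have 1: "proj_vf X x (field_x x s l) = wx"
      proof -
        have "proj_vf X (fst (u t)) (field_x x s l) = wx"
        proof (rule proj_vf_of_curve[OF X_convex _ t])
          show "((\<lambda>t. fst (u t)) has_vector_derivative wx) (at t)" using d[OF bounded_linear_components(1)] by (simp add: we)
        qed (use S_components[OF uS] n ut in simp_all)
        then show ?thesis by (simp add: ut)
      qed
      have 2: "- c *\<^sub>R Lap (\<psi>s x + s) = ws"
      proof -
        have "proj_vf E_perp (fst (snd (u t))) (- c *\<^sub>R Lap (\<psi>s x + s)) = ws"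
        proof (rule proj_vf_of_curve[OF subspace_imp_convex[OF subspace_E_perp] _ t])
          from d[OF bounded_linear_components(2)] show "((\<lambda>t. fst (snd (u t))) has_vector_derivative ws) (at t)" by (simp add: we)
        qed (use S_components[OF uS] n ut in simp_all)
        moreover have "proj_vf E_perp s (- c *\<^sub>R Lap (\<psi>s x + s)) = - c *\<^sub>R Lap (\<psi>s x + s)"
          using pS by (intro proj_vf_subspace subspace_E_perp subspace_scale[OF subspace_E_perp] Lap_E_perp) (simp add: S_iff)
        ultimately show ?thesis by (simp add: ut)
      qed
      have 3: "Lap l = wz"
      proof -
        have "proj_vf E_perp (fst (snd (snd (u t)))) (Lap l) = wz"
        proof (rule proj_vf_of_curve[OF subspace_imp_convex[OF subspace_E_perp] _ t])
          from d[OF bounded_linear_components(3)] show "((\<lambda>t. fst (snd (snd (u t)))) has_vector_derivative wz) (at t)" by (simp add: we)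
        qed (use S_components[OF uS] n ut in simp_all)
        moreover have "proj_vf E_perp z (Lap l) = Lap l"
          using pS by (intro proj_vf_subspace subspace_E_perp Lap_E_perp) (simp add: S_iff)
        ultimately show ?thesis by (simp add: ut)
      qed
      have 4: "proj_vf {0..} l (Gs x - z - Lap l) = wl"
      proof -
        have "proj_vf {0..} (snd (snd (snd (u t)))) (Gs x - z - Lap l) = wl"
        proof (rule proj_vf_of_curve[OF nonneg_stack_convex _ t])
          from d[OF bounded_linear_components(4)] show "((\<lambda>t. snd (snd (snd (u t)))) has_vector_derivative wl) (at t)" by (simp add: we)
        qed (use S_components[OF uS] n ut in simp_all)
        then show ?thesis by (simp add: ut)
      qed
      have "dyn (u t) = w" unfolding ut dyn_simp we using 1 2 3 4 by simp
      with w(1) show "(u has_vector_derivative dyn (u t)) (at t)" by simp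
    qed
  qed
  from AE_pos_imp_nonneg[OF this] u show ?thesis by (simp add: caratheodory_solution_def proj_solution_def)
qed

theorem solution_exists_unique_converges:
  assumes init: "u0 \<in> S"
  shows "\<exists>u. caratheodory_solution dyn u0 u \<and>
             (\<forall>v. caratheodory_solution dyn u0 v \<longrightarrow> (\<forall>t\<ge>0. v t = u t)) \<and>
             (\<forall>t\<ge>0. u t \<in> S) \<and>
             (\<exists>x s z l l'.
                (u \<longlongrightarrow> (x, s, z, l)) at_top \<and>
                dyn (x, s, z, l) = 0 \<and>
                \<psi>s x + s = (\<chi> i. \<psi> x) \<and>
                l = (\<chi> i. l') \<and>
                KKT own \<Omega> g M d f x l' \<and>
                is_vGNE own \<Omega> g M d f x \<and>
                (\<forall>y. is_vGNE own \<Omega> g M d f y \<longrightarrow> y = x))"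
proof -
  obtain P :: "real^'m^'i \<Rightarrow> real^'m^'i" and k where P: "linear P" "\<And>z. z \<in> E_perp \<Longrightarrow> P z \<in> E_perp"
    "\<And>z. z \<in> E_perp \<Longrightarrow> Lap (P z) = z" "\<And>z z'. P z \<bullet> z' = z \<bullet> P z'" "k > 0"
    "\<And>z. z \<in> E_perp \<Longrightarrow> k * (norm z)\<^sup>2 \<le> z \<bullet> P z"
    using laplacian_inverse_on_E_perp[OF N_ge_2 graph_undirected graph_connected, where 'q='m] by metis
  \<comment> \<open>The Lyapunov weight: identity on all components except z, where it is the
    inverse of the Laplacian.\<close>
  define Q :: "('n, 'b, 'm, 'i) state \<Rightarrow> ('n, 'b, 'm, 'i) state"
    where "Q w = (fst w, fst (snd w), P (fst (snd (snd w))), snd (snd (snd w)))" for w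
  obtain \<kappa> where \<kappa>: "\<And>u v. u \<in> S \<Longrightarrow> v \<in> S \<Longrightarrow> (field u - field v) \<bullet> (u - v) \<le> \<kappa> * (norm (u - v))\<^sup>2"
    using field_one_sided_lipschitz by blast
  \<comment> \<open>The constant \<open>min 1 k\<close> combines the identity on three components
    with the coercivity \<open>k\<close> of \<open>P\<close> on \<open>E_perp\<close>, to which the
    z-differences of points of \<open>S\<close> belong.\<close>
  interpret proj_lyapunov S field Q dissip \<kappa> "min 1 k"
  proof (rule proj_lyapunov.intro)
    show "linear Q" unfolding Q_def by (intro linearI) (auto simp: linear_add[OF P(1)] linear_scale[OF P(1)])
    show "Q x \<bullet> y = x \<bullet> Q y" for x y by (simp add: Q_def inner_prod_def P(4))
    show "0 < min 1 k" using P(5) by simp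
    show "min 1 k * (norm (x - y))\<^sup>2 \<le> (x - y) \<bullet> Q (x - y)" if "x \<in> S" "y \<in> S" for x y
    proof -
      obtain a1 a2 a3 a4 where a: "x - y = (a1, a2, a3, a4)" using prod_cases4 by blast
      have "a3 = fst (snd (snd x)) - fst (snd (snd y))" using a by (metis fst_conv fst_diff snd_conv snd_diff)
      then have "a3 \<in> E_perp" using that subspace_diff[OF subspace_E_perp] by (auto simp: state_set_def)
      then have "k * (norm a3)\<^sup>2 \<le> a3 \<bullet> P a3" by (rule P(6))
      moreover have "min 1 k * (norm a3)\<^sup>2 \<le> k * (norm a3)\<^sup>2" "min 1 k * (norm a1)\<^sup>2 \<le> 1 * (norm a1)\<^sup>2"
        "min 1 k * (norm a2)\<^sup>2 \<le> 1 * (norm a2)\<^sup>2" "min 1 k * (norm a4)\<^sup>2 \<le> 1 * (norm a4)\<^sup>2"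
        by (intro mult_right_mono; simp)+
      moreover have "(norm (a1, a2, a3, a4))\<^sup>2 = (norm a1)\<^sup>2 + ((norm a2)\<^sup>2 + ((norm a3)\<^sup>2 + (norm a4)\<^sup>2))"
        by (simp add: norm_Pair)
      ultimately show ?thesis unfolding a Q_def by (simp add: power2_norm_eq_inner algebra_simps)
    qed
    show "continuous_on S (dissip p)" for p
    proof -
      have lin: "continuous_on UNIV (Lap :: real^'m^'i \<Rightarrow> real^'m^'i)" "continuous_on UNIV (B_diag own M)"
        by (intro linear_continuous_on linear_conv_bounded_linear[THEN iffD1] linear_kron_id linear_B)+
      have \<psi>: "continuous_on UNIV \<psi>" using \<psi>_deriv by (meson continuous_at_imp_continuous_on has_derivative_continuous)
      show ?thesis
        unfolding dissip_def quad_def \<psi>s_eq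
        by (intro continuous_intros continuous_on_compose2[OF lin(1)] continuous_on_compose2[OF lin(2)] continuous_on_compose2[OF \<psi>]) auto
    qed
    show "\<exists>p\<in>S. field p \<in> normal_cone S p"
    proof -
      obtain x l where "KKT own \<Omega> g M d f x l" using KKT_exists by blast
      from equilibriumI[OF this] show ?thesis by metis
    qed
    show "w \<bullet> Q (u - p) \<le> - (\<rho> * dissip p u)"
      if "p \<in> S" "field p \<in> normal_cone S p" "u \<in> S" "0 \<le> \<rho>" "\<rho> *\<^sub>R field u - w \<in> normal_cone S u" for p u w \<rho>
    proof -
      obtain x s z l where u: "u = (x, s, z, l)" using prod_cases4 by blast
      obtain x' s' z' l' where p: "p = (x', s', z', l')" using prod_cases4 by blast
      obtain wx ws wz wl where w: "w = (wx, ws, wz, wl)" using prod_cases4 by blast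
      show ?thesis using Lyapunov_decay[OF P(1-3), of x' s' z' l' x s z l \<rho> wx ws wz wl] that
        unfolding u p w Q_def by (simp add: add.assoc)
    qed
    show "\<exists>q. (u \<longlongrightarrow> q) at_top"
      if "proj_solution S field u" "bounded (u ` {0..})" "\<And>t. 0 \<le> t \<Longrightarrow> dissip p (u t) = 0" for p u
      using zero_dissipation_converges[OF that] .
    show "0 \<le> dissip p u" for p u by (rule dissip_nonneg)
  qed (fact S_closed S_convex field_continuous \<kappa>)+
  obtain u where u: "u 0 = u0" "proj_solution S field u" using proj_solution_exists[OF init] by blast
  obtain q where q: "q \<in> S" "field q \<in> normal_cone S q" "(u \<longlongrightarrow> q) at_top" using proj_solution_converges[OF u(2)] by blast
  obtain x s z l where qe: "q = (x, s, z, l)" using prod_cases4 by blast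
  note qS = q(1,2)[unfolded qe]
  obtain l' where l': "l = (\<chi> i. l')" "KKT own \<Omega> g M d f x l'" "dyn (x, s, z, l) = 0"
    using equilibrium_KKT[OF qS] by blast
  have "caratheodory_solution dyn u0 u" using proj_solution_imp_caratheodory[OF u(2)] u(1) by simp
  moreover have "v t = u t" if "caratheodory_solution dyn u0 v" "0 \<le> t" for v t
  proof -
    have "v 0 = u0" using that(1) by (simp add: caratheodory_solution_def)
    then show ?thesis
      \<comment> \<open>With equal initial values the exponential bound on the distance is
        0.\<close>
      using proj_solution_distance[OF \<kappa> caratheodory_imp_proj_solution[OF that(1) init] u(2) that(2)] u(1) by simp
  qed
  moreover have "\<forall>t\<ge>0. u t \<in> S" using u(2) by (simp add: proj_solution_def)
  moreover have "\<psi>s x + s = (\<chi> i. \<psi> x)" by (rule equilibriumD(2)[OF qS])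
  moreover have "is_vGNE own \<Omega> g M d f x" by (rule KKT_imp_vGNE[OF l'(2)])
  moreover have "y = x" if "is_vGNE own \<Omega> g M d f y" for y
    using that KKT_unique[OF l'(2)] by (auto simp: is_vGNE_def)
  ultimately show ?thesis using q(3) l' unfolding qe by blast
qed

end

lemma C2_imp_C1:
  assumes "C2 h"
  shows "C1 h"
proof -
  obtain h' where h': "\<And>x. (h has_derivative blinfun_apply (h' x)) (at x)" "C1 h'"
    using assms by (auto simp: C2_def)
  then have "continuous_on UNIV h'"
    unfolding C1_def by (meson continuous_at_imp_continuous_on has_derivative_continuous)
  with h'(1) show ?thesis by (auto simp: C1_def)
qed

theorem theorem4:
  fixes own :: "'n::finite \<Rightarrow> 'i::finite"
    and \<Omega> :: "'i \<Rightarrow> (real^'n) set"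
    and g :: "'i \<Rightarrow> real^'n \<Rightarrow> real^'m"
    and M :: "real^'n^'b"
    and d :: "'i \<Rightarrow> real^'b"
    and f :: "'i \<Rightarrow> real^'n \<Rightarrow> real^'b \<Rightarrow> real"
    and E :: "('i \<times> 'i) set"
    and \<mu> \<theta> \<theta>\<^sub>\<sigma> c :: real
    and u0 :: "(real^'n) \<times> (real^'b^'i) \<times> (real^'m^'i) \<times> (real^'m^'i)"
  assumes N_ge_2: "2 \<le> CARD('i)"
    and f_diff: "\<And>i x s. (\<lambda>(y, r). f i (blk own i y) r) differentiable (at (x, s))"
    and \<Omega>_block: "\<And>i. \<Omega> i \<subseteq> range (blk own i)"
    and \<Omega>_closed: "\<And>i. closed (\<Omega> i)"
    and \<Omega>_convex: "\<And>i. convex (\<Omega> i)"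
    and g_convex: "\<And>i j. convex_on (range (blk own i)) (\<lambda>y. g i y $ j)"
    and g_C2: "\<And>i. C2 (\<lambda>y. g i (blk own i y))"
    and slater: "\<exists>x\<in>joint own \<Omega>. \<forall>j. coupling own g x $ j < 0"
    and J_C1: "\<And>i. C1 (cost own M d f i)"
    and J_convex: "\<And>i x. convex_on (range (blk own i)) (\<lambda>y. cost own M d f i (deviate own i y x))"
    and \<mu>_pos: "\<mu> > 0"
    and F_strongly_monotone: "\<And>x y. (pseudo_grad own M d f x - pseudo_grad own M d f y) \<bullet> (x - y)
                                \<ge> \<mu> * (norm (x - y))\<^sup>2"
    and graph_undirected: "sym E"
    and graph_connected: "\<And>i j. (i, j) \<in> E\<^sup>*"
    and \<theta>_pos: "\<theta> > 0"
    and Ft_lipschitz: "\<theta>-lipschitz_on UNIV (\<lambda>(x, \<sigma>). ext_pseudo_grad own M f x \<sigma>)"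
    and \<theta>\<sigma>_range: "0 < \<theta>\<^sub>\<sigma>" "\<theta>\<^sub>\<sigma> \<le> \<theta>"
    and Ft_lipschitz_\<sigma>: "\<And>x. \<theta>\<^sub>\<sigma>-lipschitz_on UNIV (ext_pseudo_grad own M f x)"
    and c_large: "c > \<theta>\<^sub>\<sigma>\<^sup>2 / (4 * \<mu> * lambda2 (laplacian E))"
    and init: "u0 \<in> state_set own \<Omega>"
  shows "\<exists>u. caratheodory_solution (dynamics own \<Omega> g M d f (laplacian E) c) u0 u \<and>
             (\<forall>v. caratheodory_solution (dynamics own \<Omega> g M d f (laplacian E) c) u0 v
                    \<longrightarrow> (\<forall>t\<ge>0. v t = u t)) \<and>
             (\<forall>t\<ge>0. u t \<in> state_set own \<Omega>) \<and>
             (\<exists>x s z l l'.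
                (u \<longlongrightarrow> (x, s, z, l)) at_top \<and>
                dynamics own \<Omega> g M d f (laplacian E) c (x, s, z, l) = 0 \<and>
                psi_stack own M d x + s = (\<chi> i. psi own M d x) \<and>
                l = (\<chi> i. l') \<and>
                KKT own \<Omega> g M d f x l' \<and>
                is_vGNE own \<Omega> g M d f x \<and>
                (\<forall>y. is_vGNE own \<Omega> g M d f y \<longrightarrow> y = x))"
proof -
  interpret aggregative_dynamics own \<Omega> g M d f \<mu> \<theta> E \<theta>\<^sub>\<sigma> c
  proof
    show "C1 (\<lambda>y. g i (blk own i y))" for i
      by (rule C2_imp_C1[OF g_C2])
  qed (fact f_diff \<Omega>_closed \<Omega>_convex g_convex slater J_convex \<mu>_pos F_strongly_monotone Ft_lipschitz
      N_ge_2 graph_undirected graph_connected \<theta>\<sigma>_range Ft_lipschitz_\<sigma> c_large)+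
  show ?thesis by (rule solution_exists_unique_converges[OF init])
qed

end
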